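(* Let $X$ be a Markov process on a finite set $\Omega_0$ with intensity matrix $\lambda$, let $\{\Gamma_k, k\in K\}$ be a finite nonempty collection of subsets of $\Omega_0$ such that $\Omega_0\setminus\bigcup_{k\in K}\Gamma_k\neq\emptyset$, and let $\alpha$ be a probability distribution on $\Omega_0$ (a row vector) which puts its full mass on $\Omega_0\setminus\bigcup_{k\in K}\Gamma_k$. For $k\in K$ let $\tau_k=\inf\{u\in(0,\infty): X_u\in\Gamma_k\}$ and $\tau=(\tau_k,k\in K)$. Then for every partition $s$ of $K$, the distribution of $\tau$ under $P_\alpha$ restricted to the set $R_s\subset\mathbb{R}_+^K$ has density $$f(\alpha,t,K)=\alpha\left(\prod_{n=1}^{|s|} e^{\boldsymbol{\lambda}(W_n)(\bar t_n-\bar t_{n-1})}\,\boldsymbol{\lambda}(W_n,T_n)\right)\mathbf{1},\qquad t\in R_s,$$ with respect to the $|s|$-dimensional Lebesgue measure $d_s t$ on $R_s$; that is, $P_\alpha(\tau\in U)=\int_U f(\alpha,t,K)\,d_st$ for every Borel set $U\subset R_s$. Here $\bar t_n, W_n, T_n$ (which depend on $s$, $t$ and $\{\Gamma_k\}$) are as defined in the context.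
   Context: Process: $\Omega_0$ is a finite set and $X=(X_u)_{u\ge 0}$ is an $\Omega_0$-valued continuous time process (right-continuous, piecewise constant paths) on a measurable space $(\Omega,\mathscr{F})$ with measures $P_i$, $i\in\Omega_0$, such that $P_i(X_0=i)=1$ and under each $P_i$, $X$ is a time-homogeneous Markov process with intensity matrix $\lambda$ (off-diagonal entries are jump rates, $-\lambda(i,i)=\sum_{j\ne i}\lambda(i,j)$). For a probability distribution $\alpha$ on $\Omega_0$, $P_\alpha=\sum_i\alpha(i)P_i$. Matrices: for $a,b\subset\Omega_0$, $\boldsymbol{\lambda}(a,b)$ is the $\Omega_0\times\Omega_0$ matrix whose $(i,j)$ entry is $\lambda(i,j)$ if $i\in a$, $j\in b$, and $0$ otherwise (diagonal entries included when $i=j\in a\cap b$); $\boldsymbol{\lambda}(a)=\boldsymbol{\lambda}(a,a)$. $e^{M}$ is the matrix exponential, $\mathbf 1$ is the column vector of ones indexed by $\Omega_0$, and $\prod_{n=1}^m M_n=M_1M_2\cdots M_m$ in this order. Partitions: a subpartition $s=(s(1),\dots,s(|s|))$ of $K$ is an ordered sequence of disjoint nonempty subsets of $K$; it is a partition if the union of its components is $K$. $s(n,1)$ denotes an (arbitrary) first element of $s(n)$. $L^m s=(s(m+1),\dots,s(|s|))$. For a subpartition $s$, $S(s)=\bigcup_{n=1}^{|s|}\bigcup_{k\in s(n)}\Gamma_k$ (so $S$ of the empty subpartition is $\emptyset$). For a partition $s$ of $K$, $R_s$ is the set of $t\in\mathbb{R}_+^K$ such that $t_{k_1}=t_{k_2}$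 whenever $k_1,k_2$ belong to the same component of $s$, and $t_{s(1,1)}<t_{s(2,1)}<\cdots<t_{s(|s|,1)}$. The $|s|$-dimensional Lebesgue measure $d_st$ on $R_s$ is the image of Lebesgue measure on $\{r\in\mathbb{R}_+^{|s|}: r_1<\dots<r_{|s|}\}$ under the map $r\mapsto t$ with $t_k=r_n$ for $k\in s(n)$. For a partition $s$ of $K$, $t\in R_s$ and $n\in\{1,\dots,|s|\}$: $\bar t_n=t_{s(n,1)}$, $\bar t_0=0$, $W_n=\Omega_0\setminus S(L^{n-1}s)$ (also for $n=|s|+1$, so $W_{|s|+1}=\Omega_0$), and $T_n=\left[\bigcap_{k\in s(n)}\Gamma_k\right]\cap W_{n+1}$. *)

theory Defs
  imports "HOL-Probability.Probability"
begin

section \<open>Finite-state Markov processes in continuous time\<close>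

definition intensity_matrix :: "real ^ 'o ^ 'o::finite \<Rightarrow> bool" where
  "intensity_matrix \<Lambda> \<longleftrightarrow>
     (\<forall>i j. i \<noteq> j \<longrightarrow> 0 \<le> \<Lambda> $ i $ j) \<and>
     (\<forall>i. - (\<Lambda> $ i $ i) = (\<Sum>j\<in>UNIV - {i}. \<Lambda> $ i $ j))"

text \<open>The state space carries the discrete topology, so right-continuity at \<open>u\<close> means being
  constant on some \<open>[u, u + \<epsilon>)\<close>. In the second definition \<open>D\<close> collects the jump times up to
  time \<open>b\<close>.\<close>

definition right_continuous_path :: "(real \<Rightarrow> 'o) \<Rightarrow> bool" where
  "right_continuous_path x \<longleftrightarrow> (\<forall>u\<ge>0. \<forall>\<^sub>F v in at_right u. x v = x u)"

definition piecewise_constant_path :: "(real \<Rightarrow> 'o) \<Rightarrow> bool" where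
  "piecewise_constant_path x \<longleftrightarrow>
     (\<forall>b\<ge>0. \<exists>D. finite D \<and>
        (\<forall>u v. 0 \<le> u \<and> u \<le> v \<and> v \<le> b \<and> {u..v} \<inter> D = {} \<longrightarrow> x u = x v))"

definition history :: "'w measure \<Rightarrow> (real \<Rightarrow> 'w \<Rightarrow> 'o) \<Rightarrow> real \<Rightarrow> 'w measure" where
  "history M X u = sigma (space M) {X v -` B \<inter> space M | v B. 0 \<le> v \<and> v \<le> u}"

definition transition_prob ::
  "('o \<Rightarrow> 'w measure) \<Rightarrow> (real \<Rightarrow> 'w \<Rightarrow> 'o) \<Rightarrow> real \<Rightarrow> 'o \<Rightarrow> 'o \<Rightarrow> real" where
  "transition_prob P X h i j = measure (P i) {\<omega> \<in> space (P i). X h \<omega> = j}"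

text \<open>Only the measurable space underlying \<open>M\<close> is used. The Markov property is stated with the
  conditional expectation given the natural filtration; the intensity matrix is the right
  derivative at \<open>0\<close> of the transition function. Only the values of \<open>X\<close> at nonnegative times
  matter.\<close>

locale finite_markov_process =
  fixes M :: "'w measure"
    and P :: "'o::finite \<Rightarrow> 'w measure"
    and X :: "real \<Rightarrow> 'w \<Rightarrow> 'o"
    and \<Lambda> :: "real ^ 'o ^ 'o"
  assumes prob_space_P: "\<And>i. prob_space (P i)"
    and sets_P: "\<And>i. sets (P i) = sets M"
    and measurable_X: "\<And>u. 0 \<le> u \<Longrightarrow> X u \<in> measurable M (count_space UNIV)"
    and right_continuous: "\<And>\<omega>. \<omega> \<in> space M \<Longrightarrow> right_continuous_path (\<lambda>u. X u \<omega>)"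
    and piecewise_constant: "\<And>\<omega>. \<omega> \<in> space M \<Longrightarrow> piecewise_constant_path (\<lambda>u. X u \<omega>)"
    and initial: "\<And>i. measure (P i) {\<omega> \<in> space M. X 0 \<omega> = i} = 1"
    and markov: "\<And>i j u h. 0 \<le> u \<Longrightarrow> 0 \<le> h \<Longrightarrow>
       AE \<omega> in P i.
         real_cond_exp (P i) (history M X u) (indicator {\<omega> \<in> space M. X (u + h) \<omega> = j}) \<omega>
           = transition_prob P X h (X u \<omega>) j"
    and intensity: "intensity_matrix \<Lambda>"
    and jump_rates: "\<And>i j.
       ((\<lambda>h. transition_prob P X h i j) has_real_derivative \<Lambda> $ i $ j) (at 0 within {0..})"

definition prob_vector :: "real ^ 'o::finite \<Rightarrow> bool" where
  "prob_vector \<alpha> \<longleftrightarrow> (\<forall>i. 0 \<le> \<alpha> $ i) \<and> (\<Sum>i\<in>UNIV. \<alpha> $ i) = 1"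

definition mixture :: "'w measure \<Rightarrow> ('o \<Rightarrow> 'w measure) \<Rightarrow> real ^ 'o::finite \<Rightarrow> 'w measure" where
  "mixture M P \<alpha> =
     measure_of (space M) (sets M) (\<lambda>A. \<Sum>i\<in>UNIV. ennreal (\<alpha> $ i) * emeasure (P i) A)"

text \<open>The infimum of the empty set is \<open>\<infinity>\<close>, hence the extended reals.\<close>

definition hitting_time :: "(real \<Rightarrow> 'w \<Rightarrow> 'o) \<Rightarrow> 'o set \<Rightarrow> 'w \<Rightarrow> ereal" where
  "hitting_time X G \<omega> = Inf (ereal ` {u. 0 < u \<and> X u \<omega> \<in> G})"

section \<open>Matrices\<close>

definition block :: "real ^ 'o ^ 'o \<Rightarrow> 'o set \<Rightarrow> 'o set \<Rightarrow> real ^ 'o ^ 'o::finite" where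
  "block \<Lambda> a b = (\<chi> i j. if i \<in> a \<and> j \<in> b then \<Lambda> $ i $ j else 0)"

text \<open>The product \<open>(*)\<close> on \<^typ>\<open>real ^ 'o ^ 'o\<close>, and with it the library's powers, is entrywise,
  so powers for \<open>(**)\<close> are needed. The series converges in the topology of entrywise
  convergence.\<close>

definition matrix_power :: "real ^ 'o ^ 'o \<Rightarrow> nat \<Rightarrow> real ^ 'o ^ 'o::finite" where
  "matrix_power A n = (((**) A) ^^ n) (mat 1)"

definition matrix_exp :: "real ^ 'o ^ 'o \<Rightarrow> real ^ 'o ^ 'o::finite" where
  "matrix_exp A = (\<Sum>n. (1 / fact n) *\<^sub>R matrix_power A n)"

text \<open>\<open>matrix_prod F m = F 1 ** F 2 ** \<dots> ** F m\<close>.\<close>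

primrec matrix_prod :: "(nat \<Rightarrow> real ^ 'o ^ 'o) \<Rightarrow> nat \<Rightarrow> real ^ 'o ^ 'o::finite" where
  "matrix_prod F 0 = mat 1"
| "matrix_prod F (Suc m) = matrix_prod F m ** F (Suc m)"

section \<open>Ordered partitions\<close>

text \<open>A subpartition is a list of sets. Components are numbered from 1.\<close>

definition component :: "'k set list \<Rightarrow> nat \<Rightarrow> 'k set" where
  "component s n = s ! (n - 1)"

definition first_element :: "'k set list \<Rightarrow> nat \<Rightarrow> 'k" where
  "first_element s n = (SOME k. k \<in> component s n)"

definition subpartition :: "'k set \<Rightarrow> 'k set list \<Rightarrow> bool" where
  "subpartition K s \<longleftrightarrow>
     (\<forall>n\<in>{1..length s}. component s n \<noteq> {} \<and> component s n \<subseteq> K) \<and>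
     (\<forall>m\<in>{1..length s}. \<forall>n\<in>{1..length s}. m \<noteq> n \<longrightarrow> component s m \<inter> component s n = {})"

definition ordered_partition :: "'k set \<Rightarrow> 'k set list \<Rightarrow> bool" where
  "ordered_partition K s \<longleftrightarrow>
     subpartition K s \<and> (\<Union>n\<in>{1..length s}. component s n) = K"

definition covered :: "('k \<Rightarrow> 'o set) \<Rightarrow> 'k set list \<Rightarrow> 'o set" where
  "covered \<Gamma> s = (\<Union>n\<in>{1..length s}. \<Union>k\<in>component s n. \<Gamma> k)"

text \<open>The points of \<open>\<real>\<^sub>+\<^sup>K\<close> are the functions on \<open>K\<close> extended by \<^const>\<open>undefined\<close>, i.e.\ the
  elements of \<^term>\<open>space (Pi\<^sub>M K (\<lambda>_. borel))\<close>.\<close>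

definition region :: "'k set \<Rightarrow> 'k set list \<Rightarrow> ('k \<Rightarrow> real) set" where
  "region K s = {t \<in> K \<rightarrow>\<^sub>E {0..}.
     (\<forall>n\<in>{1..length s}. \<forall>k\<in>component s n. \<forall>l\<in>component s n. t k = t l) \<and>
     (\<forall>m\<in>{1..length s}. \<forall>n\<in>{1..length s}. m < n \<longrightarrow>
        t (first_element s m) < t (first_element s n))}"

definition increasing_tuples :: "nat \<Rightarrow> (nat \<Rightarrow> real) set" where
  "increasing_tuples m = {r \<in> {1..m} \<rightarrow>\<^sub>E {0..}. strict_mono_on {1..m} r}"

definition spread :: "'k set \<Rightarrow> 'k set list \<Rightarrow> (nat \<Rightarrow> real) \<Rightarrow> 'k \<Rightarrow> real" where
  "spread K s r = (\<lambda>k\<in>K. r (THE n. n \<in> {1..length s} \<and> k \<in> component s n))"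

text \<open>The measure \<open>d\<^sub>s t\<close>, as a measure on all of \<open>\<real>\<^sup>K\<close> that is concentrated on \<open>region K s\<close>.\<close>

definition region_measure :: "'k set \<Rightarrow> 'k set list \<Rightarrow> ('k \<Rightarrow> real) measure" where
  "region_measure K s =
     distr (restrict_space (Pi\<^sub>M {1..length s} (\<lambda>_. lborel)) (increasing_tuples (length s)))
       (Pi\<^sub>M K (\<lambda>_. borel)) (spread K s)"

section \<open>The density\<close>

definition tbar :: "'k set list \<Rightarrow> ('k \<Rightarrow> real) \<Rightarrow> nat \<Rightarrow> real" where
  "tbar s t n = (if n = 0 then 0 else t (first_element s n))"

definition W :: "('k \<Rightarrow> 'o set) \<Rightarrow> 'k set list \<Rightarrow> nat \<Rightarrow> 'o set" where
  "W \<Gamma> s n = UNIV - covered \<Gamma> (drop (n - 1) s)"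

definition T :: "('k \<Rightarrow> 'o set) \<Rightarrow> 'k set list \<Rightarrow> nat \<Rightarrow> 'o set" where
  "T \<Gamma> s n = (\<Inter>k\<in>component s n. \<Gamma> k) \<inter> W \<Gamma> s (n + 1)"

definition hitting_density ::
  "real ^ 'o ^ 'o \<Rightarrow> ('k \<Rightarrow> 'o set) \<Rightarrow> 'k set list \<Rightarrow> real ^ 'o::finite \<Rightarrow> ('k \<Rightarrow> real) \<Rightarrow> real" where
  "hitting_density \<Lambda> \<Gamma> s \<alpha> t =
     (\<alpha> v* matrix_prod
        (\<lambda>n. matrix_exp ((tbar s t n - tbar s t (n - 1)) *\<^sub>R block \<Lambda> (W \<Gamma> s n) (W \<Gamma> s n))
               ** block \<Lambda> (W \<Gamma> s n) (T \<Gamma> s n))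
        (length s)) \<bullet> (\<chi> i. 1)"

end

theory Submission
  imports Defs
begin

text \<open>
  For a box of values \<open>r 1 \<in> (a 1, b 1]\<close>, \<open>\<dots>\<close>, \<open>r m \<in> (a m, b m]\<close> with \<open>b n \<le> a (n + 1)\<close>, the hitting
  times follow the pattern \<open>s\<close> with \<open>t\<^sub>n = r n\<close> in the box iff the path stays in \<open>W n\<close> on
  \<open>[b (n - 1), a n]\<close> and, on \<open>(a n, b n]\<close>, leaves \<open>W n\<close> by entering \<open>T n\<close> and then stays in
  \<open>W (n + 1)\<close>. By the Markov property the probability of this is a product of matrices
  \<open>p h\<close> (staying in \<open>W\<close> for time \<open>h\<close>) and \<open>q h\<close> (crossing from \<open>W\<close> through \<open>T\<close> into \<open>W'\<close>). They satisfy
  \<open>p (h + k) = p h p k\<close> and \<open>q (h + k) = p h q k + q h p' k\<close>. To first order in \<open>h\<close>, paths from \<open>i\<close> to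
  \<open>j\<close> only visit \<open>i\<close> and \<open>j\<close>, which gives the derivatives at \<open>0\<close>; hence \<open>p h\<close> is the exponential of the
  block of the intensity matrix and \<open>q h\<close> is the integral over \<open>u \<in> [0, h]\<close> of
  \<open>p u\<close> times the block of jump rates from \<open>W\<close> to \<open>T\<close> times \<open>p' (h - u)\<close>. So the law of the hitting times
  and the claimed density agree on boxes, and boxes generate the Borel sets of increasing tuples.
\<close>

section \<open>Matrices\<close>

text \<open>No jump chain is constructed, so the first-order claim is the main obstacle: jump rates
  control the state at single times, not the path in between. Staying in {i, j} is bounded below
  along dyadic grids, uniformly in the mesh; this bound already exhausts the first-order part of the
  transition probability from i to j, so everything else is o(h).

  Staying in W for time 0 gives the projection onto W, not the identity, so p h is this projection
  times the exponential. Next to a crossing factor the projection is absorbed.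

  Each integral for q leaves an exponential of the next block up to time b n. It merges with the two
  exponentials that follow into a single one over the time from r n to r (n + 1). The last such tail
  is a stochastic matrix and disappears when the final state is summed out.

  The region contains points with r 1 = 0, whereas hitting times are positive and boxes avoid 0.
  \<open>pos_increasing\<close> removes this hyperplane, which carries no mass on either
  side.\<close>

lemma bounded_bilinear_matrix_matrix_mult:
  "bounded_bilinear ((**) :: real ^ 'n ^ 'm \<Rightarrow> real ^ 'p ^ 'n \<Rightarrow> real ^ 'p ^ 'm)"
  unfolding bilinear_conv_bounded_bilinear[symmetric] bilinear_def
  by (auto intro!: linearI simp: matrix_add_ldistrib matrix_matrix_mult_def vec_eq_iff
        algebra_simps sum.distrib sum_distrib_left)

text \<open>Makes the limit, continuity, derivative and norm rules of bounded bilinear maps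
  available for \<open>**\<close>, where the rules of the type class concern the entrywise
  product.\<close>

interpretation matmul: bounded_bilinear
  "(**) :: real ^ 'n ^ 'm \<Rightarrow> real ^ 'p ^ 'n \<Rightarrow> real ^ 'p ^ 'm"
  by (rule bounded_bilinear_matrix_matrix_mult)

section \<open>Powers and the exponential of a matrix\<close>

lemma matrix_power_0 [simp]: "matrix_power A 0 = mat 1"
  by (simp add: matrix_power_def)

lemma matrix_power_Suc: "matrix_power A (Suc n) = A ** matrix_power A n"
  by (simp add: matrix_power_def)

lemma matrix_power_commutes:
  assumes "A ** B = B ** A"
  shows "matrix_power A n ** B = B ** matrix_power A n"
proof (induction n)
  case (Suc n)
  have "matrix_power A (Suc n) ** B = A ** (B ** matrix_power A n)"
    by (simp add: matrix_power_Suc Suc flip: matrix_mul_assoc)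
  also have "\<dots> = B ** matrix_power A (Suc n)"
    by (simp add: matrix_power_Suc assms matrix_mul_assoc)
  finally show ?case .
qed simp

lemma matrix_power_scaleR: "matrix_power (c *\<^sub>R A) n = c ^ n *\<^sub>R matrix_power A n"
  by (induction n) (simp_all add: matrix_power_Suc matmul.scaleR_left matmul.scaleR_right)

lemma summable_matrix_exp:
  fixes A :: "real ^ 'a ^ 'a"
  shows "summable (\<lambda>n. (1 / fact n) *\<^sub>R matrix_power A n)"
proof -
  \<comment> \<open>The norm is submultiplicative for \<open>**\<close> only up to a factor
    \<open>K\<close>, so the majorant is the real exponential series at
    \<open>K * norm A\<close>.\<close>
  obtain K where K: "K \<ge> 0"
    "\<And>(B :: real ^ 'a ^ 'a) (C :: real ^ 'a ^ 'a). norm (B ** C) \<le> norm B * norm C * K"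
    using matmul.nonneg_bounded by blast
  have pow: "norm (matrix_power A n) \<le> (K * norm A) ^ n * norm (mat 1 :: real ^ 'a ^ 'a)" for n
  proof (induction n)
    case (Suc n)
    have "norm (matrix_power A (Suc n)) \<le> (K * norm A) * norm (matrix_power A n)"
      using K(2)[of A "matrix_power A n"] by (simp add: matrix_power_Suc mult_ac)
    also have "\<dots> \<le> (K * norm A) * ((K * norm A) ^ n * norm (mat 1 :: real ^ 'a ^ 'a))"
      using Suc K(1) by (intro mult_left_mono) auto
    finally show ?case by (simp add: mult_ac)
  qed simp
  have "summable (\<lambda>n. inverse (fact n) * (K * norm A) ^ n * norm (mat 1 :: real ^ 'a ^ 'a))"
    by (intro summable_mult2 summable_exp)
  then show ?thesis
  proof (rule summable_comparison_test[rotated], intro exI[of _ 0] allI impI)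
    fix n :: nat
    show "norm ((1 / fact n) *\<^sub>R matrix_power A n)
      \<le> inverse (fact n) * (K * norm A) ^ n * norm (mat 1 :: real ^ 'a ^ 'a)"
      using mult_left_mono[OF pow[of n], of "1 / fact n"] by (simp add: divide_inverse)
  qed
qed

lemma sums_matrix_exp: "(\<lambda>n. (1 / fact n) *\<^sub>R matrix_power A n) sums matrix_exp A"
  unfolding matrix_exp_def by (rule summable_sums[OF summable_matrix_exp])

lemma matrix_exp_0 [simp]: "matrix_exp 0 = mat 1"
proof -
  have "(1 / fact n) *\<^sub>R matrix_power 0 n = (if n = 0 then mat 1 else 0 :: real ^ 'a ^ 'a)" for n
    by (cases n) (simp_all add: matrix_power_Suc matmul.zero_left)
  then show ?thesis
    using sums_matrix_exp[of "0 :: real ^ 'a ^ 'a"] sums_single[of 0 "\<lambda>_. mat 1 :: real ^ 'a ^ 'a"]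
    by (simp add: sums_iff)
qed

lemma matrix_exp_commutes:
  assumes "A ** B = B ** A"
  shows "matrix_exp A ** B = B ** matrix_exp A"
proof -
  have "(\<lambda>n. ((1 / fact n) *\<^sub>R matrix_power A n) ** B) sums (matrix_exp A ** B)"
    by (intro bounded_linear.sums[OF matmul.bounded_linear_left] sums_matrix_exp)
  moreover have "(\<lambda>n. B ** ((1 / fact n) *\<^sub>R matrix_power A n)) sums (B ** matrix_exp A)"
    by (intro bounded_linear.sums[OF matmul.bounded_linear_right] sums_matrix_exp)
  ultimately show ?thesis
    by (simp add: matmul.scaleR_left matmul.scaleR_right matrix_power_commutes[OF assms]
        sums_unique2)
qed

lemma matrix_exp_scaleR_commutes: "matrix_exp (c *\<^sub>R A) ** A = A ** matrix_exp (c *\<^sub>R A)"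
  by (rule matrix_exp_commutes) (simp add: matmul.scaleR_left matmul.scaleR_right)

lemma has_vector_derivative_matrix_iff:
  fixes f :: "real \<Rightarrow> real ^ 'm ^ 'n"
  shows "(f has_vector_derivative D) (at x within S) \<longleftrightarrow>
    (\<forall>i j. ((\<lambda>y. f y $ i $ j) has_real_derivative D $ i $ j) (at x within S))"
  unfolding has_vector_derivative_def
  by (subst has_derivative_componentwise_within)
    (auto simp: Basis_vec_def inner_axis has_field_derivative_def mult.commute[of _ "_ $ _ $ _"])

text \<open>Every entry is an everywhere convergent real power series, so termwise differentiation
  applies. The shift of coefficients in \<open>diffs\<close> turns into left multiplication by
  \<open>A\<close> through \<open>matrix_power_Suc\<close>.\<close>

lemma has_vector_derivative_matrix_exp:
  "((\<lambda>x. matrix_exp (x *\<^sub>R A)) has_vector_derivative A ** matrix_exp (x *\<^sub>R A)) (at x within S)"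
proof -
  define c where "c i j n = matrix_power A n $ i $ j / fact n" for i j n
  have sums: "(\<lambda>n. c i j n * y ^ n) sums (matrix_exp (y *\<^sub>R A) $ i $ j)" for i j y
    using bounded_linear.sums[OF bounded_linear_vec_nth bounded_linear.sums[OF bounded_linear_vec_nth
        sums_matrix_exp[of "y *\<^sub>R A"], of i], of j]
    by (simp add: c_def matrix_power_scaleR mult_ac)
  have diffs: "diffs (c i j) n = (\<Sum>k\<in>UNIV. A $ i $ k * c k j n)" for i j n
    by (simp add: diffs_def c_def matrix_power_Suc matrix_matrix_mult_def sum_divide_distrib
        sum_distrib_left)
  have "((\<lambda>y. matrix_exp (y *\<^sub>R A) $ i $ j) has_real_derivative (A ** matrix_exp (x *\<^sub>R A)) $ i $ j)
      (at x)" for i j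
  proof -
    have "((\<lambda>y. \<Sum>n. c i j n * y ^ n) has_real_derivative (\<Sum>n. diffs (c i j) n * x ^ n)) (at x)"
      by (intro termdiffs_strong_converges_everywhere sums_summable[OF sums])
    moreover have "(\<lambda>n. \<Sum>k\<in>UNIV. A $ i $ k * (c k j n * x ^ n))
        sums (\<Sum>k\<in>UNIV. A $ i $ k * (matrix_exp (x *\<^sub>R A) $ k $ j))"
      by (intro sums_sum sums_mult sums)
    then have "(\<Sum>n. diffs (c i j) n * x ^ n) = (A ** matrix_exp (x *\<^sub>R A)) $ i $ j"
      by (simp add: diffs sums_iff matrix_matrix_mult_def sum_distrib_right mult.assoc)
    ultimately show ?thesis
      by (simp add: sums_unique[OF sums, symmetric])
  qed
  then have "((\<lambda>y. matrix_exp (y *\<^sub>R A)) has_vector_derivative A ** matrix_exp (x *\<^sub>R A)) (at x)"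
    by (simp add: has_vector_derivative_matrix_iff)
  then show ?thesis by (rule has_vector_derivative_at_within)
qed

lemma continuous_matrix_exp [continuous_intros]:
  assumes "continuous_on S f"
  shows "continuous_on S (\<lambda>x. matrix_exp (f x *\<^sub>R A))"
proof -
  have "continuous_on UNIV (\<lambda>x. matrix_exp (x *\<^sub>R A))"
    by (rule continuous_on_vector_derivative) (rule has_vector_derivative_matrix_exp)
  from continuous_on_compose2[OF this assms] show ?thesis by simp
qed

text \<open>The product \<open>G t\<close> is constant in t: its two derivative terms cancel because
  \<open>A\<close> commutes with its exponential. The values at t = 0 and t = x are the two
  sides.\<close>

lemma matrix_exp_add: "matrix_exp ((x + y) *\<^sub>R A) = matrix_exp (x *\<^sub>R A) ** matrix_exp (y *\<^sub>R A)"
proof -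
  define G where "G t = matrix_exp (t *\<^sub>R A) ** matrix_exp ((x + y - t) *\<^sub>R A)" for t
  have "(G has_vector_derivative 0) (at t)" for t
  proof -
    have 1: "((\<lambda>t. matrix_exp ((x + y - t) *\<^sub>R A)) has_vector_derivative
        - 1 *\<^sub>R (A ** matrix_exp ((x + y - t) *\<^sub>R A))) (at t)"
      by (rule vector_diff_chain_at[of "\<lambda>t. x + y - t" "-1", unfolded o_def])
        (auto intro!: derivative_eq_intros has_vector_derivative_matrix_exp)
    have "(G has_vector_derivative matrix_exp (t *\<^sub>R A) ** (- 1 *\<^sub>R (A ** matrix_exp ((x + y - t) *\<^sub>R A)))
        + (A ** matrix_exp (t *\<^sub>R A)) ** matrix_exp ((x + y - t) *\<^sub>R A)) (at t)"
      unfolding G_def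
      by (rule bounded_bilinear.has_vector_derivative[OF bounded_bilinear_matrix_matrix_mult
            has_vector_derivative_matrix_exp 1])
    then show ?thesis
      by (simp add: matmul.minus_right matrix_mul_assoc matrix_exp_scaleR_commutes)
  qed
  then obtain c where "G t = c" for t
    using has_vector_derivative_zero_constant[of UNIV G] by auto
  then have "G 0 = G x" by simp
  then show ?thesis by (simp add: G_def)
qed

lemma matrix_matrix_mult_nth: "(A ** B) $ i $ j = (\<Sum>k\<in>UNIV. A $ i $ k * B $ k $ j)"
  by (simp add: matrix_matrix_mult_def)

section \<open>Limits and derivatives obtained from increments\<close>

lemma tendsto_matrixI:
  fixes f :: "'a \<Rightarrow> real ^ 'm ^ 'n"
  assumes "\<And>i j. ((\<lambda>x. f x $ i $ j) \<longlongrightarrow> a $ i $ j) F"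
  shows "(f \<longlongrightarrow> a) F"
  by (intro vec_tendstoI assms)

lemma has_vector_derivative_matrixI:
  fixes G :: "real \<Rightarrow> real ^ 'm ^ 'n"
  assumes "((\<lambda>y. (1 / (y - t)) *\<^sub>R (G y - G t)) \<longlongrightarrow> D) (at t within S)"
  shows "(G has_vector_derivative D) (at t within S)"
  unfolding has_vector_derivative_matrix_iff has_field_derivative_iff
  using tendsto_vec_nth[OF tendsto_vec_nth[OF assms]] by simp

text \<open>Cut the interval into n + 1 equal pieces of length \<delta>. The total increment is at
  most (n + 1) g(\<delta>), which equals (b - a) g(\<delta>) / \<delta> and tends to 0. The bound
  \<open>g\<close> depends only on the length of a piece, not on its position.\<close>

lemma increments_small_imp_eq:
  fixes G :: "real \<Rightarrow> 'a :: real_normed_vector"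
  assumes ab: "a \<le> b"
    and le: "\<And>s t. a \<le> s \<Longrightarrow> s < t \<Longrightarrow> t \<le> b \<Longrightarrow> norm (G t - G s) \<le> g (t - s)"
    and g: "((\<lambda>k. g k / k) \<longlongrightarrow> 0) (at_right 0)"
  shows "G b = G a"
proof (cases "a = b")
  case False
  define \<delta> where "\<delta> n = (b - a) / real (Suc n)" for n
  have pos: "0 < \<delta> n" for n using False ab by (simp add: \<delta>_def)
  have "\<delta> \<longlonglongrightarrow> 0"
    unfolding \<delta>_def using LIMSEQ_Suc[OF tendsto_divide_0[OF tendsto_const filterlim_real_sequentially[THEN filterlim_at_top_imp_at_infinity]]]
    by simp
  then have \<delta>: "filterlim \<delta> (at_right 0) sequentially"
    using pos by (auto simp: filterlim_at less_imp_neq[THEN not_sym])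
  have bound: "norm (G b - G a) \<le> (b - a) * (g (\<delta> n) / \<delta> n)" for n
  proof -
    define x where "x m = a + real m * \<delta> n" for m
    have x: "x 0 = a" "x (Suc n) = b" by (simp_all add: x_def \<delta>_def)
    have "G b - G a = (\<Sum>m<Suc n. G (x (Suc m)) - G (x m))"
      using sum_lessThan_telescope[of "\<lambda>m. G (x m)" "Suc n"] x by simp
    also have "norm \<dots> \<le> (\<Sum>m<Suc n. g (\<delta> n))"
    proof (rule sum_norm_le)
      fix m assume "m \<in> {..<Suc n}"
      then have "real (Suc m) * \<delta> n \<le> real (Suc n) * \<delta> n" using pos[of n] by (intro mult_right_mono) auto
      then have "x (Suc m) \<le> x (Suc n)" by (simp add: x_def)
      moreover have "x (Suc m) - x m = \<delta> n" by (simp add: x_def algebra_simps)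
      moreover have "a \<le> x m" using pos[of n] by (simp add: x_def)
      ultimately show "norm (G (x (Suc m)) - G (x m)) \<le> g (\<delta> n)"
        using le[of "x m" "x (Suc m)"] pos[of n] x by simp
    qed
    also have "\<dots> = real (Suc n) * g (\<delta> n)" by simp
    also have "\<dots> = (b - a) * (g (\<delta> n) / \<delta> n)"
      using False by (simp add: \<delta>_def field_simps)
    finally show ?thesis .
  qed
  have "(\<lambda>n. (b - a) * (g (\<delta> n) / \<delta> n)) \<longlonglongrightarrow> (b - a) * 0"
    by (intro tendsto_mult tendsto_const filterlim_compose[OF g \<delta>])
  then have "norm (G b - G a) \<le> (b - a) * 0"
    by (rule tendsto_lowerbound) (simp_all only: bound always_eventually trivial_limit_sequentially
        not_False_eq_True simp_thms)
  then show ?thesis by simp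
qed simp

text \<open>Meant for increments that factor into past, short middle interval and future: only the
  middle factor is small, and its rate \<open>L\<close> at 0 determines the derivative.\<close>

lemma has_vector_derivative_increments:
  fixes G :: "real \<Rightarrow> real ^ 'n ^ 'n"
  assumes inc: "\<And>s t. a \<le> s \<Longrightarrow> s < t \<Longrightarrow> t \<le> b \<Longrightarrow> G t - G s = A s ** D (t - s) ** C t"
    and A: "continuous_on UNIV A" and C: "continuous_on UNIV C"
    and D: "((\<lambda>k. (1 / k) *\<^sub>R D k) \<longlongrightarrow> L) (at_right 0)"
    and t: "t \<in> {a..b}"
  shows "(G has_vector_derivative A t ** L ** C t) (at t within {a..b})"
proof (rule has_vector_derivative_matrixI)
  let ?F = "at t within {a..b}"
  have id: "((\<lambda>y. y) \<longlongrightarrow> t) ?F" by (rule tendsto_ident_at)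
  \<comment> \<open>Both sides of t are treated at once: the interval between t and y has length
    \<open>\<bar>y - t\<bar>\<close>, left end \<open>min y t\<close> and right end
    \<open>max y t\<close>.\<close>
  have "filterlim (\<lambda>y. \<bar>y - t\<bar>) (at_right 0) ?F"
    unfolding filterlim_at
    using tendsto_rabs[OF tendsto_diff[OF id tendsto_const[of t]]]
    by (auto simp: eventually_at_filter)
  then have "((\<lambda>y. (1 / \<bar>y - t\<bar>) *\<^sub>R D \<bar>y - t\<bar>) \<longlongrightarrow> L) ?F"
    by (rule filterlim_compose[OF D])
  moreover have "((\<lambda>y. A (min y t)) \<longlongrightarrow> A t) ?F"
    using tendsto_min[OF id tendsto_const[of t]] by (intro continuous_on_tendsto_compose[OF A]) auto
  moreover have "((\<lambda>y. C (max y t)) \<longlongrightarrow> C t) ?F"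
    using tendsto_max[OF id tendsto_const[of t]] by (intro continuous_on_tendsto_compose[OF C]) auto
  ultimately have "((\<lambda>y. A (min y t) ** ((1 / \<bar>y - t\<bar>) *\<^sub>R D \<bar>y - t\<bar>) ** C (max y t)) \<longlongrightarrow> A t ** L ** C t) ?F"
    by (intro matmul.tendsto)
  then show "((\<lambda>y. (1 / (y - t)) *\<^sub>R (G y - G t)) \<longlongrightarrow> A t ** L ** C t) ?F"
  proof (rule Lim_transform_eventually)
    show "\<forall>\<^sub>F y in ?F. A (min y t) ** ((1 / \<bar>y - t\<bar>) *\<^sub>R D \<bar>y - t\<bar>) ** C (max y t) = (1 / (y - t)) *\<^sub>R (G y - G t)"
      unfolding eventually_at_filter
    proof (intro always_eventually allI impI)
      fix y assume y: "y \<noteq> t" "y \<in> {a..b}"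
      show "A (min y t) ** ((1 / \<bar>y - t\<bar>) *\<^sub>R D \<bar>y - t\<bar>) ** C (max y t) = (1 / (y - t)) *\<^sub>R (G y - G t)"
      proof (cases "t < y")
        case True
        then show ?thesis
          using inc[of t y] y t by (simp add: matmul.scaleR_left matmul.scaleR_right)
      next
        case False
        with y have "y < t" by simp
        moreover have "(1 / (y - t)) *\<^sub>R (G y - G t) = (1 / (t - y)) *\<^sub>R (G t - G y)"
        proof -
          have "1 / (y - t) = - (1 / (t - y))" by (simp add: minus_divide_right)
          then show ?thesis by (simp only: scaleR_minus_left) (simp add: scaleR_diff_right)
        qed
        ultimately show ?thesis
          using inc[of y t] y t by (simp add: matmul.scaleR_left matmul.scaleR_right)
      qed
    qed
  qed
qed

section \<open>Coordinate projections and exponentials of blocks\<close>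

lemma block_nth [simp]: "block A a b $ i $ j = (if i \<in> a \<and> j \<in> b then A $ i $ j else 0)"
  by (simp add: block_def)

text \<open>\<open>block (mat 1) V V\<close> is the projection onto the coordinates in
  \<open>V\<close>. It takes the place of the identity as the value at time 0 of staying
  probabilities.\<close>

lemma block_one_mult_nth: "(block (mat 1) V V ** A) $ i $ j = (if i \<in> V then A $ i $ j else 0)"
proof -
  have "block (mat 1) V V $ i $ k * A $ k $ j = (if k = i then if i \<in> V then A $ i $ j else 0 else 0)" for k
    by (simp add: mat_def)
  then show ?thesis by (simp add: matrix_matrix_mult_nth del: block_nth)
qed

lemma mult_block_one_nth: "(A ** block (mat 1) V V) $ i $ j = (if j \<in> V then A $ i $ j else 0)"
proof -
  have "A $ i $ k * block (mat 1) V V $ k $ j = (if k = j then if j \<in> V then A $ i $ j else 0 else 0)" for k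
    by (simp add: mat_def)
  then show ?thesis by (simp add: matrix_matrix_mult_nth del: block_nth)
qed

lemma matrix_eqI: "(\<And>i j. A $ i $ j = B $ i $ j) \<Longrightarrow> A = B"
  by (simp add: vec_eq_iff)

text \<open>Only the term n = 0 of the series survives multiplication by \<open>B\<close>.\<close>

lemma matrix_exp_annihilated:
  fixes A B :: "real ^ 'n ^ 'n"
  assumes "B ** A = 0"
  shows "B ** matrix_exp A = B"
proof -
  have "B ** ((1 / fact n) *\<^sub>R matrix_power A n) = (if n = 0 then B else 0)" for n
    by (cases n) (simp_all add: matrix_power_Suc matmul.scaleR_right matrix_mul_assoc assms matmul.zero_left)
  moreover have "(\<lambda>n. B ** ((1 / fact n) *\<^sub>R matrix_power A n)) sums (B ** matrix_exp A)"
    by (intro bounded_linear.sums[OF matmul.bounded_linear_right] sums_matrix_exp)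
  ultimately show ?thesis
    using sums_single[of 0 "\<lambda>_. B"] by (simp add: sums_iff)
qed

text \<open>The rows of the block outside \<open>V\<close> vanish, so the complementary projection
  annihilates it. This covers the rows of the exponential that are not staying
  probabilities.\<close>

lemma matrix_exp_block_outside:
  assumes "i \<notin> V"
  shows "matrix_exp (h *\<^sub>R block \<Lambda> V V) $ i $ j = of_bool (i = j)"
proof -
  let ?B = "mat 1 - block (mat 1) V V :: real ^ 'a ^ 'a"
  have "?B ** (h *\<^sub>R block \<Lambda> V V) = 0"
    by (rule matrix_eqI) (simp add: matmul.diff_left block_one_mult_nth)
  from arg_cong[OF matrix_exp_annihilated[OF this], of "\<lambda>A. A $ i $ j"] show ?thesis
    using assms by (simp add: matmul.diff_left block_one_mult_nth) (simp add: mat_def)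
qed

lemma matrix_exp_block_commutes:
  "matrix_exp (h *\<^sub>R block \<Lambda> V V) ** block (mat 1) V V = block (mat 1) V V ** matrix_exp (h *\<^sub>R block \<Lambda> V V)"
  by (intro matrix_exp_commutes matrix_eqI) (simp add: block_one_mult_nth mult_block_one_nth)

section \<open>Measurability and nonnegativity of matrix expressions\<close>

lemma borel_measurable_matrix_prod:
  fixes F :: "'a \<Rightarrow> nat \<Rightarrow> real ^ 'n ^ 'n"
  assumes "\<And>n i j. 1 \<le> n \<Longrightarrow> n \<le> k \<Longrightarrow> (\<lambda>x. F x n $ i $ j) \<in> borel_measurable M"
  shows "(\<lambda>x. matrix_prod (F x) k $ i $ j) \<in> borel_measurable M"
  using assms
proof (induction k arbitrary: j)
  case (Suc k)
  then show ?case by (simp add: matrix_matrix_mult_nth)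
qed simp

lemma borel_measurable_matrix_mult:
  fixes F :: "'a \<Rightarrow> real ^ 'k ^ 'm" and H :: "'a \<Rightarrow> real ^ 'n ^ 'k"
  assumes "\<And>i j. (\<lambda>x. F x $ i $ j) \<in> borel_measurable M" "\<And>i j. (\<lambda>x. H x $ i $ j) \<in> borel_measurable M"
  shows "(\<lambda>x. (F x ** H x) $ i $ j) \<in> borel_measurable M"
  unfolding matrix_matrix_mult_nth by (intro borel_measurable_sum borel_measurable_times assms)

lemma borel_measurable_matrix_exp:
  assumes [measurable]: "f \<in> borel_measurable M"
  shows "(\<lambda>x. matrix_exp (f x *\<^sub>R A) $ i $ j) \<in> borel_measurable M"
proof -
  have "continuous_on UNIV (\<lambda>y. matrix_exp (y *\<^sub>R A) $ i $ j)" by (intro continuous_intros)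
  from borel_measurable_continuous_onI[OF this] show ?thesis by measurable
qed

lemma matrix_mult_nonneg:
  fixes A B :: "real ^ 'n ^ 'n"
  assumes "\<And>i j. 0 \<le> A $ i $ j" "\<And>i j. 0 \<le> B $ i $ j"
  shows "0 \<le> (A ** B) $ i $ j"
  unfolding matrix_matrix_mult_nth by (intro sum_nonneg mult_nonneg_nonneg assms)

lemma matrix_prod_nonneg:
  assumes "\<And>n i j. 1 \<le> n \<Longrightarrow> n \<le> k \<Longrightarrow> 0 \<le> F n $ i $ j"
  shows "0 \<le> matrix_prod F k $ i $ j"
  using assms
proof (induction k arbitrary: i j)
  case (Suc k)
  show ?case unfolding matrix_prod.simps by (intro matrix_mult_nonneg Suc) auto
qed (simp add: mat_def)

lemma matrix_prod_cong:
  assumes "\<And>n. 1 \<le> n \<Longrightarrow> n \<le> k \<Longrightarrow> F n = H n"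
  shows "matrix_prod F k = matrix_prod H k"
  using assms by (induction k) simp_all

section \<open>The Markov property\<close>

abbreviation path_space :: "real set \<Rightarrow> (real \<Rightarrow> 'o) measure" where
  "path_space I \<equiv> Pi\<^sub>M I (\<lambda>_. count_space UNIV)"

context finite_markov_process
begin

text \<open>The restriction to \<open>{0..}\<close> makes the shifted path a point of the product
  space \<open>path_space {0..}\<close>.\<close>

definition future :: "real \<Rightarrow> 'w \<Rightarrow> real \<Rightarrow> 'o" where
  "future u \<omega> = (\<lambda>v\<in>{0..}. X (u + v) \<omega>)"

lemma space_P [simp]: "space (P i) = space M"
  using sets_P by (rule sets_eq_imp_space_eq)

lemma measurable_P [simp]: "measurable (P i) N = measurable M N"
  by (rule measurable_cong_sets) (simp_all add: sets_P)

lemma space_history [simp]: "space (history M X u) = space M"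
  by (simp add: history_def space_measure_of_conv)

lemma measurable_history: "X v \<in> measurable (history M X u) (count_space UNIV)"
  if "0 \<le> v" "v \<le> u"
proof (rule measurableI)
  fix B :: "'o set"
  show "X v -` B \<inter> space (history M X u) \<in> sets (history M X u)"
    using that unfolding space_history by (auto simp: history_def intro!: sigma_sets.Basic)
qed simp

lemma sets_history_subset: "sets (history M X u) \<subseteq> sets M"
proof -
  have "X v -` B \<inter> space M \<in> sets M" if "0 \<le> v" for v B
    using measurable_X[OF that] by (rule measurable_sets) simp
  then show ?thesis
    unfolding history_def by (subst sets_measure_of) (auto intro!: sets.sigma_sets_subset)
qed

lemma measurable_future: "0 \<le> u \<Longrightarrow> future u \<in> measurable M (path_space {0..})"
  unfolding future_def by (intro measurable_restrict measurable_X) auto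

lemma measure_eq_sum_values:
  assumes Y: "Y \<in> measurable M (count_space UNIV)" and B: "B \<in> sets M"
  shows "measure (P i) {\<omega> \<in> B. Y \<omega> \<in> S} = (\<Sum>l\<in>S. measure (P i) {\<omega> \<in> B. Y \<omega> = (l :: 'o)})"
proof -
  interpret prob_space "P i" by (rule prob_space_P)
  have "{\<omega> \<in> B. Y \<omega> = l} \<in> sets M" for l
  proof -
    have "{\<omega> \<in> B. Y \<omega> = l} = (Y -` {l} \<inter> space M) \<inter> B"
      using sets.sets_into_space[OF B] by auto
    then show ?thesis using measurable_sets[OF Y, of "{l}"] B by simp
  qed
  then have "measure (P i) (\<Union>l\<in>S. {\<omega> \<in> B. Y \<omega> = l}) = (\<Sum>l\<in>S. measure (P i) {\<omega> \<in> B. Y \<omega> = l})"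
    by (intro finite_measure_finite_Union) (auto simp: sets_P disjoint_family_on_def)
  moreover have "(\<Union>l\<in>S. {\<omega> \<in> B. Y \<omega> = l}) = {\<omega> \<in> B. Y \<omega> \<in> S}" by auto
  ultimately show ?thesis by simp
qed

text \<open>Integrate the conditional expectation of the Markov property over \<open>A\<close>. On
  \<open>A\<close> the present state is \<open>j\<close>, so the integrand is the constant
  \<open>transition_prob P X h j k\<close>.\<close>

lemma markov_step:
  assumes u: "0 \<le> u" "0 \<le> h"
    and A: "A \<in> sets (history M X u)" "A \<subseteq> {\<omega> \<in> space M. X u \<omega> = j}"
  shows "measure (P i) {\<omega> \<in> A. X (u + h) \<omega> = k} = measure (P i) A * transition_prob P X h j k"
proof -
  interpret prob_space "P i" by (rule prob_space_P)
  interpret finite_measure_subalgebra "P i" "history M X u"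
    using sets_history_subset by unfold_locales (auto simp: subalgebra_def sets_P)
  have AM [measurable]: "A \<in> sets (P i)" using A sets_history_subset by (auto simp: sets_P)
  have Xh: "X (u + h) \<in> measurable (P i) (count_space UNIV)" using measurable_X u by simp
  have B: "{\<omega> \<in> space M. X (u + h) \<omega> = k} \<in> sets (P i)"
    using measurable_sets[OF Xh, of "{k}"] by (simp add: vimage_def Int_def conj_commute)
  have "measure (P i) {\<omega> \<in> A. X (u + h) \<omega> = k}
      = (LINT \<omega>:A|P i. indicator {\<omega> \<in> space M. X (u + h) \<omega> = k} \<omega>)"
  proof -
    have "A \<inter> {\<omega> \<in> space M. X (u + h) \<omega> = k} = {\<omega> \<in> A. X (u + h) \<omega> = k}" using A by auto
    then show ?thesis using AM B sets.sets_into_space[OF AM]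
      by (simp add: set_lebesgue_integral_def flip: indicator_inter_arith)
        (simp add: Int_absorb2 subset_iff)
  qed
  also have "\<dots> = (LINT \<omega>:A|P i. real_cond_exp (P i) (history M X u)
      (indicator {\<omega> \<in> space M. X (u + h) \<omega> = k}) \<omega>)"
    using B A by (intro real_cond_exp_intA) (auto simp: integrable_indicator_iff emeasure_eq_measure
        intro!: sets.Int simp flip: space_P)
  also have "\<dots> = (LINT \<omega>:A|P i. transition_prob P X h j k)"
    unfolding set_lebesgue_integral_def
  proof (rule integral_cong_AE)
    show "AE \<omega> in P i. indicator A \<omega> *\<^sub>R real_cond_exp (P i) (history M X u)
        (indicator {\<omega> \<in> space M. X (u + h) \<omega> = k}) \<omega> = indicator A \<omega> *\<^sub>R transition_prob P X h j k"
      using markov[OF u, of i k]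
      by eventually_elim (use A in \<open>auto simp: indicator_def\<close>)
    show "(\<lambda>\<omega>. indicator A \<omega> *\<^sub>R real_cond_exp (P i) (history M X u)
        (indicator {\<omega> \<in> space M. X (u + h) \<omega> = k}) \<omega>) \<in> borel_measurable (P i)"
      using borel_measurable_cond_exp2[measurable] by measurable
  qed measurable
  also have "\<dots> = measure (P i) A * transition_prob P X h j k"
    using sets.sets_into_space[OF AM] by (simp add: set_lebesgue_integral_def Int_absorb2 mult.commute)
  finally show ?thesis .
qed

lemma measurable_history_cylinder:
  assumes "finite J" "J \<subseteq> {0..b}" "A \<in> sets (history M X u)" "0 \<le> u" "0 \<le> b"
  shows "{\<omega> \<in> A. \<forall>v\<in>J. X (u + v) \<omega> \<in> S v} \<in> sets (history M X (u + b))"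
proof -
  have "sets (history M X u) \<subseteq> sets (history M X (u + b))"
    unfolding history_def using assms
    by (subst (1 2) sets_measure_of) (auto intro!: sigma_sets_mono, fastforce)
  then have [measurable]: "A \<in> sets (history M X (u + b))" using assms by auto
  have [measurable]: "X (u + v) \<in> measurable (history M X (u + b)) (count_space UNIV)" if "v \<in> J" for v
    using that assms by (intro measurable_history) auto
  have "A \<inter> {\<omega> \<in> space (history M X (u + b)). \<forall>v\<in>J. X (u + v) \<omega> \<in> S v} \<in> sets (history M X (u + b))"
    using assms(1) by measurable
  moreover have "A \<inter> {\<omega> \<in> space (history M X (u + b)). \<forall>v\<in>J. X (u + v) \<omega> \<in> S v}
      = {\<omega> \<in> A. \<forall>v\<in>J. X (u + v) \<omega> \<in> S v}"
    using assms(3) sets_history_subset sets.sets_into_space by fastforce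
  ultimately show ?thesis by simp
qed

lemma start_mem_history: "{\<omega> \<in> space M. X 0 \<omega> = j} \<in> sets (history M X 0)"
  using measurable_sets[OF measurable_history[of 0 0], of "{j}"]
  by (simp add: vimage_def Int_def conj_commute)

lemma AE_start: "AE \<omega> in P i. X 0 \<omega> = i"
proof -
  interpret prob_space "P i" by (rule prob_space_P)
  have "{\<omega> \<in> space M. X 0 \<omega> = i} \<in> sets (P i)"
    using start_mem_history sets_history_subset by (auto simp: sets_P)
  then show ?thesis using initial[of i] AE_prob_1 by fastforce
qed

lemma measure_restrict_start:
  assumes "A \<in> sets M"
  shows "measure (P i) {\<omega> \<in> A. X 0 \<omega> = i} = measure (P i) A"
proof (rule measure_eq_AE)
  have "{\<omega> \<in> A. X 0 \<omega> = i} = A \<inter> {\<omega> \<in> space M. X 0 \<omega> = i}"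
    using sets.sets_into_space[OF assms] by auto
  also have "\<dots> \<in> sets M"
    using start_mem_history sets_history_subset assms by auto
  finally show "{\<omega> \<in> A. X 0 \<omega> = i} \<in> sets (P i)" by (simp add: sets_P)
qed (use AE_start[of i] assms in \<open>auto simp: sets_P elim!: eventually_mono\<close>)

text \<open>Induction on the largest time b. Conditioning on the state at the preceding time c
  splits off one transition over b - c, in the same way on both sides, and the induction hypothesis
  identifies the remaining factors. Time 0 always belongs to the index set, so a preceding time
  exists.\<close>

lemma markov_finite:
  assumes "finite J" and "J \<subseteq> {0<..}" and u: "0 \<le> u"
    and A: "A \<in> sets (history M X u)" "A \<subseteq> {\<omega> \<in> space M. X u \<omega> = j}"
  shows "measure (P i) {\<omega> \<in> A. \<forall>v\<in>insert 0 J. X (u + v) \<omega> \<in> S v}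
    = measure (P i) A * measure (P j) {\<omega> \<in> space M. \<forall>v\<in>insert 0 J. X v \<omega> \<in> S v}"
  using assms
proof (induction J arbitrary: S rule: finite_linorder_max_induct)
  case empty
  interpret prob_space "P j" by (rule prob_space_P)
  have "{\<omega> \<in> A. X u \<omega> \<in> S 0} = (if j \<in> S 0 then A else {})" using A by auto
  moreover have "measure (P j) {\<omega> \<in> space M. X 0 \<omega> \<in> S 0} = (if j \<in> S 0 then 1 else 0)"
  proof -
    have "measure (P j) {\<omega> \<in> space M. X 0 \<omega> \<in> S 0} = measure (P j) (if j \<in> S 0 then space M else {})"
      using AE_start[of j] measurable_sets[OF measurable_X[of 0], of "S 0"]
      by (intro measure_eq_AE)
        (auto simp: sets_P vimage_def Int_def conj_commute elim!: eventually_mono)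
    then show ?thesis using prob_space by simp
  qed
  ultimately show ?case by simp
next
  case (insert b J)
  define c where "c = Max (insert 0 J)"
  have c: "c \<in> insert 0 J" "0 \<le> c" "c < b" "J \<subseteq> {0..c}"
    using insert.hyps insert.prems Max_in[of "insert 0 J"] Max_ge[of "insert 0 J"]
    by (auto simp: c_def subset_iff)
  have cb: "insert 0 (insert b J) \<subseteq> {0..b}" "insert 0 J \<subseteq> {0..c}"
    using c insert.hyps by (auto simp: subset_iff intro: less_imp_le order_trans)
  \<comment> \<open>Prescribing the state k at time c only shrinks one of the sets, so the event
    keeps the shape that the induction hypothesis covers.\<close>
  define S' where "S' k = S(c := S c \<inter> {k})" for k
  \<comment> \<open>Stated for arbitrary \<open>i\<close>, \<open>u\<close> and \<open>A\<close>
    because it is used twice: for the given data, and for \<open>P j\<close> at time 0 with the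
    whole space as \<open>A\<close>.\<close>
  have dec: "measure (P i) {\<omega> \<in> A. \<forall>v\<in>insert 0 (insert b J). X (u + v) \<omega> \<in> S v}
    = (\<Sum>k\<in>UNIV. \<Sum>l\<in>S b. measure (P i) {\<omega> \<in> A. \<forall>v\<in>insert 0 J. X (u + v) \<omega> \<in> S' k v} *
        transition_prob P X (b - c) k l)"
    if u: "0 \<le> u" and A: "A \<in> sets (history M X u)" for i u A
  proof -
    define C where "C k = {\<omega> \<in> A. \<forall>v\<in>insert 0 J. X (u + v) \<omega> \<in> S' k v}" for k
    define B where "B = {\<omega> \<in> A. \<forall>v\<in>insert 0 (insert b J). X (u + v) \<omega> \<in> S v}"
    have C: "C k \<in> sets (history M X (u + c))" for k
      unfolding C_def using insert.hyps c cb A u by (intro measurable_history_cylinder) auto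
    have "B \<in> sets (history M X (u + b))"
      unfolding B_def using insert.hyps c cb A u by (intro measurable_history_cylinder) auto
    then have B: "B \<in> sets M" using sets_history_subset by auto
    have "measure (P i) B = measure (P i) {\<omega> \<in> B. X (u + c) \<omega> \<in> UNIV}" by simp
    also have "\<dots> = (\<Sum>k\<in>UNIV. measure (P i) {\<omega> \<in> B. X (u + c) \<omega> = k})"
      using u c by (intro measure_eq_sum_values measurable_X B) auto
    also have "\<dots> = (\<Sum>k\<in>UNIV. measure (P i) {\<omega> \<in> C k. X (u + b) \<omega> \<in> S b})"
    proof -
      have "{\<omega> \<in> B. X (u + c) \<omega> = k} = {\<omega> \<in> C k. X (u + b) \<omega> \<in> S b}" for k
        using c insert.hyps by (auto simp: B_def C_def S'_def split: if_splits)
      then show ?thesis by simp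
    qed
    also have "\<dots> = (\<Sum>k\<in>UNIV. \<Sum>l\<in>S b. measure (P i) {\<omega> \<in> C k. X (u + b) \<omega> = l})"
      using u c C sets_history_subset by (intro sum.cong refl measure_eq_sum_values measurable_X) auto
    also have "\<dots> = (\<Sum>k\<in>UNIV. \<Sum>l\<in>S b. measure (P i) (C k) * transition_prob P X (b - c) k l)"
    proof (intro sum.cong refl)
      fix k l
      have "C k \<subseteq> {\<omega> \<in> space M. X (u + c) \<omega> = k}"
        using c(1) sets.sets_into_space[OF C[of k]]
        by (intro subsetI CollectI conjI) (auto simp: C_def S'_def)
      then show "measure (P i) {\<omega> \<in> C k. X (u + b) \<omega> = l} = measure (P i) (C k) * transition_prob P X (b - c) k l"
        using markov_step[of "u + c" "b - c" "C k" k i l] u c C by simp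
    qed
    finally show ?thesis by (simp add: B_def C_def)
  qed
  have sp: "space M \<in> sets (history M X 0)" using sets.top[of "history M X 0"] by simp
  have IH: "measure (P i) {\<omega> \<in> A. \<forall>v\<in>insert 0 J. X (u + v) \<omega> \<in> S' k v}
      = measure (P i) A * measure (P j) {\<omega> \<in> space M. \<forall>v\<in>insert 0 J. X (0 + v) \<omega> \<in> S' k v}" for k
    using insert.IH[of "S' k"] insert.prems by simp
  have "measure (P i) {\<omega> \<in> A. \<forall>v\<in>insert 0 (insert b J). X (u + v) \<omega> \<in> S v}
    = measure (P i) A * (\<Sum>k\<in>UNIV. \<Sum>l\<in>S b.
        measure (P j) {\<omega> \<in> space M. \<forall>v\<in>insert 0 J. X (0 + v) \<omega> \<in> S' k v} *
        transition_prob P X (b - c) k l)"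
    unfolding dec[OF insert.prems(2,3)] IH by (simp add: sum_distrib_left mult.assoc)
  also have "\<dots> = measure (P i) A * measure (P j)
      {\<omega> \<in> space M. \<forall>v\<in>insert 0 (insert b J). X (0 + v) \<omega> \<in> S v}"
    by (subst dec[OF _ sp]) simp_all
  finally show ?case by simp
qed

text \<open>Both sides are finite measures in \<open>B\<close>: the law of the future on
  \<open>A\<close>, and the law of the path under \<open>P j\<close> scaled by the probability of
  \<open>A\<close>. They agree on cylinders by \<open>markov_finite\<close>, and cylinders
  generate.\<close>

lemma markov_future:
  assumes u: "0 \<le> u"
    and A: "A \<in> sets (history M X u)" "A \<subseteq> {\<omega> \<in> space M. X u \<omega> = j}"
    and B: "B \<in> sets (path_space {0..})"
  shows "measure (P i) {\<omega> \<in> A. future u \<omega> \<in> B}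
    = measure (P i) A * measure (P j) {\<omega> \<in> space M. future 0 \<omega> \<in> B}"
proof -
  interpret Pi: prob_space "P i" by (rule prob_space_P)
  interpret Pj: prob_space "P j" by (rule prob_space_P)
  have AM [measurable]: "A \<in> sets (P i)" using A sets_history_subset by (auto simp: sets_P)
  have fu [measurable]: "future u \<in> measurable (P i) (path_space {0..})"
    and f0 [measurable]: "future 0 \<in> measurable (P j) (path_space {0..})"
    using u by (simp_all add: measurable_future)
  define N1 where "N1 = distr (density (P i) (indicator A)) (path_space {0..}) (future u)"
  define N2 where "N2 = scale_measure (emeasure (P i) A) (distr (P j) (path_space {0..}) (future 0))"
  have N1: "emeasure N1 C = ennreal (measure (P i) {\<omega> \<in> A. future u \<omega> \<in> C})"
    if [measurable]: "C \<in> sets (path_space {0..})" for C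
  proof -
    have "emeasure N1 C = emeasure (P i) (A \<inter> (future u -` C \<inter> space (P i)))"
    proof -
      have "future u -` C \<inter> space (P i) \<in> sets (P i)" by measurable
      then show ?thesis
        unfolding N1_def using AM fu
        by (subst emeasure_distr)
          (simp_all add: emeasure_restricted del: measurable_P space_P)
    qed
    also have "A \<inter> (future u -` C \<inter> space (P i)) = {\<omega> \<in> A. future u \<omega> \<in> C}"
      using sets.sets_into_space[OF AM] by auto
    finally show ?thesis by (simp add: Pi.emeasure_eq_measure)
  qed
  have N2: "emeasure N2 C = ennreal (measure (P i) A * measure (P j) {\<omega> \<in> space M. future 0 \<omega> \<in> C})"
    if [measurable]: "C \<in> sets (path_space {0..})" for C
    using that f0 by (simp add: N2_def emeasure_distr vimage_def Int_def conj_commute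
        Pi.emeasure_eq_measure Pj.emeasure_eq_measure ennreal_mult del: measurable_P)
  have "N1 = N2"
  proof (rule measure_eqI_PiM_infinite[of _ "{0..}" "\<lambda>_. count_space UNIV"])
    show "sets N1 = sets (path_space {0..})" "sets N2 = sets (path_space {0..})" by (simp_all add: N1_def N2_def)
    show "finite_measure N1"
      using N1[OF sets.top] by (intro finite_measureI) (simp add: sets_eq_imp_space_eq[of N1 "path_space {0..}"] \<open>sets N1 = _\<close>)
    fix S :: "real \<Rightarrow> 'o set" and J :: "real set"
    assume J: "finite J" "J \<subseteq> {0..}"
    define C where "C = prod_emb {0..} (\<lambda>_. count_space UNIV) J (Pi\<^sub>E J S)"
    have C [measurable]: "C \<in> sets (path_space {0..})"
      unfolding C_def using J by (intro sets_PiM_I) auto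
    \<comment> \<open>Time 0 is added to the cylinder to match \<open>markov_finite\<close>; where
      \<open>J\<close> does not contain it, the condition there is vacuous.\<close>
    define S' where "S' v = (if v \<in> J then S v else UNIV)" for v
    have mem: "future a \<omega> \<in> C \<longleftrightarrow> (\<forall>v\<in>insert 0 (J - {0}). X (a + v) \<omega> \<in> S' v)" for a \<omega>
      using J by (auto simp: C_def prod_emb_def future_def S'_def PiE_iff restrict_def extensional_def)
    have "measure (P i) {\<omega> \<in> A. future u \<omega> \<in> C}
        = measure (P i) A * measure (P j) {\<omega> \<in> space M. future 0 \<omega> \<in> C}"
      using markov_finite[of "J - {0}" u A j i S'] J u A unfolding mem by fastforce
    then show "emeasure N1 C = emeasure N2 C" by (simp add: N1 N2)
  qed
  then show ?thesis using N1[OF B] N2[OF B] by (simp add: measure_nonneg)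
qed

end

section \<open>Path events\<close>

lemma right_continuous_pathD:
  assumes "right_continuous_path x" "0 \<le> u"
  obtains e where "u < e" "\<And>v. u \<le> v \<Longrightarrow> v < e \<Longrightarrow> x v = x u"
proof -
  from assms obtain e where "u < e" "\<forall>v>u. v < e \<longrightarrow> x v = x u"
    unfolding right_continuous_path_def eventually_at_right_field by blast
  then show thesis by (intro that[of e]) (auto simp: le_less)
qed

lemma right_continuous_path_shift:
  assumes "right_continuous_path x" "0 \<le> u"
  shows "right_continuous_path (\<lambda>v. x (u + v))"
  unfolding right_continuous_path_def eventually_at_right_field
proof safe
  fix v :: real
  assume "0 \<le> v"
  then obtain e where e: "u + v < e" "\<And>w. u + v \<le> w \<Longrightarrow> w < e \<Longrightarrow> x w = x (u + v)"
    using right_continuous_pathD[OF assms(1) add_nonneg_nonneg[OF assms(2)], of v] by blast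
  show "\<exists>b>v. \<forall>w>v. w < b \<longrightarrow> x (u + w) = x (u + v)"
  proof (intro exI[of _ "e - u"] conjI allI impI)
    show "x (u + w) = x (u + v)" if "v < w" "w < e - u" for w
      using that by (intro e(2)) simp_all
  qed (use e(1) in simp)
qed

text \<open>Right-continuity makes the infimum t of the exit times an exit time itself: the path is
  constant on some [t, e), and this interval contains an exit time.\<close>

lemma first_exit:
  fixes x :: "real \<Rightarrow> 'o"
  assumes x: "right_continuous_path x" and a: "0 \<le> a" "a \<le> b" "x b \<notin> V"
  obtains t where "a \<le> t" "t \<le> b" "x t \<notin> V" "\<And>u. a \<le> u \<Longrightarrow> u < t \<Longrightarrow> x u \<in> V"
proof -
  define S where "S = {u. a \<le> u \<and> x u \<notin> V}"
  define t where "t = Inf S"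
  have S: "b \<in> S" "bdd_below S" using a by (auto simp: S_def bdd_below_def)
  have "t \<le> b" using cInf_lower[OF S] by (simp add: t_def)
  moreover have "a \<le> t" unfolding t_def using S(1) by (intro cInf_greatest) (auto simp: S_def)
  ultimately have t: "a \<le> t" "t \<le> b" by auto
  have below: "x u \<in> V" if "a \<le> u" "u < t" for u
  proof (rule ccontr)
    assume "x u \<notin> V"
    then have "t \<le> u" unfolding t_def using that S(2) by (intro cInf_lower) (auto simp: S_def)
    with that show False by simp
  qed
  obtain e where e: "t < e" "\<And>v. t \<le> v \<Longrightarrow> v < e \<Longrightarrow> x v = x t"
    using right_continuous_pathD[OF x order_trans[OF a(1) t(1)]] by blast
  obtain u where u: "u \<in> S" "u < e"
    using cInf_lessD[of S e] e(1) S(1) unfolding t_def by blast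
  then have "t \<le> u" using cInf_lower[OF _ S(2)] by (simp add: t_def)
  then have "x t \<notin> V" using e(2)[of u] u by (auto simp: S_def)
  then show thesis using that t below by blast
qed

definition stay :: "'o set \<Rightarrow> real \<Rightarrow> (real \<Rightarrow> 'o) \<Rightarrow> bool" where
  "stay V h x \<longleftrightarrow> (\<forall>u\<in>{0..h}. x u \<in> V)"

text \<open>With t = 0 excluded and t = h included, crossing windows are half open, so adjacent
  windows neither overlap nor miss their common end point.\<close>

definition cross :: "'o set \<Rightarrow> 'o set \<Rightarrow> 'o set \<Rightarrow> real \<Rightarrow> (real \<Rightarrow> 'o) \<Rightarrow> bool" where
  "cross V G V' h x \<longleftrightarrow> (\<exists>t. 0 < t \<and> t \<le> h \<and> (\<forall>u\<in>{0..<t}. x u \<in> V) \<and> x t \<in> G \<and> (\<forall>u\<in>{t..h}. x u \<in> V'))"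

text \<open>A point u < h has rationals of the interval directly to its right, where the path still
  has the value at u. The end point h has none and is listed separately.\<close>

lemma stay_iff_rational:
  assumes x: "right_continuous_path x" and h: "0 \<le> h"
  shows "stay V h x \<longleftrightarrow> x h \<in> V \<and> (\<forall>q\<in>\<rat> \<inter> {0..h}. x q \<in> V)"
proof safe
  assume V: "x h \<in> V" "\<forall>q\<in>\<rat> \<inter> {0..h}. x q \<in> V"
  show "stay V h x"
    unfolding stay_def
  proof
    fix u assume u: "u \<in> {0..h}"
    show "x u \<in> V"
    proof (cases "u = h")
      case False
      obtain e where e: "u < e" "\<And>v. u \<le> v \<Longrightarrow> v < e \<Longrightarrow> x v = x u"
        using right_continuous_pathD[OF x, of u] u by (metis atLeastAtMost_iff)
      obtain q where "q \<in> \<rat>" "u < q" "q < min e h"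
        using Rats_dense_in_real[of u "min e h"] e(1) u False by auto
      then have "x q = x u" "q \<in> \<rat> \<inter> {0..h}" using e(2)[of q] u by simp_all
      then show ?thesis using V(2) by metis
    qed (use V in simp)
  qed
qed (use h in \<open>auto simp: stay_def\<close>)

text \<open>Replaces the uncountable choice of the crossing time by a countable one. Just after
  crossing, the path still sits in \<open>G\<close>, so r may be taken rational, or equal to h if
  the crossing happens there. Conversely, the first exit from \<open>V\<close> before such an r must
  land in \<open>G\<close>, because the path has seen only \<open>V \<union> G\<close> up to
  r.\<close>

lemma cross_iff_rational:
  assumes x: "right_continuous_path x" and h: "0 \<le> h"
    and V: "V \<subseteq> V'" "G \<subseteq> V'" "V \<inter> G = {}"
  shows "cross V G V' h x \<longleftrightarrow> x 0 \<in> V \<and> stay V' h x \<and>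
    (\<exists>r\<in>insert h (\<rat> \<inter> {0..h}). x r \<in> G \<and> stay (V \<union> G) r x)"
    (is "_ \<longleftrightarrow> ?R")
proof
  assume "cross V G V' h x"
  then obtain t where t: "0 < t" "t \<le> h" "\<And>u. 0 \<le> u \<Longrightarrow> u < t \<Longrightarrow> x u \<in> V" "x t \<in> G"
    "\<And>u. t \<le> u \<Longrightarrow> u \<le> h \<Longrightarrow> x u \<in> V'"
    by (auto simp: cross_def)
  have 1: "x 0 \<in> V" using t by simp
  have 2: "stay V' h x"
    unfolding stay_def
  proof
    fix u assume "u \<in> {0..h}"
    then show "x u \<in> V'" using t(3)[of u] t(5)[of u] V(1) by (cases "u < t") auto
  qed
  obtain e where e: "t < e" "\<And>v. t \<le> v \<Longrightarrow> v < e \<Longrightarrow> x v = x t"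
    using right_continuous_pathD[OF x less_imp_le[OF t(1)]] by blast
  have r: "x r \<in> G \<and> stay (V \<union> G) r x" if "t \<le> r" "r < e" for r
    using t e(2) that unfolding stay_def
    by (metis Un_iff atLeastAtMost_iff le_less_trans not_le order_trans)
  have 3: "\<exists>r\<in>insert h (\<rat> \<inter> {0..h}). x r \<in> G \<and> stay (V \<union> G) r x"
  proof (cases "t = h")
    case False
    obtain q where q: "q \<in> \<rat>" "t < q" "q < min e h"
      using Rats_dense_in_real[of t "min e h"] e(1) t False by auto
    then have "q \<in> \<rat> \<inter> {0..h}" "x q \<in> G \<and> stay (V \<union> G) q x"
      using r[of q] t(1,2) by simp_all
    then show ?thesis by blast
  qed (use r[of h] e(1) in auto)
  show ?R by (intro conjI 1 2 3)
next
  assume ?R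
  then obtain r where x0: "x 0 \<in> V" "stay V' h x"
    and r: "r \<in> insert h (\<rat> \<inter> {0..h})" "x r \<in> G" "stay (V \<union> G) r x"
    by (elim conjE bexE) (rule that)
  have r0: "0 \<le> r" "r \<le> h" "x r \<notin> V" using r(1,2) h V(3) by auto
  then obtain t where t: "0 \<le> t" "t \<le> r" "x t \<notin> V" "\<And>u. 0 \<le> u \<Longrightarrow> u < t \<Longrightarrow> x u \<in> V"
    using first_exit[OF x order_refl, of r V] by auto
  then have "0 < t" "x t \<in> G" using x0(1) r(3) by (auto simp: stay_def le_less)
  then show "cross V G V' h x"
    using t r0 x0(2) by (auto simp: cross_def stay_def intro!: exI[of _ t])
qed

lemma stay_add:
  assumes "0 \<le> h" "0 \<le> k"
  shows "stay V (h + k) x \<longleftrightarrow> stay V h x \<and> stay V k (\<lambda>v. x (h + v))"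
proof safe
  assume *: "stay V h x" "stay V k (\<lambda>v. x (h + v))"
  show "stay V (h + k) x" unfolding stay_def
  proof
    fix u assume "u \<in> {0..h + k}"
    then show "x u \<in> V"
      using *(1) bspec[OF *(2)[unfolded stay_def], of "u - h"] by (cases "u \<le> h") (auto simp: stay_def)
  qed
qed (use assms in \<open>auto simp: stay_def\<close>)

text \<open>The two alternatives correspond to a crossing time after h and a crossing time at most
  h.\<close>

lemma cross_add:
  assumes hk: "0 \<le> h" "0 \<le> k" and V: "V \<subseteq> V'" "G \<subseteq> V'" "V \<inter> G = {}"
  shows "cross V G V' (h + k) x \<longleftrightarrow>
    (stay V h x \<and> cross V G V' k (\<lambda>v. x (h + v))) \<or> (cross V G V' h x \<and> stay V' k (\<lambda>v. x (h + v)))"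
    (is "_ \<longleftrightarrow> ?A \<or> ?B")
proof
  assume c: "cross V G V' (h + k) x"
  have ?A if no: "\<not> (cross V G V' h x \<and> stay V' k (\<lambda>v. x (h + v)))"
  proof -
    from c obtain t where t: "0 < t" "t \<le> h + k" "\<And>u. 0 \<le> u \<Longrightarrow> u < t \<Longrightarrow> x u \<in> V" "x t \<in> G"
      "\<And>u. t \<le> u \<Longrightarrow> u \<le> h + k \<Longrightarrow> x u \<in> V'"
      by (auto simp: cross_def)
    have "h < t"
    proof (rule ccontr)
      assume "\<not> h < t"
      then have "cross V G V' h x" "stay V' k (\<lambda>v. x (h + v))"
        using t hk by (auto simp: cross_def stay_def intro!: exI[of _ t])
      with no show False by simp
  qed
  then show ?A
    using t hk by (auto simp: cross_def stay_def intro!: exI[of _ "t - h"])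
  qed
  then show "?A \<or> ?B" by blast
next
  have 1: "cross V G V' (h + k) x" if *: "stay V h x" "cross V G V' k (\<lambda>v. x (h + v))"
  proof -
    from * obtain t where t: "0 < t" "t \<le> k" "\<And>u. 0 \<le> u \<Longrightarrow> u < t \<Longrightarrow> x (h + u) \<in> V" "x (h + t) \<in> G"
      "\<And>u. t \<le> u \<Longrightarrow> u \<le> k \<Longrightarrow> x (h + u) \<in> V'"
      by (auto simp: cross_def)
    have "x u \<in> V" if "0 \<le> u" "u < h + t" for u
      using that *(1) t(3)[of "u - h"] by (cases "u \<le> h") (auto simp: stay_def)
    moreover have "x u \<in> V'" if "h + t \<le> u" "u \<le> h + k" for u
      using that t(5)[of "u - h"] by simp
    ultimately show "cross V G V' (h + k) x"
      using t hk unfolding cross_def by (intro exI[of _ "h + t"]) auto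
  qed
  have 2: "cross V G V' (h + k) x" if *: "cross V G V' h x" "stay V' k (\<lambda>v. x (h + v))"
  proof -
    from * obtain t where t: "0 < t" "t \<le> h" "\<And>u. 0 \<le> u \<Longrightarrow> u < t \<Longrightarrow> x u \<in> V" "x t \<in> G"
      "\<And>u. t \<le> u \<Longrightarrow> u \<le> h \<Longrightarrow> x u \<in> V'"
      by (auto simp: cross_def)
    have "x u \<in> V'" if "t \<le> u" "u \<le> h + k" for u
      using that t(5)[of u] bspec[OF *(2)[unfolded stay_def], of "u - h"] by (cases "u \<le> h") auto
    then show "cross V G V' (h + k) x"
      using t hk unfolding cross_def by (intro exI[of _ t]) auto
  qed
  assume "?A \<or> ?B"
  with 1 2 show "cross V G V' (h + k) x" by blast
qed

text \<open>Makes the alternatives of \<open>cross_add\<close> exclusive, so that their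
  probabilities add.\<close>

lemma not_stay_and_cross: "V \<inter> G = {} \<Longrightarrow> stay V h x \<Longrightarrow> \<not> cross V G V' h x"
  by (force simp: stay_def cross_def)

text \<open>The product sigma-algebra over an interval cannot express conditions at uncountably many
  times. Agreement is therefore demanded on right-continuous paths only, where rational times
  suffice.\<close>

definition observable :: "real \<Rightarrow> ((real \<Rightarrow> 'o) \<Rightarrow> bool) \<Rightarrow> bool" where
  "observable h Q \<longleftrightarrow> (\<exists>B \<in> sets (path_space {0..h}).
     \<forall>x. right_continuous_path x \<longrightarrow> (Q x \<longleftrightarrow> restrict x {0..h} \<in> B))"

lemma observableI:
  assumes Q': "Measurable.pred (path_space {0..h}) Q'"
    and eq: "\<And>x. right_continuous_path x \<Longrightarrow> Q x \<longleftrightarrow> Q' (restrict x {0..h})"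
  shows "observable h Q"
  unfolding observable_def
proof (intro bexI allI impI)
  let ?M = "path_space {0..h} :: (real \<Rightarrow> 'a) measure"
  show "{y \<in> space ?M. Q' y} \<in> sets ?M" using Q' by measurable
  fix x :: "real \<Rightarrow> 'a" assume "right_continuous_path x"
  then show "Q x \<longleftrightarrow> restrict x {0..h} \<in> {y \<in> space ?M. Q' y}"
    using eq[of x] by (simp add: space_PiM)
qed

lemma pred_path_component:
  assumes "v \<in> I"
  shows "Measurable.pred (path_space I) (\<lambda>x. x v \<in> S)"
  using assms by (intro pred_sets2[OF _ measurable_component_singleton]) auto

lemma pred_path_rational:
  assumes "r \<in> I" "\<rat> \<inter> {0..r} \<subseteq> I"
  shows "Measurable.pred (path_space I) (\<lambda>x. x r \<in> S \<and> (\<forall>q\<in>\<rat> \<inter> {0..r}. x q \<in> S))"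
proof -
  have "countable (\<rat> \<inter> {0..r})" by (rule countable_subset[OF _ countable_rat]) auto
  then show ?thesis
    using assms by (intro pred_intros_logic(3) measurable_pred_countable pred_path_component) auto
qed

lemma observable_stay: "0 \<le> h \<Longrightarrow> observable h (stay V h)"
  by (rule observableI[OF pred_path_rational[of h _ V]]) (auto simp: stay_iff_rational)

lemma observable_cross:
  assumes h: "0 \<le> h" and V: "V \<subseteq> V'" "G \<subseteq> V'" "V \<inter> G = {}"
  shows "observable h (cross V G V' h)"
proof (rule observableI)
  let ?Q = "\<lambda>x. x 0 \<in> V \<and> (x h \<in> V' \<and> (\<forall>q\<in>\<rat> \<inter> {0..h}. x q \<in> V')) \<and>
    (\<exists>r\<in>insert h (\<rat> \<inter> {0..h}). x r \<in> G \<and> (x r \<in> V \<union> G \<and> (\<forall>q\<in>\<rat> \<inter> {0..r}. x q \<in> V \<union> G)))"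
  have "countable (insert h (\<rat> \<inter> {0..h}))"
    by (auto intro: countable_subset[OF _ countable_rat])
  then show "Measurable.pred (path_space {0..h}) ?Q"
    using h by (intro pred_intros_logic(3) measurable_pred_countable pred_path_component
        pred_path_rational) auto
  fix x :: "real \<Rightarrow> 'a" assume x: "right_continuous_path x"
  show "cross V G V' h x \<longleftrightarrow> ?Q (restrict x {0..h})"
    using h by (simp add: cross_iff_rational[OF x h V] stay_iff_rational[OF x])
qed

lemma observable_grid:
  assumes "finite J" "J \<subseteq> {0..h}"
  shows "observable h (\<lambda>x. \<forall>v\<in>J. x v \<in> V)"
  using assms
  by (intro observableI[where Q' = "\<lambda>x. \<forall>v\<in>J. x v \<in> V"])
    (auto intro!: pred_intros_finite pred_path_component simp: subset_iff)

lemma observable_concat: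
  assumes hk: "0 \<le> h" "0 \<le> k" and Q: "observable h Q" and R: "observable k R"
  shows "observable (h + k) (\<lambda>x. Q x \<and> R (\<lambda>v. x (h + v)))"
proof -
  from Q obtain B where B: "B \<in> sets (path_space {0..h})"
    "\<And>x. right_continuous_path x \<Longrightarrow> Q x \<longleftrightarrow> restrict x {0..h} \<in> B"
    by (auto simp: observable_def)
  from R obtain C where C: "C \<in> sets (path_space {0..k})"
    "\<And>x. right_continuous_path x \<Longrightarrow> R x \<longleftrightarrow> restrict x {0..k} \<in> C"
    by (auto simp: observable_def)
  let ?M = "path_space {0..h + k} :: (real \<Rightarrow> 'a) measure"
  have 1: "(\<lambda>x. \<lambda>v\<in>{0..h}. x v) \<in> measurable ?M (path_space {0..h})"
    and 2: "(\<lambda>x. \<lambda>v\<in>{0..k}. x (h + v)) \<in> measurable ?M (path_space {0..k})"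
    using hk by (auto intro!: measurable_restrict measurable_component_singleton)
  show ?thesis
  proof (rule observableI)
    show "Measurable.pred ?M (\<lambda>x. (\<lambda>v\<in>{0..h}. x v) \<in> B \<and> (\<lambda>v\<in>{0..k}. x (h + v)) \<in> C)"
      using pred_sets2[OF B(1) 1] pred_sets2[OF C(1) 2] by (intro pred_intros_logic) simp_all
    fix x :: "real \<Rightarrow> 'a" assume x: "right_continuous_path x"
    have *: "restrict (\<lambda>v. restrict x {0..h + k} v) {0..h} = restrict x {0..h}"
      "(\<lambda>v\<in>{0..k}. restrict x {0..h + k} (h + v)) = (\<lambda>v\<in>{0..k}. x (h + v))"
      using hk by (auto simp: restrict_def fun_eq_iff)
    show "Q x \<and> R (\<lambda>v. x (h + v)) \<longleftrightarrow> (\<lambda>v\<in>{0..h}. restrict x {0..h + k} v) \<in> B \<and>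
        (\<lambda>v\<in>{0..k}. restrict x {0..h + k} (h + v)) \<in> C"
      unfolding * using B(2)[OF x] C(2)[OF right_continuous_path_shift[OF x hk(1)]] by simp
  qed
qed

section \<open>Probabilities of observable path events\<close>

context finite_markov_process
begin

abbreviation path_of :: "'w \<Rightarrow> real \<Rightarrow> 'o" where
  "path_of \<omega> \<equiv> (\<lambda>v. X v \<omega>)"

text \<open>The state at the end is recorded so that successive pieces of a path compose by matrix
  multiplication.\<close>

definition prob_matrix :: "real \<Rightarrow> ((real \<Rightarrow> 'o) \<Rightarrow> bool) \<Rightarrow> real ^ 'o ^ 'o" where
  "prob_matrix h Q = (\<chi> i j. measure (P i) {\<omega> \<in> space M. Q (path_of \<omega>) \<and> X h \<omega> = j})"

lemma observable_mem_history:
  assumes u: "0 \<le> u" "0 \<le> h" and Q: "observable h Q" and A: "A \<in> sets (history M X u)"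
  shows "{\<omega> \<in> A. Q (\<lambda>v. X (u + v) \<omega>)} \<in> sets (history M X (u + h))"
proof -
  from Q obtain B where B: "B \<in> sets (path_space {0..h})"
    "\<And>x. right_continuous_path x \<Longrightarrow> Q x \<longleftrightarrow> restrict x {0..h} \<in> B"
    by (auto simp: observable_def)
  have "(\<lambda>\<omega>. \<lambda>v\<in>{0..h}. X (u + v) \<omega>) \<in> measurable (history M X (u + h)) (path_space {0..h})"
    using u by (intro measurable_restrict measurable_history) auto
  from measurable_sets[OF this B(1)]
  have "(\<lambda>\<omega>. \<lambda>v\<in>{0..h}. X (u + v) \<omega>) -` B \<inter> space M \<in> sets (history M X (u + h))" by simp
  moreover have "A \<in> sets (history M X (u + h))"
    using measurable_history_cylinder[of "{}" h A u] A u by simp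
  moreover have "{\<omega> \<in> A. Q (\<lambda>v. X (u + v) \<omega>)} =
      A \<inter> ((\<lambda>\<omega>. \<lambda>v\<in>{0..h}. X (u + v) \<omega>) -` B \<inter> space M)"
    using A sets_history_subset sets.sets_into_space
      B(2)[OF right_continuous_path_shift[OF right_continuous u(1)]] by fastforce
  ultimately show ?thesis by auto
qed

lemma observable_mem_sets:
  assumes "0 \<le> h" "observable h Q"
  shows "{\<omega> \<in> space M. Q (path_of \<omega>)} \<in> sets M"
  using observable_mem_history[OF order_refl assms sets.top] sets_history_subset
  by (auto simp: subset_iff)

lemma observable_state_mem_history:
  assumes "0 \<le> h" "observable h Q"
  shows "{\<omega> \<in> space M. Q (path_of \<omega>) \<and> X h \<omega> = j} \<in> sets (history M X h)"
proof -
  have "{\<omega> \<in> space M. Q (path_of \<omega>)} \<inter> (X h -` {j} \<inter> space (history M X h)) \<in> sets (history M X h)"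
    using observable_mem_history[OF order_refl assms sets.top]
      measurable_sets[OF measurable_history[of h h], of "{j}"] assms
    by - (rule sets.Int, simp_all)
  moreover have "{\<omega> \<in> space M. Q (path_of \<omega>) \<and> X h \<omega> = j} =
    {\<omega> \<in> space M. Q (path_of \<omega>)} \<inter> (X h -` {j} \<inter> space (history M X h))" by auto
  ultimately show ?thesis by simp
qed

lemma observable_state_mem_sets:
  assumes "0 \<le> h" "observable h Q"
  shows "{\<omega> \<in> space M. Q (path_of \<omega>) \<and> X h \<omega> = j} \<in> sets M"
  using observable_state_mem_history[OF assms] sets_history_subset by auto

lemma markov_observable:
  assumes u: "0 \<le> u" "0 \<le> h" and Q: "observable h Q"
    and A: "A \<in> sets (history M X u)" "A \<subseteq> {\<omega> \<in> space M. X u \<omega> = j}"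
  shows "measure (P i) {\<omega> \<in> A. Q (\<lambda>v. X (u + v) \<omega>) \<and> X (u + h) \<omega> = k}
    = measure (P i) A * prob_matrix h Q $ j $ k"
proof -
  from Q obtain B where B: "B \<in> sets (path_space {0..h})"
    "\<And>x. right_continuous_path x \<Longrightarrow> Q x \<longleftrightarrow> restrict x {0..h} \<in> B"
    by (auto simp: observable_def)
  have 1: "(\<lambda>x. \<lambda>v\<in>{0..h}. x v) \<in> measurable (path_space {0..}) (path_space {0..h} :: (real \<Rightarrow> 'o) measure)"
    using u by (auto intro!: measurable_restrict measurable_component_singleton)
  \<comment> \<open>\<open>markov_future\<close> speaks of paths on all of \<open>{0..}\<close>, so
    \<open>B\<close> and the final state are lifted to a set of such paths.\<close>
  define C where "C = {x \<in> space (path_space {0..}). restrict x {0..h} \<in> B \<and> x h \<in> {k}}"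
  have C: "C \<in> sets (path_space {0..})"
    unfolding C_def using pred_sets2[OF B(1) 1] pred_path_component[of h "{0..}" "{k}"] u
    by (intro predE pred_intros_logic) simp_all
  have mem: "future a \<omega> \<in> C \<longleftrightarrow> Q (\<lambda>v. X (a + v) \<omega>) \<and> X (a + h) \<omega> = k" if "\<omega> \<in> space M" "0 \<le> a" for a \<omega>
  proof -
    have "restrict (future a \<omega>) {0..h} = restrict (\<lambda>v. X (a + v) \<omega>) {0..h}"
      by (auto simp: future_def restrict_def fun_eq_iff)
    then show ?thesis
      using B(2)[OF right_continuous_path_shift[OF right_continuous[OF that(1)] that(2)]] u
      by (auto simp: C_def space_PiM future_def)
  qed
  have "{\<omega> \<in> A. Q (\<lambda>v. X (u + v) \<omega>) \<and> X (u + h) \<omega> = k} = {\<omega> \<in> A. future u \<omega> \<in> C}"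
    using A mem u by blast
  moreover have "{\<omega> \<in> space M. Q (path_of \<omega>) \<and> X h \<omega> = k} = {\<omega> \<in> space M. future 0 \<omega> \<in> C}"
    using mem[of _ 0] by auto
  ultimately show ?thesis
    using markov_future[OF u(1) A C, of i] by (simp add: prob_matrix_def)
qed

text \<open>A Chapman-Kolmogorov equation for path events: sum over the state at time h and factor
  each summand by \<open>markov_observable\<close>.\<close>

lemma prob_matrix_concat:
  assumes hk: "0 \<le> h" "0 \<le> k" and Q: "observable h Q" and R: "observable k R"
  shows "prob_matrix (h + k) (\<lambda>x. Q x \<and> R (\<lambda>v. x (h + v))) = prob_matrix h Q ** prob_matrix k R"
proof -
  have "prob_matrix (h + k) (\<lambda>x. Q x \<and> R (\<lambda>v. x (h + v))) $ i $ j =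
      (prob_matrix h Q ** prob_matrix k R) $ i $ j" for i j
  proof -
    define B where "B = {\<omega> \<in> space M. (Q (path_of \<omega>) \<and> R (\<lambda>v. X (h + v) \<omega>)) \<and> X (h + k) \<omega> = j}"
    define A where "A l = {\<omega> \<in> space M. Q (path_of \<omega>) \<and> X h \<omega> = l}" for l
    have B: "B \<in> sets M"
      unfolding B_def
      using observable_state_mem_sets[OF _ observable_concat[OF hk Q R], of j] hk by simp
    have "measure (P i) B = measure (P i) {\<omega> \<in> B. X h \<omega> \<in> UNIV}" by simp
    also have "\<dots> = (\<Sum>l\<in>UNIV. measure (P i) {\<omega> \<in> B. X h \<omega> = l})"
      using hk by (intro measure_eq_sum_values measurable_X B)
    also have "\<dots> = (\<Sum>l\<in>UNIV. measure (P i) (A l) * prob_matrix k R $ l $ j)"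
    proof (intro sum.cong refl)
      fix l
      have "{\<omega> \<in> B. X h \<omega> = l} = {\<omega> \<in> A l. R (\<lambda>v. X (h + v) \<omega>) \<and> X (h + k) \<omega> = j}"
        by (auto simp: B_def A_def)
      then show "measure (P i) {\<omega> \<in> B. X h \<omega> = l} = measure (P i) (A l) * prob_matrix k R $ l $ j"
        using markov_observable[OF hk R, of "A l" l i j] observable_state_mem_history[OF hk(1) Q]
        by (simp add: A_def) (auto simp: A_def)
    qed
    finally show ?thesis by (simp add: prob_matrix_def matrix_matrix_mult_def B_def A_def)
  qed
  then show ?thesis by (simp add: vec_eq_iff)
qed

lemma prob_matrix_disj:
  assumes h: "0 \<le> h" and Q: "observable h Q" and R: "observable h R"
    and disj: "\<And>x. right_continuous_path x \<Longrightarrow> \<not> (Q x \<and> R x)"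
  shows "prob_matrix h (\<lambda>x. Q x \<or> R x) = prob_matrix h Q + prob_matrix h R"
proof -
  have "prob_matrix h (\<lambda>x. Q x \<or> R x) $ i $ j = (prob_matrix h Q + prob_matrix h R) $ i $ j" for i j
  proof -
    interpret prob_space "P i" by (rule prob_space_P)
    have "{\<omega> \<in> space M. (Q (path_of \<omega>) \<or> R (path_of \<omega>)) \<and> X h \<omega> = j} =
      {\<omega> \<in> space M. Q (path_of \<omega>) \<and> X h \<omega> = j} \<union> {\<omega> \<in> space M. R (path_of \<omega>) \<and> X h \<omega> = j}" by auto
    moreover have "{\<omega> \<in> space M. Q (path_of \<omega>) \<and> X h \<omega> = j} \<inter> {\<omega> \<in> space M. R (path_of \<omega>) \<and> X h \<omega> = j} = {}"
      using disj right_continuous by auto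
    ultimately show ?thesis
      using observable_state_mem_sets[OF h Q, of j] observable_state_mem_sets[OF h R, of j]
      by (simp add: prob_matrix_def finite_measure_Union sets_P)
  qed
  then show ?thesis by (simp add: vec_eq_iff)
qed

lemma prob_matrix_cong:
  assumes "\<And>x. right_continuous_path x \<Longrightarrow> Q x \<longleftrightarrow> R x"
  shows "prob_matrix h Q = prob_matrix h R"
  unfolding prob_matrix_def using assms right_continuous
  by (intro arg_cong[of _ _ vec_lambda] ext arg_cong[of _ _ "measure _"]) auto

lemma prob_matrix_nonneg: "0 \<le> prob_matrix h Q $ i $ j"
  by (simp add: prob_matrix_def)

lemma prob_matrix_le_1: "prob_matrix h Q $ i $ j \<le> 1"
proof -
  interpret prob_space "P i" by (rule prob_space_P)
  show ?thesis by (simp add: prob_matrix_def)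
qed

text \<open>\<open>P i\<close> starts in \<open>i\<close> almost surely. Making this part of the
  event allows pathwise arguments to use the initial state.\<close>

lemma prob_matrix_start:
  assumes "0 \<le> h" "observable h Q"
  shows "prob_matrix h Q $ i $ j
    = measure (P i) {\<omega> \<in> space M. X 0 \<omega> = i \<and> Q (path_of \<omega>) \<and> X h \<omega> = j}"
  using measure_restrict_start[OF observable_state_mem_sets[OF assms], of i j]
  by (simp add: prob_matrix_def conj_ac)

lemma prob_matrix_eq_0:
  assumes h: "0 \<le> h" "observable h Q"
    and no: "\<And>x. right_continuous_path x \<Longrightarrow> Q x \<Longrightarrow> x 0 = i \<Longrightarrow> x h = j \<Longrightarrow> False"
  shows "prob_matrix h Q $ i $ j = 0"
proof -
  have "{\<omega> \<in> space M. X 0 \<omega> = i \<and> Q (path_of \<omega>) \<and> X h \<omega> = j} = {}"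
    using no right_continuous by blast
  then show ?thesis unfolding prob_matrix_start[OF h] by (simp only: measure_empty)
qed

end

section \<open>Short-time asymptotics\<close>

context finite_markov_process
begin

abbreviation trans :: "real \<Rightarrow> 'o \<Rightarrow> 'o \<Rightarrow> real" where
  "trans \<equiv> transition_prob P X"

lemma trans_eq_prob_matrix: "trans h i j = prob_matrix h (\<lambda>_. True) $ i $ j"
  by (simp add: transition_prob_def prob_matrix_def)

lemma trans_0: "trans 0 i j = (if i = j then 1 else 0)"
proof (cases "i = j")
  case False
  have "observable 0 (\<lambda>_ :: real \<Rightarrow> 'o. True)" using observable_grid[of "{}" 0 UNIV] by simp
  with False show ?thesis
    using prob_matrix_eq_0[of 0 "\<lambda>_. True" i j] by (simp add: trans_eq_prob_matrix)
qed (use initial[of j] in \<open>simp add: transition_prob_def\<close>)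

lemma trans_difference_quotient:
  "((\<lambda>h. (trans h i j - (if i = j then 1 else 0)) / h) \<longlongrightarrow> \<Lambda> $ i $ j) (at_right 0)"
  using jump_rates[of i j]
  by (simp add: has_field_derivative_iff trans_0 at_within_Ici_at_right)

lemma rate_nonpos: "\<Lambda> $ i $ i \<le> 0"
  using intensity sum_nonneg[of "UNIV - {i}" "\<lambda>j. \<Lambda> $ i $ j"]
  by (auto simp: intensity_matrix_def dest!: spec[of _ i])

lemma observable_True: "0 \<le> h \<Longrightarrow> observable h (\<lambda>_. True)"
  using observable_grid[of "{}" h UNIV] by simp

text \<open>The probabilities of seeing only the states \<open>i\<close> and \<open>j\<close> on a grid with \<open>N\<close> steps are
  bounded below by the \<open>N\<close> ways of placing a single jump.\<close>

lemma grid_prob_ge: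
  fixes \<delta> :: real
  assumes \<delta>: "0 \<le> \<delta>" and a: "0 \<le> a" "a \<le> trans \<delta> i i" "a \<le> trans \<delta> j j"
  defines "Q \<equiv> \<lambda>N x. \<forall>v\<in>(\<lambda>m. real m * \<delta>) ` {..N}. x v \<in> {i, j}"
  shows "a ^ N \<le> prob_matrix (real N * \<delta>) (Q N) $ j $ j"
    and "i \<noteq> j \<Longrightarrow> real N * trans \<delta> i j * a ^ (N - 1) \<le> prob_matrix (real N * \<delta>) (Q N) $ i $ j"
proof -
  let ?p = "\<lambda>N. prob_matrix (real N * \<delta>) (Q N)"
  have obs: "observable (real N * \<delta>) (Q N)" for N
    unfolding Q_def using \<delta> by (intro observable_grid) (auto intro!: mult_right_mono)
  have 0: "observable \<delta> (\<lambda>x. x 0 \<in> {i, j})"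
    using observable_grid[of "{0}" \<delta> "{i, j}"] \<delta> by simp
  have step: "?p (Suc N)
      = prob_matrix \<delta> (\<lambda>x. x 0 \<in> {i, j}) ** ?p N" for N
  proof -
    have "Q (Suc N) = (\<lambda>x. x 0 \<in> {i, j} \<and> Q N (\<lambda>v. x (\<delta> + v)))"
      by (auto simp: Q_def fun_eq_iff atMost_Suc_eq_insert_0 image_iff algebra_simps Ball_def)
    then show ?thesis
      using prob_matrix_concat[OF \<delta> _ 0 obs[of N]] \<delta> by (simp add: algebra_simps)
  qed
  have one: "prob_matrix \<delta> (\<lambda>x. x 0 \<in> {i, j}) $ k $ l = trans \<delta> k l" if "k \<in> {i, j}" for k l
    unfolding trans_eq_prob_matrix prob_matrix_start[OF \<delta> 0] prob_matrix_start[OF \<delta> observable_True[OF \<delta>]]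
    using that by (intro arg_cong[of _ _ "measure _"]) auto
  have expand: "?p (Suc N) $ k $ j
      = (\<Sum>l\<in>UNIV. trans \<delta> k l * ?p N $ l $ j)" if "k \<in> {i, j}" for k N
    unfolding step matrix_matrix_mult_nth one[OF that] ..
  have nonneg: "0 \<le> trans \<delta> k l * ?p N $ l $ j" for k l N
    by (simp add: prob_matrix_nonneg trans_eq_prob_matrix)
  show jj: "a ^ N \<le> ?p N $ j $ j" for N
  proof (induction N)
    case 0
    then show ?case
      using initial[of j] by (simp add: prob_matrix_def Q_def conj_commute cong: conj_cong)
  next
    case (Suc N)
    have "a ^ Suc N \<le> trans \<delta> j j * ?p N $ j $ j"
      using a Suc by (simp, intro mult_mono) auto
    also have "\<dots> \<le> ?p (Suc N) $ j $ j"
      unfolding expand[OF insertI2[OF singletonI]]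
      by (rule member_le_sum[of j UNIV "\<lambda>l. trans \<delta> j l * ?p N $ l $ j"])
        (simp_all add: nonneg)
    finally show ?case .
  qed
  show "real N * trans \<delta> i j * a ^ (N - 1) \<le> ?p N $ i $ j" if ij: "i \<noteq> j" for N
  proof (induction N)
    case (Suc N)
    have nonneg': "0 \<le> trans \<delta> i j" by (simp add: transition_prob_def)
    \<comment> \<open>A new first step either remains in i and leaves the jump to the other N steps,
      or jumps at once and leaves N steps in j. For N = 0 the truncated exponent
      \<open>N - 1\<close> is harmless, since its coefficient is 0.\<close>
    have "real (Suc N) * trans \<delta> i j * a ^ (Suc N - 1)
        = a * (real N * trans \<delta> i j * a ^ (N - 1)) + trans \<delta> i j * a ^ N"
      by (cases N) (simp_all add: algebra_simps)
    also have "\<dots> \<le> trans \<delta> i i * ?p N $ i $ j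
        + trans \<delta> i j * ?p N $ j $ j"
      using a Suc jj[of N] nonneg' by (intro add_mono mult_mono) auto
    also have "\<dots> = (\<Sum>l\<in>{i, j}. trans \<delta> i l * ?p N $ l $ j)"
      using ij by simp
    also have "\<dots> \<le> (\<Sum>l\<in>UNIV. trans \<delta> i l * ?p N $ l $ j)"
      by (intro sum_mono2) (simp_all add: nonneg)
    also have "\<dots> = ?p (Suc N) $ i $ j"
      by (rule expand[symmetric]) simp
    finally show ?case .
  qed (simp add: prob_matrix_nonneg)
qed

abbreviation dyadics :: "real \<Rightarrow> nat \<Rightarrow> real set" where
  "dyadics h n \<equiv> (\<lambda>m. real m * (h / 2 ^ n)) ` {..2 ^ n}"

text \<open>Choose the mesh smaller than the room to the right of u inside both e and h, then round
  u up to the grid.\<close>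

lemma grid_dense:
  fixes u h :: real
  assumes "0 \<le> u" "u < e" "u < h"
  obtains n m where "m \<le> 2 ^ n" "u \<le> real m * (h / 2 ^ n)" "real m * (h / 2 ^ n) < e"
proof -
  define d where "d = min e h - u"
  have d: "d > 0" using assms by (simp add: d_def)
  have h: "h > 0" using assms by simp
  obtain n where n: "h / d < 2 ^ n" using real_arch_pow[of 2 "h / d"] by auto
  define \<delta> where "\<delta> = h / 2 ^ n"
  have \<delta>: "0 < \<delta>" "\<delta> < d" using n d h by (simp_all add: \<delta>_def field_simps)
  define m where "m = nat \<lceil>u / \<delta>\<rceil>"
  have "u / \<delta> \<le> real m" "real m < u / \<delta> + 1"
    using assms(1) \<delta>(1) by (auto simp: m_def) linarith+
  then have m: "u \<le> real m * \<delta>" "real m * \<delta> < u + \<delta>" using \<delta>(1) by (simp_all add: field_simps)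
  then have "real m * \<delta> < e" "real m * \<delta> < h" using \<delta> by (simp_all add: d_def)
  moreover from this have "real m < 2 ^ n" using h by (simp add: \<delta>_def field_simps)
  then have "m \<le> 2 ^ n" by simp
  ultimately show thesis using that[of m n] m by (simp add: \<delta>_def)
qed

text \<open>Dyadic grids are nested, so the events decrease, and measures are continuous from above.
  By right-continuity the intersection is staying in \<open>V\<close> throughout; the end point h is
  the grid point with m = 1, n = 0.\<close>

lemma stay_prob_lim:
  fixes h :: real and V :: "'o set"
  assumes h: "0 < h"
  defines "Q \<equiv> \<lambda>n x. \<forall>v\<in>dyadics h n. x v \<in> V"
  shows "(\<lambda>n. prob_matrix h (Q n) $ i $ j) \<longlonglongrightarrow> prob_matrix h (stay V h) $ i $ j"
proof -
  interpret prob_space "P i" by (rule prob_space_P)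
  define A where "A n = {\<omega> \<in> space M. Q n (path_of \<omega>) \<and> X h \<omega> = j}" for n
  have obs: "observable h (Q n)" for n
    unfolding Q_def
  proof (intro observable_grid subsetI)
    fix v assume "v \<in> dyadics h n"
    then obtain m where m: "m \<le> 2 ^ n" "v = real m * (h / 2 ^ n)" by auto
    have "real m \<le> 2 ^ n" using m(1) by simp
    then have "real m * (h / 2 ^ n) \<le> 2 ^ n * (h / 2 ^ n)" using h by (intro mult_right_mono) auto
    then show "v \<in> {0..h}" using h m by simp
  qed simp
  have A: "range A \<subseteq> sets (P i)"
    using observable_state_mem_sets[OF less_imp_le[OF h] obs, of _ j] by (auto simp: A_def sets_P)
  have "decseq A"
  proof (rule decseq_SucI)
    fix n
    have "real m * (h / 2 ^ n) = real (2 * m) * (h / 2 ^ Suc n)" for m by simp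
    then have "dyadics h n \<subseteq> dyadics h (Suc n)"
      by (intro image_subsetI image_eqI[where x = "2 * _"]) auto
    then show "A (Suc n) \<subseteq> A n" unfolding A_def Q_def by blast
  qed
  from finite_Lim_measure_decseq[OF A this]
  have "(\<lambda>n. measure (P i) (A n)) \<longlonglongrightarrow> measure (P i) (\<Inter>n. A n)" .
  moreover have "(\<Inter>n. A n) = {\<omega> \<in> space M. stay V h (path_of \<omega>) \<and> X h \<omega> = j}"
  proof safe
    fix \<omega> assume "\<omega> \<in> (\<Inter>n. A n)"
    then have \<omega>: "\<omega> \<in> space M" "X h \<omega> = j" "\<And>m n. m \<le> 2 ^ n \<Longrightarrow> X (real m * (h / 2 ^ n)) \<omega> \<in> V"
      by (auto simp: A_def Q_def)
    then show "\<omega> \<in> space M" "X h \<omega> = j" by auto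
    show "stay V h (path_of \<omega>)"
      unfolding stay_def
    proof
      fix u assume u: "u \<in> {0..h}"
      show "X u \<omega> \<in> V"
      proof (cases "u = h")
        case True
        then show ?thesis using \<omega>(3)[of 1 0] by simp
      next
        case False
        obtain e where e: "u < e" "\<And>v. u \<le> v \<Longrightarrow> v < e \<Longrightarrow> X v \<omega> = X u \<omega>"
          using right_continuous_pathD[OF right_continuous[OF \<omega>(1)], of u] u by (metis atLeastAtMost_iff)
        obtain n m where nm: "m \<le> 2 ^ n" "u \<le> real m * (h / 2 ^ n)" "real m * (h / 2 ^ n) < e"
          using grid_dense[of u e h] e(1) u False by (metis atLeastAtMost_iff le_less)
        from \<omega>(3)[OF nm(1)] e(2)[OF nm(2,3)] show ?thesis by simp
      qed
    qed
  next
    fix \<omega> n assume \<omega>: "\<omega> \<in> space M" "stay V h (path_of \<omega>)"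
    have "real m * (h / 2 ^ n) \<in> {0..h}" if "m \<le> 2 ^ n" for m
    proof -
      have "real m \<le> 2 ^ n" using that by simp
      then show ?thesis using h by (simp add: field_simps)
    qed
    with \<omega> show "\<omega> \<in> A n" if "j = X h \<omega>" using that by (auto simp: A_def Q_def stay_def)
  qed
  ultimately show ?thesis by (simp add: prob_matrix_def A_def)
qed

lemma tendsto_div_pow2: "filterlim (\<lambda>n. h / 2 ^ n) (at_right 0) sequentially" if "0 < (h :: real)"
proof -
  have "(\<lambda>n. h / 2 ^ n) \<longlonglongrightarrow> 0"
    using tendsto_mult_right_zero[OF LIMSEQ_realpow_zero[of "1/2"], of h] by (simp add: power_one_over)
  then show ?thesis using that by (simp add: filterlim_at)
qed

lemma eventually_trans_diag_ge:
  assumes "- \<Lambda> $ i $ i < c" "0 < h"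
  shows "\<forall>\<^sub>F n in sequentially. 1 - c * (h / 2 ^ n) \<le> trans (h / 2 ^ n) i i"
proof -
  have "\<forall>\<^sub>F \<delta> in at_right 0. - c < (trans \<delta> i i - 1) / \<delta>"
    using order_tendstoD(1)[OF trans_difference_quotient[of i i], of "- c"] assms by simp
  then have "\<forall>\<^sub>F \<delta> in at_right 0. 1 - c * \<delta> \<le> trans \<delta> i i"
    using eventually_at_right_less[of 0]
    by eventually_elim (simp add: field_simps)
  then show ?thesis
    using tendsto_div_pow2[OF assms(2)] by (rule eventually_compose_filterlim)
qed

text \<open>Apply \<open>grid_prob_ge\<close> with 2^n steps of length \<delta> = h / 2^n and a = 1
  - c \<delta>. Bernoulli's inequality bounds the power of a below by 1 - c h for every mesh, and
  2^n times the transition probability over \<delta> tends to h times the jump rate.\<close>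

lemma stay_pair_prob_ge:
  assumes h: "0 < h" and c: "- \<Lambda> $ i $ i < c" "- \<Lambda> $ j $ j < c"
  shows "i = j \<Longrightarrow> 1 - c * h \<le> prob_matrix h (stay {i, j} h) $ i $ j"
    and "i \<noteq> j \<Longrightarrow> h * \<Lambda> $ i $ j * (1 - c * h) \<le> prob_matrix h (stay {i, j} h) $ i $ j"
proof -
  let ?a = "\<lambda>n. 1 - c * (h / 2 ^ n)" and ?p = "prob_matrix h (stay {i, j} h) $ i $ j"
  define Q where "Q n x \<longleftrightarrow> (\<forall>v\<in>dyadics h n. x v \<in> {i, j})"
    for n and x :: "real \<Rightarrow> 'o"
  have lim: "(\<lambda>n. prob_matrix h (Q n) $ i $ j) \<longlonglongrightarrow> ?p"
    unfolding Q_def by (rule stay_prob_lim[OF h])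
  have c0: "0 < c" using c rate_nonpos[of i] by linarith
  have small: "\<forall>\<^sub>F n in sequentially. c * (h / 2 ^ n) \<le> 1"
  proof -
    have "(\<lambda>n. c * (h / 2 ^ n)) \<longlonglongrightarrow> c * 0"
      using tendsto_div_pow2[OF h] by (intro tendsto_mult tendsto_const) (simp add: filterlim_at)
    from order_tendstoD(2)[OF this, of 1] show ?thesis by (auto elim!: eventually_mono)
  qed
  have bern: "1 - c * h \<le> ?a n ^ 2 ^ n" if "c * (h / 2 ^ n) \<le> 1" for n
    using Bernoulli_inequality[of "- (c * (h / 2 ^ n))" "2 ^ n"] that by simp
  note ev = eventually_conj[OF small eventually_conj[OF eventually_trans_diag_ge[OF c(1) h]
        eventually_trans_diag_ge[OF c(2) h]]]
  show "1 - c * h \<le> ?p" if "i = j"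
  proof (rule tendsto_lowerbound[OF lim])
    show "\<forall>\<^sub>F n in sequentially. 1 - c * h \<le> prob_matrix h (Q n) $ i $ j"
      using ev
    proof eventually_elim
      case (elim n)
      then have "?a n ^ 2 ^ n \<le> prob_matrix (2 ^ n * (h / 2 ^ n)) (Q n) $ j $ j"
        unfolding Q_def using h grid_prob_ge(1)[of "h / 2 ^ n" "?a n" i j "2 ^ n"] by simp
      with bern[of n] elim show ?case using that by simp
    qed
  qed simp
  show "h * \<Lambda> $ i $ j * (1 - c * h) \<le> ?p" if ij: "i \<noteq> j"
  proof (rule tendsto_le[OF _ lim])
    have "(\<lambda>n. (trans (h / 2 ^ n) i j - (if i = j then 1 else 0)) / (h / 2 ^ n)) \<longlonglongrightarrow> \<Lambda> $ i $ j"
      by (rule filterlim_compose[OF trans_difference_quotient tendsto_div_pow2[OF h]])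
    then have "(\<lambda>n. h * (trans (h / 2 ^ n) i j / (h / 2 ^ n)) * (1 - c * h)) \<longlonglongrightarrow> h * \<Lambda> $ i $ j * (1 - c * h)"
      using ij by (intro tendsto_intros) simp
    then show "(\<lambda>n. 2 ^ n * trans (h / 2 ^ n) i j * (1 - c * h)) \<longlonglongrightarrow> h * \<Lambda> $ i $ j * (1 - c * h)"
      using h by (simp add: field_simps)
    show "\<forall>\<^sub>F n in sequentially. 2 ^ n * trans (h / 2 ^ n) i j * (1 - c * h) \<le> prob_matrix h (Q n) $ i $ j"
      using ev
    proof eventually_elim
      case (elim n)
      \<comment> \<open>Bernoulli's inequality was applied to the full exponent; lowering it by one
        only increases the power, the base being in [0, 1].\<close>
      have "?a n ^ 2 ^ n \<le> ?a n ^ (2 ^ n - 1)"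
        using elim c0 h by (intro power_decreasing) auto
      with bern[of n] elim have "1 - c * h \<le> ?a n ^ (2 ^ n - 1)" by simp
      then have "2 ^ n * trans (h / 2 ^ n) i j * (1 - c * h)
          \<le> 2 ^ n * trans (h / 2 ^ n) i j * ?a n ^ (2 ^ n - 1)"
        by (intro mult_left_mono) (auto simp: transition_prob_def)
      also have "\<dots> \<le> prob_matrix (2 ^ n * (h / 2 ^ n)) (Q n) $ i $ j"
        unfolding Q_def
        using h elim ij grid_prob_ge(2)[of "h / 2 ^ n" "?a n" i j "2 ^ n"] by simp
      finally show ?case by simp
    qed
  qed simp
qed

lemma prob_matrix_le_trans: "0 \<le> h \<Longrightarrow> observable h Q \<Longrightarrow> prob_matrix h Q $ i $ j \<le> trans h i j"
proof -
  assume h: "0 \<le> h" "observable h Q"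
  interpret prob_space "P i" by (rule prob_space_P)
  show ?thesis
    unfolding prob_matrix_def transition_prob_def
    using observable_state_mem_sets[OF h(1) observable_True[OF h(1)], of j]
    by (auto intro!: finite_measure_mono simp: sets_P)
qed

text \<open>To first order in \<open>h\<close>, all paths from \<open>i\<close> to \<open>j\<close> stay in \<open>{i, j}\<close>.\<close>

lemma leave_pair_prob:
  "((\<lambda>h. (trans h i j - prob_matrix h (stay {i, j} h) $ i $ j) / h) \<longlongrightarrow> 0) (at_right 0)"
proof -
  let ?p = "\<lambda>h. prob_matrix h (stay {i, j} h) $ i $ j"
  let ?d = "\<lambda>h. trans h i j - ?p h"
  have lower: "\<forall>\<^sub>F h in at_right 0. 0 \<le> ?d h / h"
    using eventually_at_right_less[of "0 :: real"]
    by eventually_elim (auto intro!: divide_nonneg_pos prob_matrix_le_trans observable_stay)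
  show ?thesis
  proof (cases "i = j")
    case True
    \<comment> \<open>The bound of \<open>stay_pair_prob_ge\<close> needs c strictly above the exit
      rate. Taking c larger by e / h costs only e, which is arbitrary.\<close>
    have "1 + \<Lambda> $ i $ i * h \<le> ?p h" if "0 < h" for h
    proof (rule field_le_epsilon)
      fix e :: real assume e: "0 < e"
      have "1 - (- \<Lambda> $ i $ i + e / h) * h \<le> ?p h"
        using e that True by (intro stay_pair_prob_ge(1)) simp_all
      moreover have "(- \<Lambda> $ i $ i + e / h) * h = - \<Lambda> $ i $ i * h + e"
        using that by (simp add: field_simps)
      ultimately show "1 + \<Lambda> $ i $ i * h \<le> ?p h + e" by simp
    qed
    then have *: "1 + \<Lambda> $ i $ i * h \<le> ?p h" if "0 < h" for h
      using that by simp
    have "\<forall>\<^sub>F h in at_right 0. ?d h / h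
        \<le> (trans h i j - (if i = j then 1 else 0)) / h - \<Lambda> $ i $ j"
      using eventually_at_right_less[of "0 :: real"]
    proof eventually_elim
      case (elim h)
      have "?d h / h
          \<le> (trans h i j - 1 - \<Lambda> $ i $ i * h) / h"
        using *[OF elim] elim by (intro divide_right_mono) auto
      also have "\<dots> = (trans h i j - (if i = j then 1 else 0)) / h - \<Lambda> $ i $ j"
        using elim True by (simp add: diff_divide_distrib)
      finally show ?case .
    qed
    moreover have "((\<lambda>h. (trans h i j - (if i = j then 1 else 0)) / h - \<Lambda> $ i $ j) \<longlongrightarrow> 0) (at_right 0)"
      using tendsto_diff[OF trans_difference_quotient[of i j] tendsto_const[of "\<Lambda> $ i $ j"]] by simp
    ultimately show ?thesis
      by (rule tendsto_sandwich[OF lower _ tendsto_const])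
  next
    case False
    \<comment> \<open>Exit rates are nonnegative, so one plus their sum exceeds both. Its size is
      irrelevant: c enters through a term of order h^2.\<close>
    define c where "c = 1 - \<Lambda> $ i $ i - \<Lambda> $ j $ j"
    have c: "- \<Lambda> $ i $ i < c" "- \<Lambda> $ j $ j < c"
      using rate_nonpos[of i] rate_nonpos[of j] by (simp_all add: c_def)
    have "\<forall>\<^sub>F h in at_right 0. ?d h / h
        \<le> (trans h i j - (if i = j then 1 else 0)) / h - \<Lambda> $ i $ j * (1 - c * h)"
      using eventually_at_right_less[of "0 :: real"]
    proof eventually_elim
      case (elim h)
      have "?d h / h
          \<le> (trans h i j - h * \<Lambda> $ i $ j * (1 - c * h)) / h"
        using stay_pair_prob_ge(2)[OF elim c False] elim by (intro divide_right_mono) auto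
      also have "\<dots> = (trans h i j - (if i = j then 1 else 0)) / h - \<Lambda> $ i $ j * (1 - c * h)"
        using elim False by (simp add: diff_divide_distrib)
      finally show ?case .
    qed
    moreover have "((\<lambda>h. (trans h i j - (if i = j then 1 else 0)) / h - \<Lambda> $ i $ j * (1 - c * h)) \<longlongrightarrow> 0) (at_right 0)"
    proof -
      have "((\<lambda>h. \<Lambda> $ i $ j * (1 - c * h)) \<longlongrightarrow> \<Lambda> $ i $ j * (1 - c * 0)) (at_right 0)"
        by (intro tendsto_intros)
      from tendsto_diff[OF trans_difference_quotient[of i j] this] show ?thesis by simp
    qed
    ultimately show ?thesis
      by (rule tendsto_sandwich[OF lower _ tendsto_const])
  qed
qed

text \<open>If the paths from i to j inside {i, j} already decide \<open>Q h\<close> as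
  \<open>c\<close>, then \<open>Q h\<close> and \<open>c\<close> differ only on paths leaving the
  pair, which have probability o(h) by \<open>leave_pair_prob\<close>. The first-order behaviour is
  thus that of the transition probability, or zero.\<close>

lemma prob_matrix_small_time:
  assumes Q: "\<And>h. 0 < h \<Longrightarrow> observable h (Q h)"
    and iff: "\<And>h x. \<lbrakk>0 < h; right_continuous_path x; x 0 = i; x h = j; stay {i, j} h x\<rbrakk> \<Longrightarrow> Q h x \<longleftrightarrow> c"
  shows "((\<lambda>h. (prob_matrix h (Q h) $ i $ j - of_bool (c \<and> i = j)) / h) \<longlongrightarrow> of_bool c * \<Lambda> $ i $ j) (at_right 0)"
proof -
  interpret prob_space "P i" by (rule prob_space_P)
  have "\<bar>prob_matrix h (Q h) $ i $ j - of_bool c * trans h i j\<bar>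
      \<le> trans h i j - prob_matrix h (stay {i, j} h) $ i $ j" if h: "0 < h" for h
  proof -
    have h0: "0 \<le> h" using h by simp
    note obs = Q[OF h] observable_stay[OF h0, of "{i, j}"] observable_True[OF h0]
    define A where "A R = {\<omega> \<in> space M. X 0 \<omega> = i \<and> R (path_of \<omega>) \<and> X h \<omega> = j}" for R
    have A: "A R \<in> sets (P i)" "prob_matrix h R $ i $ j = measure (P i) (A R)" if "observable h R" for R
    proof -
      have "A R = {\<omega> \<in> space M. X 0 \<omega> = i} \<inter> {\<omega> \<in> space M. R (path_of \<omega>) \<and> X h \<omega> = j}"
        by (auto simp: A_def)
      then show "A R \<in> sets (P i)"
        using subsetD[OF sets_history_subset start_mem_history[of i]]
          observable_state_mem_sets[OF h0 that, of j]
        by (simp only: sets_P sets.Int)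
      show "prob_matrix h R $ i $ j = measure (P i) (A R)"
        unfolding A_def by (rule prob_matrix_start[OF h0 that])
    qed
    have t: "trans h i j = measure (P i) (A (\<lambda>_. True))"
      using A(2)[OF obs(3)] by (simp add: trans_eq_prob_matrix)
    have Q_iff: "Q h (path_of \<omega>) \<longleftrightarrow> c" if "\<omega> \<in> A (stay {i, j} h)" for \<omega>
      using that iff[OF h right_continuous] by (auto simp: A_def)
    show ?thesis
    proof (cases c)
      case True
      then have "A (stay {i, j} h) \<subseteq> A (Q h)" using Q_iff by (auto simp: A_def)
      moreover have "A (Q h) \<subseteq> A (\<lambda>_. True)" by (auto simp: A_def)
      ultimately show ?thesis
        using True finite_measure_mono[OF _ A(1)[OF obs(1)]] finite_measure_mono[OF _ A(1)[OF obs(3)]]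
        by (simp add: A(2)[OF obs(1)] A(2)[OF obs(2)] t)
    next
      case False
      then have "A (stay {i, j} h) \<inter> A (Q h) = {}" using Q_iff by (auto simp: A_def)
      then have "measure (P i) (A (stay {i, j} h)) + measure (P i) (A (Q h))
          = measure (P i) (A (stay {i, j} h) \<union> A (Q h))"
        using A(1)[OF obs(1)] A(1)[OF obs(2)] by (simp add: finite_measure_Union)
      also have "\<dots> \<le> measure (P i) (A (\<lambda>_. True))"
        by (intro finite_measure_mono A(1) obs) (auto simp: A_def)
      finally show ?thesis using False by (simp add: A(2)[OF obs(1)] A(2)[OF obs(2)] t)
    qed
  qed
  then have "\<forall>\<^sub>F h in at_right 0. norm ((prob_matrix h (Q h) $ i $ j - of_bool c * trans h i j) / h)
      \<le> (trans h i j - prob_matrix h (stay {i, j} h) $ i $ j) / h"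
    using eventually_at_right_less[of "0 :: real"]
    by (auto elim!: eventually_mono intro!: divide_right_mono)
  then have "((\<lambda>h. (prob_matrix h (Q h) $ i $ j - of_bool c * trans h i j) / h) \<longlongrightarrow> 0) (at_right 0)"
    by (rule Lim_null_comparison) (rule leave_pair_prob)
  from tendsto_add[OF this tendsto_mult[OF tendsto_const[of "of_bool c"] trans_difference_quotient[of i j]]]
  show ?thesis by (cases c; cases "i = j") (simp_all add: diff_divide_distrib)
qed

end

section \<open>Staying in a set and crossing into a larger one\<close>

context finite_markov_process
begin

abbreviation E :: "'o set \<Rightarrow> real \<Rightarrow> real ^ 'o ^ 'o" where
  "E V h \<equiv> matrix_exp (h *\<^sub>R block \<Lambda> V V)"

abbreviation stay_matrix :: "'o set \<Rightarrow> real \<Rightarrow> real ^ 'o ^ 'o" where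
  "stay_matrix V h \<equiv> prob_matrix h (stay V h)"

abbreviation cross_matrix :: "'o set \<Rightarrow> 'o set \<Rightarrow> 'o set \<Rightarrow> real \<Rightarrow> real ^ 'o ^ 'o" where
  "cross_matrix V G V' h \<equiv> prob_matrix h (cross V G V' h)"

lemma stay_matrix_add:
  assumes "0 \<le> h" "0 \<le> k"
  shows "stay_matrix V (h + k) = stay_matrix V h ** stay_matrix V k"
  using prob_matrix_concat[OF assms observable_stay[OF assms(1), of V] observable_stay[OF assms(2), of V]]
  by (simp add: stay_add[OF assms, abs_def])

lemma stay_matrix_0: "stay_matrix V 0 = block (mat 1) V V"
proof (rule matrix_eqI)
  fix i j
  show "stay_matrix V 0 $ i $ j = block (mat 1) V V $ i $ j"
  proof (cases "i = j \<and> i \<in> V")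
    case True
    have "{\<omega> \<in> space M. X 0 \<omega> = i \<and> stay V 0 (\<lambda>v. X v \<omega>) \<and> X 0 \<omega> = j} = {\<omega> \<in> space M. X 0 \<omega> = i}"
      using True by (auto simp: stay_def)
    then have "stay_matrix V 0 $ i $ j = 1"
      using initial[of i] by (simp only: prob_matrix_start[OF order_refl observable_stay[OF order_refl]])
    then show ?thesis using True by (auto simp: mat_def)
  next
    case False
    then have "stay_matrix V 0 $ i $ j = 0"
      by (intro prob_matrix_eq_0 observable_stay) (auto simp: stay_def)
    then show ?thesis using False by (auto simp: mat_def)
  qed
qed

lemma stay_matrix_proj: "0 \<le> h \<Longrightarrow> stay_matrix V h ** block (mat 1) V V = stay_matrix V h"
proof (rule matrix_eqI)
  fix i j assume h: "0 \<le> h"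
  have "stay_matrix V h $ i $ j = 0" if "j \<notin> V"
    using that h by (intro prob_matrix_eq_0 observable_stay) (auto simp: stay_def)
  then show "(stay_matrix V h ** block (mat 1) V V) $ i $ j = stay_matrix V h $ i $ j"
    by (simp add: mult_block_one_nth)
qed

text \<open>A path from i to j that sees only these two states stays in \<open>V\<close> exactly if
  both lie in \<open>V\<close>, so \<open>prob_matrix_small_time\<close> applies.\<close>

lemma stay_matrix_quotient:
  "((\<lambda>h. (1 / h) *\<^sub>R (stay_matrix V h - block (mat 1) V V)) \<longlongrightarrow> block \<Lambda> V V) (at_right 0)"
proof (rule tendsto_matrixI)
  fix i j
  have "((\<lambda>h. (stay_matrix V h $ i $ j - of_bool ((i \<in> V \<and> j \<in> V) \<and> i = j)) / h)
      \<longlongrightarrow> of_bool (i \<in> V \<and> j \<in> V) * \<Lambda> $ i $ j) (at_right 0)"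
    by (rule prob_matrix_small_time) (auto simp: observable_stay stay_def)
  moreover have "of_bool ((i \<in> V \<and> j \<in> V) \<and> i = j) = block (mat 1) V V $ i $ j"
    "of_bool (i \<in> V \<and> j \<in> V) * \<Lambda> $ i $ j = block \<Lambda> V V $ i $ j"
    by (auto simp: mat_def)
  ultimately show "((\<lambda>h. ((1 / h) *\<^sub>R (stay_matrix V h - block (mat 1) V V)) $ i $ j) \<longlongrightarrow> block \<Lambda> V V $ i $ j) (at_right 0)"
    by simp
qed

lemma matrix_exp_quotient:
  "((\<lambda>h. (1 / h) *\<^sub>R (E V h - mat 1)) \<longlongrightarrow> block \<Lambda> V V) (at_right 0)"
proof (rule tendsto_matrixI)
  fix i j
  have "((\<lambda>h. E V h) has_vector_derivative block \<Lambda> V V ** E V 0) (at 0 within {0..})"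
    by (rule has_vector_derivative_matrix_exp)
  then show "((\<lambda>h. ((1 / h) *\<^sub>R (E V h - mat 1)) $ i $ j) \<longlongrightarrow> block \<Lambda> V V $ i $ j) (at_right 0)"
    by (simp add: has_vector_derivative_matrix_iff has_field_derivative_iff at_within_Ici_at_right)
qed

lemma norm_prob_matrix_le: "norm (prob_matrix h Q) \<le> real (CARD('o) * CARD('o))"
proof -
  have "norm (prob_matrix h Q) \<le> (\<Sum>i\<in>UNIV. norm (prob_matrix h Q $ i))"
    unfolding norm_vec_def by (rule L2_set_le_sum) simp
  also have "\<dots> \<le> (\<Sum>i\<in>(UNIV :: 'o set). \<Sum>j\<in>(UNIV :: 'o set). 1)"
  proof (rule sum_mono)
    fix i
    have "norm (prob_matrix h Q $ i) \<le> (\<Sum>j\<in>UNIV. norm (prob_matrix h Q $ i $ j))"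
      unfolding norm_vec_def by (rule L2_set_le_sum) simp
    also have "\<dots> \<le> (\<Sum>j\<in>(UNIV :: 'o set). 1)"
      by (intro sum_mono) (simp add: prob_matrix_nonneg prob_matrix_le_1)
    finally show "norm (prob_matrix h Q $ i) \<le> (\<Sum>j\<in>(UNIV :: 'o set). 1)" .
  qed
  finally show ?thesis by simp
qed

text \<open>\<open>t \<mapsto> stay_matrix V t ** E V (h - t)\<close> is constant, since its increments are of smaller
  order than the length of the interval.\<close>

theorem stay_matrix_eq_exp:
  assumes h: "0 \<le> h"
  shows "stay_matrix V h = block (mat 1) V V ** E V h"
proof -
  \<comment> \<open>The defect of the claim over a time k; both terms have the same value and the
    same derivative at 0, so it is o(k).\<close>
  define D where "D k = stay_matrix V k - block (mat 1) V V ** E V k" for k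
  define G where "G t = stay_matrix V t ** E V (h - t)" for t
  obtain K where K: "K \<ge> 0"
    "\<And>(B :: real ^ 'o ^ 'o) (C :: real ^ 'o ^ 'o). norm (B ** C) \<le> norm B * norm C * K"
    using matmul.nonneg_bounded by blast
  obtain c where c: "\<And>t. t \<in> {0..h} \<Longrightarrow> norm (E V (h - t)) \<le> c"
  proof -
    have "continuous_on {0..h} (\<lambda>t. E V (h - t))" by (intro continuous_intros)
    then have "bounded ((\<lambda>t. E V (h - t)) ` {0..h})"
      by (intro compact_imp_bounded compact_continuous_image) auto
    then obtain c where "\<forall>t\<in>{0..h}. norm (E V (h - t)) \<le> c" by (auto simp: bounded_iff)
    with that show thesis by blast
  qed
  define N where "N = real (CARD('o) * CARD('o))"
  have "G h = G 0"
  proof (rule increments_small_imp_eq[OF h])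
    fix s t assume st: "0 \<le> s" "s < t" "t \<le> h"
    have "E V (h - s) = E V (t - s) ** E V (h - t)"
      using matrix_exp_add[of "t - s" "h - t" "block \<Lambda> V V"] by simp
    \<comment> \<open>\<open>stay_matrix_proj\<close> inserts the projection to the right of
      \<open>stay_matrix V s\<close>, which turns the exponential over t - s into the projected one
      that \<open>D\<close> contains.\<close>
    then have "G t - G s = stay_matrix V s ** D (t - s) ** E V (h - t)"
      using st stay_matrix_add[of s "t - s" V] stay_matrix_proj[of s V]
      by (simp add: G_def D_def matmul.diff_left matmul.diff_right matrix_mul_assoc)
    also have "norm \<dots> \<le> N * norm (D (t - s)) * K * c * K"
    proof -
      have "norm (stay_matrix V s ** D (t - s)) \<le> N * norm (D (t - s)) * K"
        using K by (intro order_trans[OF K(2)] mult_right_mono)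
          (simp_all add: N_def norm_prob_matrix_le del: of_nat_mult)
      then have "norm (stay_matrix V s ** D (t - s)) * norm (E V (h - t)) \<le> N * norm (D (t - s)) * K * c"
        using c[of t] st K by (intro mult_mono) (auto simp: N_def)
      then show ?thesis using K by (intro order_trans[OF K(2)] mult_right_mono)
    qed
    finally show "norm (G t - G s) \<le> N * norm (D (t - s)) * K * c * K" .
  next
    have "((\<lambda>k. (1 / k) *\<^sub>R (stay_matrix V k - block (mat 1) V V)
        - block (mat 1) V V ** ((1 / k) *\<^sub>R (E V k - mat 1))) \<longlongrightarrow> block \<Lambda> V V - block (mat 1) V V ** block \<Lambda> V V) (at_right 0)"
      by (intro tendsto_diff stay_matrix_quotient matmul.tendsto tendsto_const matrix_exp_quotient)
    moreover have "block \<Lambda> V V - block (mat 1) V V ** block \<Lambda> V V = 0"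
      by (rule matrix_eqI) (simp add: block_one_mult_nth)
    moreover have "(1 / k) *\<^sub>R (stay_matrix V k - block (mat 1) V V)
        - block (mat 1) V V ** ((1 / k) *\<^sub>R (E V k - mat 1)) = (1 / k) *\<^sub>R D k" for k
      by (simp add: D_def matmul.scaleR_right matmul.diff_right scaleR_diff_right)
    ultimately have "((\<lambda>k. (1 / k) *\<^sub>R D k) \<longlongrightarrow> 0) (at_right 0)" by simp
    then have "((\<lambda>k. N * norm ((1 / k) *\<^sub>R D k) * K * c * K) \<longlongrightarrow> N * norm (0 :: real ^ 'o ^ 'o) * K * c * K) (at_right 0)"
      by (intro tendsto_intros)
    then have lim: "((\<lambda>k. N * norm ((1 / k) *\<^sub>R D k) * K * c * K) \<longlongrightarrow> 0) (at_right 0)" by simp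
    show "((\<lambda>k. N * norm (D k) * K * c * K / k) \<longlongrightarrow> 0) (at_right 0)"
      using eventually_at_right_less[of "0 :: real"]
      by (intro Lim_transform_eventually[OF lim]) (erule eventually_mono, simp)
  qed
  then show ?thesis by (simp add: G_def stay_matrix_0)
qed

text \<open>Rows indexed by \<open>V\<close> consist of staying probabilities; the others are rows
  of the identity.\<close>

lemma matrix_exp_nonneg:
  assumes "0 \<le> h"
  shows "0 \<le> E V h $ i $ j"
proof (cases "i \<in> V")
  case True
  then show ?thesis
    using arg_cong[OF stay_matrix_eq_exp[OF assms, of V], of "\<lambda>A. A $ i $ j"]
      prob_matrix_nonneg[of h "stay V h" i j] by (simp add: block_one_mult_nth)
qed (simp add: matrix_exp_block_outside)

text \<open>Staying in \<open>UNIV\<close> is no restriction, so this exponential is the transition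
  matrix. The fact removes the tail after the last crossing.\<close>

lemma matrix_exp_UNIV_row_sum:
  assumes "0 \<le> h"
  shows "(\<Sum>j\<in>UNIV. E UNIV h $ i $ j) = 1"
proof -
  interpret prob_space "P i" by (rule prob_space_P)
  have "block (mat 1) UNIV UNIV = (mat 1 :: real ^ 'o ^ 'o)"
    by (rule matrix_eqI) simp
  then have "E UNIV h = stay_matrix UNIV h"
    using stay_matrix_eq_exp[OF assms, of UNIV] by simp
  then have "(\<Sum>j\<in>UNIV. E UNIV h $ i $ j) = (\<Sum>j\<in>UNIV. measure (P i) {\<omega> \<in> space M. X h \<omega> = j})"
    by (simp add: prob_matrix_def stay_def)
  also have "\<dots> = measure (P i) {\<omega> \<in> space M. X h \<omega> \<in> UNIV}"
    using assms by (intro measure_eq_sum_values[symmetric] measurable_X sets.top)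
  also have "\<dots> = 1" using prob_space by simp
  finally show ?thesis .
qed

section \<open>Crossing probabilities: functional equation, rate at 0, integral formula\<close>

context
  fixes V G V' :: "'o set"
  assumes V: "V \<subseteq> V'" "G \<subseteq> V'" "V \<inter> G = {}"
begin

lemma cross_matrix_add:
  assumes "0 \<le> h" "0 \<le> k"
  shows "cross_matrix V G V' (h + k)
    = stay_matrix V h ** cross_matrix V G V' k + cross_matrix V G V' h ** stay_matrix V' k"
proof -
  note obs = observable_stay[OF assms(1), of V] observable_cross[OF assms(2) V]
    observable_cross[OF assms(1) V] observable_stay[OF assms(2), of V']
  have "cross_matrix V G V' (h + k) =
      prob_matrix (h + k) (\<lambda>x. (stay V h x \<and> cross V G V' k (\<lambda>v. x (h + v))) \<or> (cross V G V' h x \<and> stay V' k (\<lambda>v. x (h + v))))"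
    using cross_add[OF assms V] by (intro prob_matrix_cong) auto
  also have "\<dots> = prob_matrix (h + k) (\<lambda>x. stay V h x \<and> cross V G V' k (\<lambda>v. x (h + v)))
      + prob_matrix (h + k) (\<lambda>x. cross V G V' h x \<and> stay V' k (\<lambda>v. x (h + v)))"
    using assms not_stay_and_cross[OF V(3)] by (intro prob_matrix_disj observable_concat obs) auto
  also have "\<dots> = stay_matrix V h ** cross_matrix V G V' k + cross_matrix V G V' h ** stay_matrix V' k"
    by (simp only: prob_matrix_concat[OF assms obs(1,2)] prob_matrix_concat[OF assms obs(3,4)])
  finally show ?thesis .
qed

lemma cross_matrix_0: "cross_matrix V G V' 0 = 0"
proof (rule matrix_eqI)
  fix i j
  show "cross_matrix V G V' 0 $ i $ j = 0 $ i $ j"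
    using prob_matrix_eq_0[OF order_refl observable_cross[OF order_refl V], of i j]
    unfolding cross_def by fastforce
qed

lemma cross_matrix_proj:
  assumes "0 \<le> h"
  shows "block (mat 1) V V ** cross_matrix V G V' h = cross_matrix V G V' h"
    and "cross_matrix V G V' h ** block (mat 1) V' V' = cross_matrix V G V' h"
proof -
  have "cross_matrix V G V' h $ i $ j = 0" if "i \<notin> V \<or> j \<notin> V'" for i j
    using that by (intro prob_matrix_eq_0 assms observable_cross V) (auto simp: cross_def)
  then show "block (mat 1) V V ** cross_matrix V G V' h = cross_matrix V G V' h"
    "cross_matrix V G V' h ** block (mat 1) V' V' = cross_matrix V G V' h"
    by (auto intro!: matrix_eqI simp: block_one_mult_nth mult_block_one_nth)
qed

text \<open>The projection that distinguishes the staying matrix from the exponential commutes with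
  the latter and is absorbed by the crossing matrix, whose rows outside \<open>V\<close>
  vanish.\<close>

lemma stay_cross_matrix:
  assumes "0 \<le> h" "0 \<le> k"
  shows "stay_matrix V h ** cross_matrix V G V' k = E V h ** cross_matrix V G V' k"
  unfolding stay_matrix_eq_exp[OF assms(1)] matrix_exp_block_commutes[symmetric]
  by (simp add: cross_matrix_proj[OF assms(2)] flip: matrix_mul_assoc)

lemma cross_stay_matrix:
  assumes "0 \<le> h" "0 \<le> k"
  shows "cross_matrix V G V' h ** stay_matrix V' k = cross_matrix V G V' h ** E V' k"
  unfolding stay_matrix_eq_exp[OF assms(2)]
  by (simp add: cross_matrix_proj[OF assms(1)] matrix_mul_assoc)

text \<open>A path from i to j that sees only these two states crosses exactly if i is in
  \<open>V\<close> and j in \<open>G\<close>. As \<open>V\<close> and \<open>G\<close> are disjoint,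
  the diagonal contributes no term of order zero. For the existence part, the witness r = h
  works.\<close>

lemma cross_matrix_quotient:
  "((\<lambda>h. (1 / h) *\<^sub>R cross_matrix V G V' h) \<longlongrightarrow> block \<Lambda> V G) (at_right 0)"
proof (rule tendsto_matrixI)
  fix i j
  have "((\<lambda>h. (cross_matrix V G V' h $ i $ j - of_bool ((i \<in> V \<and> j \<in> G) \<and> i = j)) / h)
      \<longlongrightarrow> of_bool (i \<in> V \<and> j \<in> G) * \<Lambda> $ i $ j) (at_right 0)"
  proof (rule prob_matrix_small_time)
    fix h :: real and x :: "real \<Rightarrow> 'o"
    assume h: "0 < h" and x: "right_continuous_path x" "x 0 = i" "x h = j" "stay {i, j} h x"
    show "cross V G V' h x \<longleftrightarrow> i \<in> V \<and> j \<in> G"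
    proof
      assume "cross V G V' h x"
      then obtain t where t: "0 < t" "t \<le> h" "x 0 \<in> V" "x t \<in> G" by (auto simp: cross_def)
      moreover from t x have "x t \<in> {i, j}" by (auto simp: stay_def)
      ultimately show "i \<in> V \<and> j \<in> G" using x V by auto
    next
      assume "i \<in> V \<and> j \<in> G"
      then show "cross V G V' h x"
        unfolding cross_iff_rational[OF x(1) less_imp_le[OF h] V]
        using x V h
        by (intro conjI bexI[of _ h])
          (auto simp: stay_def dest!: bspec)
    qed
  qed (use V in \<open>simp add: observable_cross\<close>)
  moreover have "\<not> ((i \<in> V \<and> j \<in> G) \<and> i = j)"
    "of_bool (i \<in> V \<and> j \<in> G) * \<Lambda> $ i $ j = block \<Lambda> V G $ i $ j"
    using V by auto
  ultimately have "((\<lambda>h. (cross_matrix V G V' h $ i $ j - 0) / h) \<longlongrightarrow> block \<Lambda> V G $ i $ j) (at_right 0)"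
    by (simp only: of_bool_eq)
  then show "((\<lambda>h. ((1 / h) *\<^sub>R cross_matrix V G V' h) $ i $ j) \<longlongrightarrow> block \<Lambda> V G $ i $ j) (at_right 0)"
    by simp
qed

text \<open>Variation of constants: \<open>H t\<close> multiplies crossing up to t by the
  exponential of \<open>V'\<close> for the remaining time. It vanishes at a, is the crossing matrix
  at b, and by \<open>cross_matrix_add\<close> its increments factor around a short crossing, so the
  integrand is its derivative.\<close>

theorem has_bochner_integral_cross_matrix:
  assumes ab: "a \<le> b"
  shows "has_bochner_integral lborel
    (\<lambda>t. indicator {a..b} t *\<^sub>R (E V (t - a) ** block \<Lambda> V G ** E V' (b - t))) (cross_matrix V G V' (b - a))"
proof -
  let ?H = "\<lambda>t. E V (t - a) ** block \<Lambda> V G ** E V' (b - t)"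
  define H where "H t = cross_matrix V G V' (t - a) ** E V' (b - t)" for t
  have inc: "H t - H s = E V (s - a) ** cross_matrix V G V' (t - s) ** E V' (b - t)"
    if st: "a \<le> s" "s < t" "t \<le> b" for s t
  proof -
    have "E V' (b - s) = E V' (t - s) ** E V' (b - t)"
      using matrix_exp_add[of "t - s" "b - t" "block \<Lambda> V' V'"] by simp
    moreover have "cross_matrix V G V' (t - a)
        = E V (s - a) ** cross_matrix V G V' (t - s) + cross_matrix V G V' (s - a) ** E V' (t - s)"
      using cross_matrix_add[of "s - a" "t - s"] st by (simp add: stay_cross_matrix cross_stay_matrix)
    ultimately show ?thesis by (simp add: H_def matmul.add_left matrix_mul_assoc)
  qed
  have "has_bochner_integral lborel
      (\<lambda>t. indicator {a..b} t *\<^sub>R ?H t) (H b - H a)"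
  proof (rule has_bochner_integral_FTC_Icc[OF ab])
    fix t assume "a \<le> t" "t \<le> b"
    then show "(H has_vector_derivative ?H t) (at t within {a..b})"
      by (intro has_vector_derivative_increments[OF inc _ _ cross_matrix_quotient] continuous_intros) auto
  next
    show "continuous_on {a..b} ?H"
      by (intro matmul.continuous_on continuous_intros)
  qed
  then show ?thesis by (simp add: H_def cross_matrix_0 matmul.zero_left)
qed

lemma block_rates_nonneg: "0 \<le> block \<Lambda> V G $ i $ j"
proof -
  have "i \<noteq> j" if "i \<in> V" "j \<in> G" using that V by auto
  then show ?thesis using intensity by (auto simp: intensity_matrix_def)
qed

lemma nn_integral_cross_matrix:
  assumes ab: "a \<le> b"
  shows "(\<integral>\<^sup>+t\<in>{a<..b}. ennreal ((E V (t - a) ** block \<Lambda> V G ** E V' (b - t)) $ i $ j) \<partial>lborel)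
    = ennreal (cross_matrix V G V' (b - a) $ i $ j)"
proof -
  let ?H = "\<lambda>t. E V (t - a) ** block \<Lambda> V G ** E V' (b - t)"
  have "has_bochner_integral lborel
      (\<lambda>t. (indicator {a..b} t *\<^sub>R ?H t) $ i $ j)
      (cross_matrix V G V' (b - a) $ i $ j)"
    by (intro has_bochner_integral_bounded_linear[OF bounded_linear_vec_nth]
        has_bochner_integral_cross_matrix[OF ab])
  moreover have "0 \<le> (indicator {a..b} t *\<^sub>R ?H t) $ i $ j" for t
    by (cases "t \<in> {a..b}")
      (auto simp: matrix_matrix_mult_nth intro!: sum_nonneg mult_nonneg_nonneg matrix_exp_nonneg block_rates_nonneg
        simp del: block_nth)
  ultimately have "(\<integral>\<^sup>+t. ennreal ((indicator {a..b} t *\<^sub>R ?H t) $ i $ j) \<partial>lborel)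
      = ennreal (cross_matrix V G V' (b - a) $ i $ j)"
    by (subst nn_integral_eq_integral) (auto simp: has_bochner_integral_iff)
  \<comment> \<open>The fundamental theorem works on the closed interval, boxes are half open; the
    difference is a null set.\<close>
  moreover have "AE t in lborel. t \<noteq> a" by (rule AE_lborel_singleton)
  then have "(\<integral>\<^sup>+t\<in>{a<..b}. ennreal (?H t $ i $ j) \<partial>lborel)
      = (\<integral>\<^sup>+t. ennreal ((indicator {a..b} t *\<^sub>R ?H t) $ i $ j) \<partial>lborel)"
    by (intro nn_integral_cong_AE) (auto elim!: eventually_mono split: split_indicator)
  ultimately show ?thesis by simp
qed

end

end

section \<open>Crossing times in prescribed intervals\<close>

abbreviation lborel_tuples :: "nat \<Rightarrow> (nat \<Rightarrow> real) measure" where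
  "lborel_tuples m \<equiv> Pi\<^sub>M {1..m} (\<lambda>_. lborel)"

abbreviation tuple_space :: "nat \<Rightarrow> (nat \<Rightarrow> real) measure" where
  "tuple_space m \<equiv> Pi\<^sub>M {1..m} (\<lambda>_. borel)"

lemma nn_integral_PiM_Suc:
  fixes f :: "(nat \<Rightarrow> real) \<Rightarrow> ennreal"
  assumes "f \<in> borel_measurable (lborel_tuples (Suc k))"
  shows "integral\<^sup>N (lborel_tuples (Suc k)) f
    = (\<integral>\<^sup>+r. \<integral>\<^sup>+t. f (r(Suc k := t)) \<partial>lborel \<partial>lborel_tuples k)"
proof -
  interpret product_sigma_finite "\<lambda>_. lborel :: real measure" ..
  have "{1..Suc k} = insert (Suc k) {1..k}" by auto
  with product_nn_integral_insert[of "{1..k}" "Suc k" f] assms show ?thesis by simp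
qed

text \<open>A path through the nested sets \<open>V 1, V 2, \<dots>\<close> which passes from \<open>V n\<close> to \<open>V (n + 1)\<close>
  by entering \<open>G n\<close> during \<open>(a n, b n]\<close>.\<close>

primrec box_event :: "(nat \<Rightarrow> 'o set) \<Rightarrow> (nat \<Rightarrow> 'o set) \<Rightarrow> (nat \<Rightarrow> real) \<Rightarrow> (nat \<Rightarrow> real) \<Rightarrow> nat \<Rightarrow>
    (real \<Rightarrow> 'o) \<Rightarrow> bool" where
  "box_event V G a b 0 x \<longleftrightarrow> True"
| "box_event V G a b (Suc n) x \<longleftrightarrow> box_event V G a b n x \<and>
     stay (V (Suc n)) (a (Suc n) - b n) (\<lambda>v. x (b n + v)) \<and>
     cross (V (Suc n)) (G (Suc n)) (V (Suc (Suc n))) (b (Suc n) - a (Suc n)) (\<lambda>v. x (a (Suc n) + v))"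

context finite_markov_process
begin

text \<open>Tuples live on \<open>{1..m}\<close> and have no meaningful value at 0, so the initial
  time 0 is supplied by the conditional.\<close>

definition chain_matrix :: "(nat \<Rightarrow> 'o set) \<Rightarrow> (nat \<Rightarrow> 'o set) \<Rightarrow> (nat \<Rightarrow> real) \<Rightarrow> nat \<Rightarrow> real ^ 'o ^ 'o" where
  "chain_matrix V G r n = E (V n) (r n - (if n = 1 then 0 else r (n - 1))) ** block \<Lambda> (V n) (G n)"

definition chain_density :: "(nat \<Rightarrow> 'o set) \<Rightarrow> (nat \<Rightarrow> 'o set) \<Rightarrow> nat \<Rightarrow> real ^ 'o \<Rightarrow> (nat \<Rightarrow> real) \<Rightarrow> real" where
  "chain_density V G m \<alpha> r = (\<Sum>i\<in>UNIV. \<alpha> $ i * (\<Sum>j\<in>UNIV. matrix_prod (chain_matrix V G r) m $ i $ j))"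

context
  fixes V G :: "nat \<Rightarrow> 'o set" and m :: nat
  assumes chain: "\<And>n. 1 \<le> n \<Longrightarrow> n \<le> m \<Longrightarrow> V n \<subseteq> V (Suc n)"
    "\<And>n. 1 \<le> n \<Longrightarrow> n \<le> m \<Longrightarrow> G n \<subseteq> V (Suc n)"
    "\<And>n. 1 \<le> n \<Longrightarrow> n \<le> m \<Longrightarrow> V n \<inter> G n = {}"
begin

lemma borel_measurable_chain_density:
  "chain_density V G m \<alpha> \<in> borel_measurable (tuple_space m)"
proof -
  have "(\<lambda>r. matrix_prod (chain_matrix V G r) m $ i $ j) \<in> borel_measurable (tuple_space m)" for i j
    unfolding chain_matrix_def
  proof (intro borel_measurable_matrix_prod borel_measurable_matrix_mult borel_measurable_matrix_exp)
    fix n assume "1 \<le> n" "n \<le> m"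
    then show "(\<lambda>r. r n - (if n = 1 then 0 else r (n - 1))) \<in> borel_measurable (tuple_space m)"
      by (cases "n = 1") (auto intro!: borel_measurable_diff measurable_component_singleton)
  qed simp
  then show ?thesis unfolding chain_density_def[abs_def] by measurable
qed

lemma chain_density_nonneg:
  assumes "\<And>i. 0 \<le> \<alpha> $ i" and "\<And>n. 1 \<le> n \<Longrightarrow> n \<le> m \<Longrightarrow> (if n = 1 then 0 else r (n - 1)) \<le> r n"
  shows "0 \<le> chain_density V G m \<alpha> r"
  unfolding chain_density_def
proof (intro sum_nonneg mult_nonneg_nonneg matrix_prod_nonneg assms(1))
  fix n i j assume n: "1 \<le> n" "n \<le> m"
  show "0 \<le> chain_matrix V G r n $ i $ j"
    unfolding chain_matrix_def using assms(2)[OF n]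
    by (intro matrix_mult_nonneg matrix_exp_nonneg block_rates_nonneg[of _ "V (Suc n)"] chain n) simp
qed

context
  fixes a b :: "nat \<Rightarrow> real"
  assumes b0: "b 0 = 0" and ab: "\<And>n. n < m \<Longrightarrow> b n \<le> a (Suc n)" "\<And>n. n < m \<Longrightarrow> a (Suc n) \<le> b (Suc n)"
begin

text \<open>The staying factor is written as an exponential, which \<open>stay_cross_matrix\<close>
  permits in front of a crossing; \<open>box_kernel\<close> is the corresponding integrand for a
  crossing at time t.\<close>

definition box_matrix :: "nat \<Rightarrow> real ^ 'o ^ 'o" where
  "box_matrix n = E (V n) (a n - b (n - 1)) ** cross_matrix (V n) (G n) (V (Suc n)) (b n - a n)"

definition box_kernel :: "nat \<Rightarrow> real \<Rightarrow> real ^ 'o ^ 'o" where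
  "box_kernel n t = E (V n) (a n - b (n - 1)) **
    (E (V n) (t - a n) ** block \<Lambda> (V n) (G n) ** E (V (Suc n)) (b n - t))"

lemma b_nonneg: "n \<le> m \<Longrightarrow> 0 \<le> b n"
proof (induction n)
  case (Suc n)
  then show ?case using ab[of n] by linarith
qed (simp add: b0)

text \<open>The two claims are proved together because \<open>prob_matrix_concat\<close> requires
  the initial part of the event to be observable.\<close>

lemma box_event_observable_prob:
  "n \<le> m \<Longrightarrow> observable (b n) (box_event V G a b n) \<and>
    prob_matrix (b n) (box_event V G a b n) = matrix_prod box_matrix n"
proof (induction n)
  case 0
  have "observable 0 (\<lambda>_ :: real \<Rightarrow> 'o. True)" by (simp add: observable_True)
  moreover have "prob_matrix 0 (\<lambda>_. True) = mat 1"
    by (rule matrix_eqI) (simp add: mat_def trans_0 flip: trans_eq_prob_matrix)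
  moreover have "box_event V G a b 0 = (\<lambda>_. True)" by (simp add: fun_eq_iff)
  ultimately show ?case by (simp add: b0)
next
  case (Suc n)
  have n: "n < m" "1 \<le> Suc n" "Suc n \<le> m" "n \<le> m" using Suc.prems by auto
  from Suc have IH: "observable (b n) (box_event V G a b n)"
    "prob_matrix (b n) (box_event V G a b n) = matrix_prod box_matrix n" by auto
  note V = chain(1)[OF n(2,3)] chain(2)[OF n(2,3)] chain(3)[OF n(2,3)]
  define h where "h = a (Suc n) - b n"
  define k where "k = b (Suc n) - a (Suc n)"
  have hk: "0 \<le> h" "0 \<le> k" "0 \<le> h + k" using ab[OF n(1)] by (simp_all add: h_def k_def)
  have bhk: "b (Suc n) = b n + (h + k)" "a (Suc n) = b n + h" by (simp_all add: h_def k_def)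
  note obs1 = observable_stay[OF hk(1), of "V (Suc n)"] observable_cross[OF hk(2) V]
  define R where "R x \<longleftrightarrow> stay (V (Suc n)) h x \<and> cross (V (Suc n)) (G (Suc n)) (V (Suc (Suc n))) k (\<lambda>v. x (h + v))" for x
  have R: "observable (h + k) R" unfolding R_def by (rule observable_concat[OF hk(1,2) obs1])
  have eq: "box_event V G a b (Suc n) = (\<lambda>x. box_event V G a b n x \<and> R (\<lambda>v. x (b n + v)))"
    by (simp add: fun_eq_iff R_def h_def k_def add.assoc[symmetric])
  have "observable (b (Suc n)) (box_event V G a b (Suc n))"
    unfolding eq bhk(1) by (rule observable_concat[OF b_nonneg[OF n(4)] hk(3) IH(1) R])
  moreover have "prob_matrix (b (Suc n)) (box_event V G a b (Suc n)) = matrix_prod box_matrix n ** prob_matrix (h + k) R"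
    unfolding eq bhk(1) prob_matrix_concat[OF b_nonneg[OF n(4)] hk(3) IH(1) R] IH(2) ..
  moreover have "prob_matrix (h + k) R = box_matrix (Suc n)"
    unfolding R_def prob_matrix_concat[OF hk(1,2) obs1] stay_cross_matrix[OF V hk(1,2)]
    by (simp add: box_matrix_def h_def k_def)
  ultimately show ?case by (simp only: matrix_prod.simps simp_thms)
qed

lemmas observable_box_event = box_event_observable_prob[THEN conjunct1]
  and prob_matrix_box_event = box_event_observable_prob[THEN conjunct2]

text \<open>The exponential ending kernel n (time b n - r n) and the two starting kernel n + 1
  belong to the same block, and their times add up to r (n + 1) - r n. The exponential ending the
  last kernel has no successor, whence the extra factor on the left.\<close>

lemma chain_matrix_prod_eq_box_kernel:
  assumes "k \<le> m" "\<And>n. 1 \<le> n \<Longrightarrow> n \<le> m \<Longrightarrow> r n \<in> {a n<..b n}"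
  shows "matrix_prod (chain_matrix V G r) k ** E (V (Suc k)) (b k - (if k = 0 then 0 else r k))
    = matrix_prod (\<lambda>n. box_kernel n (r n)) k"
  using assms(1)
proof (induction k)
  case (Suc k)
  define r' where "r' = (if k = 0 then 0 else r k)"
  let ?E = "E (V (Suc k))" and ?L = "block \<Lambda> (V (Suc k)) (G (Suc k)) ** E (V (Suc (Suc k))) (b (Suc k) - r (Suc k))"
  have IH: "matrix_prod (chain_matrix V G r) k ** ?E (b k - r') = matrix_prod (\<lambda>n. box_kernel n (r n)) k"
    using Suc by (simp add: r'_def)
  have "matrix_prod (\<lambda>n. box_kernel n (r n)) (Suc k) = matrix_prod (chain_matrix V G r) k **
      (?E (b k - r') ** ?E (a (Suc k) - b k) ** ?E (r (Suc k) - a (Suc k))) ** ?L"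
  proof -
    have "box_kernel (Suc k) (r (Suc k)) = (?E (a (Suc k) - b k) ** ?E (r (Suc k) - a (Suc k))) ** ?L"
      by (simp add: box_kernel_def matrix_mul_assoc)
    then show ?thesis unfolding matrix_prod.simps IH[symmetric] by (simp only: matrix_mul_assoc)
  qed
  also have "?E (b k - r') ** ?E (a (Suc k) - b k) ** ?E (r (Suc k) - a (Suc k)) = ?E (r (Suc k) - r')"
    by (simp flip: matrix_exp_add)
  also have "?E (r (Suc k) - r') = ?E (r (Suc k) - (if Suc k = 1 then 0 else r (Suc k - 1)))"
    by (simp add: r'_def)
  finally show ?case by (simp add: chain_matrix_def matrix_mul_assoc)
qed (simp add: b0)

lemma box_kernel_nonneg:
  assumes n: "1 \<le> n" "n \<le> m" and t: "t \<in> {a n<..b n}"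
  shows "0 \<le> box_kernel n t $ i $ j"
proof -
  have "b (n - 1) \<le> a n" using ab(1)[of "n - 1"] n by simp
  then show ?thesis
    unfolding box_kernel_def using t
    by (intro matrix_mult_nonneg matrix_exp_nonneg block_rates_nonneg[of _ "V (Suc n)"] chain n) auto
qed

lemma borel_measurable_box_kernel:
  "(\<lambda>t. box_kernel n t $ i $ j) \<in> borel_measurable borel"
  unfolding box_kernel_def by (intro borel_measurable_matrix_mult borel_measurable_matrix_exp) auto

lemma borel_measurable_box_kernel_component:
  assumes "n \<in> I"
  shows "(\<lambda>r. box_kernel n (r n) $ i $ j) \<in> borel_measurable (Pi\<^sub>M I (\<lambda>_. lborel))"
proof -
  have "(\<lambda>t. box_kernel n t $ i $ j) \<in> borel_measurable lborel"
    using borel_measurable_box_kernel by simp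
  from measurable_compose[OF measurable_component_singleton[OF assms] this] show ?thesis .
qed

text \<open>The constant left factor leaves the integral and \<open>nn_integral_cross_matrix\<close>
  does the rest. Signs are known only for t in the window, so sums are moved through
  \<open>ennreal\<close> there and the indicator covers the other t.\<close>

lemma nn_integral_box_kernel:
  assumes n: "1 \<le> n" "n \<le> m"
  shows "(\<integral>\<^sup>+t\<in>{a n<..b n}. ennreal (box_kernel n t $ i $ j) \<partial>lborel) = ennreal (box_matrix n $ i $ j)"
proof -
  have le: "b (n - 1) \<le> a n" "a n \<le> b n" using ab[of "n - 1"] n by simp_all
  let ?H = "\<lambda>t. E (V n) (t - a n) ** block \<Lambda> (V n) (G n) ** E (V (Suc n)) (b n - t)"
  let ?C = "E (V n) (a n - b (n - 1))"
  have C: "0 \<le> ?C $ i $ k" for k using le by (intro matrix_exp_nonneg) simp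
  have [measurable]: "(\<lambda>t. ?H t $ k $ j) \<in> borel_measurable borel" for k
    by (intro borel_measurable_matrix_mult borel_measurable_matrix_exp) auto
  have H: "0 \<le> ?H t $ k $ j" if "t \<in> {a n<..b n}" for t k
    using that by (intro matrix_mult_nonneg matrix_exp_nonneg block_rates_nonneg[of _ "V (Suc n)"] chain n) auto
  have "(\<integral>\<^sup>+t\<in>{a n<..b n}. ennreal (box_kernel n t $ i $ j) \<partial>lborel)
      = (\<integral>\<^sup>+t. (\<Sum>k\<in>UNIV. ennreal (?C $ i $ k) * (ennreal (?H t $ k $ j) * indicator {a n<..b n} t)) \<partial>lborel)"
  proof (intro nn_integral_cong)
    fix t
    show "ennreal (box_kernel n t $ i $ j) * indicator {a n<..b n} t
        = (\<Sum>k\<in>UNIV. ennreal (?C $ i $ k) * (ennreal (?H t $ k $ j) * indicator {a n<..b n} t))"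
    proof (cases "t \<in> {a n<..b n}")
      case True
      have "ennreal (box_kernel n t $ i $ j) = (\<Sum>k\<in>UNIV. ennreal (?C $ i $ k * ?H t $ k $ j))"
        unfolding box_kernel_def matrix_matrix_mult_nth[of ?C]
        by (intro sum_ennreal[symmetric] mult_nonneg_nonneg C H True)
      then show ?thesis using True by (simp only: ennreal_mult'[OF C] indicator_simps mult_1_right)
    qed simp
  qed
  also have "\<dots> = (\<Sum>k\<in>UNIV. ennreal (?C $ i $ k) * (\<integral>\<^sup>+t\<in>{a n<..b n}. ennreal (?H t $ k $ j) \<partial>lborel))"
    by (simp add: nn_integral_sum nn_integral_cmult)
  also have "\<dots> = (\<Sum>k\<in>UNIV. ennreal (?C $ i $ k * cross_matrix (V n) (G n) (V (Suc n)) (b n - a n) $ k $ j))"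
    by (simp only: nn_integral_cross_matrix[OF chain(1)[OF n] chain(2)[OF n] chain(3)[OF n] le(2)]
        ennreal_mult'[OF C])
  also have "\<dots> = ennreal (box_matrix n $ i $ j)"
    unfolding box_matrix_def matrix_matrix_mult_nth
    by (intro sum_ennreal mult_nonneg_nonneg C prob_matrix_nonneg)
  finally show ?thesis .
qed

lemma box_matrix_nonneg:
  assumes n: "1 \<le> n" "n \<le> m"
  shows "0 \<le> box_matrix n $ i $ j"
  unfolding box_matrix_def using ab(1)[of "n - 1"] n
  by (intro matrix_mult_nonneg matrix_exp_nonneg prob_matrix_nonneg) simp

text \<open>Kernel n involves coordinate n only, so the last coordinate can be integrated first, by
  Tonelli, and the induction hypothesis takes care of the others.\<close>

lemma nn_integral_box_kernel_prod:
  assumes "k \<le> m"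
  shows "(\<integral>\<^sup>+r. ennreal (matrix_prod (\<lambda>n. box_kernel n (r n)) k $ i $ j) *
      (\<Prod>n\<in>{1..k}. indicator {a n<..b n} (r n)) \<partial>lborel_tuples k)
    = ennreal (matrix_prod box_matrix k $ i $ j)"
  using assms
proof (induction k arbitrary: j)
  case 0
  interpret product_sigma_finite "\<lambda>_. lborel :: real measure" ..
  show ?case by (simp add: PiM_empty)
next
  case (Suc k)
  interpret product_sigma_finite "\<lambda>_. lborel :: real measure" ..
  let ?B = "\<lambda>k r. \<Prod>n\<in>{1..k}. indicator {a n<..b n} (r n) :: ennreal"
  let ?Q = "\<lambda>k r. matrix_prod (\<lambda>n. box_kernel n (r n)) k"
  have k: "1 \<le> Suc k" "Suc k \<le> m" "k \<le> m" using Suc.prems by auto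
  have meas_Q: "(\<lambda>r. ?Q k' r $ i $ j) \<in> borel_measurable (lborel_tuples k')" for k' i j
    by (intro borel_measurable_matrix_prod borel_measurable_box_kernel_component) auto
  have meas_B: "?B k' \<in> borel_measurable (lborel_tuples k')" for k'
    by measurable
  have [measurable]: "(\<lambda>r. ennreal (?Q k' r $ i $ j) * ?B k' r) \<in> borel_measurable (lborel_tuples k')"
    for k' i j using meas_Q meas_B by measurable
  have meas_K [measurable]: "(\<lambda>t. box_kernel (Suc k) t $ l $ j) \<in> borel_measurable lborel" for l
    using borel_measurable_box_kernel by simp
  have ins: "{1..Suc k} = insert (Suc k) {1..k}" by auto
  have split: "ennreal (?Q (Suc k) r $ i $ j) * ?B (Suc k) r
      = (\<Sum>l\<in>UNIV. (ennreal (?Q k r $ i $ l) * ?B k r) *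
          (ennreal (box_kernel (Suc k) (r (Suc k)) $ l $ j) * indicator {a (Suc k)<..b (Suc k)} (r (Suc k))))" for r
  proof (cases "\<forall>n\<in>{1..Suc k}. r n \<in> {a n<..b n}")
    case True
    have "ennreal (?Q (Suc k) r $ i $ j)
        = (\<Sum>l\<in>UNIV. ennreal (?Q k r $ i $ l * box_kernel (Suc k) (r (Suc k)) $ l $ j))"
      unfolding matrix_prod.simps matrix_matrix_mult_nth using True k
      by (intro sum_ennreal[symmetric] mult_nonneg_nonneg matrix_prod_nonneg box_kernel_nonneg) auto
    also have "\<dots> = (\<Sum>l\<in>UNIV. ennreal (?Q k r $ i $ l) * ennreal (box_kernel (Suc k) (r (Suc k)) $ l $ j))"
      using True k by (intro sum.cong refl ennreal_mult matrix_prod_nonneg box_kernel_nonneg) auto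
    finally show ?thesis using True by (simp add: indicator_def)
  next
    case False
    then obtain n where "n \<in> {1..Suc k}" "r n \<notin> {a n<..b n}" by blast
    then have "n \<in> {1..Suc k}" "indicator {a n<..b n} (r n) = (0 :: ennreal)" by auto
    then have 0: "?B (Suc k) r = 0" by (intro prod_zero) auto
    have "?B k r * indicator {a (Suc k)<..b (Suc k)} (r (Suc k)) = 0"
      using 0 by (simp add: ins mult.commute)
    have *: "(x * ?B k r) * (y * indicator {a (Suc k)<..b (Suc k)} (r (Suc k))) = 0" for x y
    proof -
      have "(x * ?B k r) * (y * indicator {a (Suc k)<..b (Suc k)} (r (Suc k)))
          = (x * y) * (?B k r * indicator {a (Suc k)<..b (Suc k)} (r (Suc k)))"
        by (simp only: mult_ac)
      then show ?thesis by (simp only: \<open>?B k r * _ = 0\<close> mult_zero_right)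
    qed
    show ?thesis by (simp only: 0 * mult_zero_right sum.neutral_const)
  qed
  have "(\<integral>\<^sup>+r. ennreal (?Q (Suc k) r $ i $ j) * ?B (Suc k) r \<partial>lborel_tuples (Suc k))
      = (\<integral>\<^sup>+r. \<integral>\<^sup>+t. ennreal (?Q (Suc k) (r(Suc k := t)) $ i $ j) * ?B (Suc k) (r(Suc k := t))
          \<partial>lborel \<partial>lborel_tuples k)"
    by (rule nn_integral_PiM_Suc) measurable
  also have "\<dots> = (\<integral>\<^sup>+r. \<integral>\<^sup>+t. (\<Sum>l\<in>UNIV. (ennreal (?Q k r $ i $ l) * ?B k r) *
          (ennreal (box_kernel (Suc k) t $ l $ j) * indicator {a (Suc k)<..b (Suc k)} t))
          \<partial>lborel \<partial>lborel_tuples k)"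
  proof -
    \<comment> \<open>The first k factors do not see coordinate \<open>Suc k\<close>, hence are
      constant for the inner integral.\<close>
    have upd: "?Q k (r(Suc k := t)) = ?Q k r" "?B k (r(Suc k := t)) = ?B k r" for r t
      by (auto intro!: matrix_prod_cong prod.cong)
    show ?thesis by (simp only: split upd fun_upd_same)
  qed
  also have "\<dots> = (\<integral>\<^sup>+r. (\<Sum>l\<in>UNIV. (ennreal (?Q k r $ i $ l) * ?B k r) * ennreal (box_matrix (Suc k) $ l $ j))
          \<partial>lborel_tuples k)"
    by (simp add: nn_integral_sum nn_integral_cmult nn_integral_box_kernel[OF k(1,2)]
        del: One_nat_def)
  also have "\<dots> = (\<Sum>l\<in>UNIV. ennreal (matrix_prod box_matrix k $ i $ l) * ennreal (box_matrix (Suc k) $ l $ j))"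
    using Suc.IH[OF k(3)] by (simp add: nn_integral_sum nn_integral_multc del: One_nat_def)
  also have "\<dots> = (\<Sum>l\<in>UNIV. ennreal (matrix_prod box_matrix k $ i $ l * box_matrix (Suc k) $ l $ j))"
    using k by (intro sum.cong refl ennreal_mult[symmetric] matrix_prod_nonneg box_matrix_nonneg) auto
  also have "\<dots> = ennreal (matrix_prod box_matrix (Suc k) $ i $ j)"
    unfolding matrix_prod.simps matrix_matrix_mult_nth using k
    by (intro sum_ennreal mult_nonneg_nonneg matrix_prod_nonneg box_matrix_nonneg) auto
  finally show ?case .
qed

lemma measure_box_event:
  "measure (P i) {\<omega> \<in> space M. box_event V G a b m (path_of \<omega>)} = (\<Sum>j\<in>UNIV. matrix_prod box_matrix m $ i $ j)"
proof -
  have "measure (P i) {\<omega> \<in> space M. box_event V G a b m (path_of \<omega>)}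
      = measure (P i) {\<omega> \<in> {\<omega> \<in> space M. box_event V G a b m (path_of \<omega>)}. X (b m) \<omega> \<in> UNIV}" by simp
  also have "\<dots> = (\<Sum>j\<in>UNIV. prob_matrix (b m) (box_event V G a b m) $ i $ j)"
  proof (subst measure_eq_sum_values)
    show "X (b m) \<in> measurable M (count_space UNIV)" by (rule measurable_X[OF b_nonneg[OF order_refl]])
    show "{\<omega> \<in> space M. box_event V G a b m (path_of \<omega>)} \<in> sets M"
      by (rule observable_mem_sets[OF b_nonneg[OF order_refl] observable_box_event[OF order_refl]])
  qed (simp add: prob_matrix_def)
  finally show ?thesis by (simp add: prob_matrix_box_event)
qed

text \<open>On the box, chain density and product of kernels differ only by the final exponential of
  \<open>UNIV\<close>, and summing over the final state cancels it because its rows sum to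
  1.\<close>

lemma nn_integral_box_chain_density:
  assumes \<alpha>: "\<And>i. 0 \<le> \<alpha> $ i" and Vm: "V (Suc m) = UNIV"
  shows "(\<integral>\<^sup>+r. ennreal (chain_density V G m \<alpha> r) * indicator {r. \<forall>n\<in>{1..m}. r n \<in> {a n<..b n}} r
      \<partial>lborel_tuples m)
    = (\<Sum>i\<in>UNIV. ennreal (\<alpha> $ i) * emeasure (P i) {\<omega> \<in> space M. box_event V G a b m (path_of \<omega>)})"
proof -
  let ?B = "\<lambda>r. \<Prod>n\<in>{1..m}. indicator {a n<..b n} (r n) :: ennreal"
  let ?Q = "\<lambda>r. matrix_prod (\<lambda>n. box_kernel n (r n)) m"
  have B: "?B r = indicator {r. \<forall>n\<in>{1..m}. r n \<in> {a n<..b n}} r" for r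
  proof (cases "\<forall>n\<in>{1..m}. r n \<in> {a n<..b n}")
    case False
    then obtain n where "n \<in> {1..m}" "r n \<notin> {a n<..b n}" by blast
    then have "n \<in> {1..m}" "indicator {a n<..b n} (r n) = (0 :: ennreal)" by auto
    then have "?B r = 0" by (intro prod_zero) auto
    with False show ?thesis by simp
  qed simp
  have meas_Q: "(\<lambda>r. ?Q r $ i $ j) \<in> borel_measurable (lborel_tuples m)" for i j
    by (intro borel_measurable_matrix_prod borel_measurable_box_kernel_component) auto
  have [measurable]: "?B \<in> borel_measurable (lborel_tuples m)" by measurable
  have [measurable]: "(\<lambda>r. ennreal (?Q r $ i $ j) * ?B r) \<in> borel_measurable (lborel_tuples m)"
    for i j using meas_Q by measurable
  have density: "ennreal (chain_density V G m \<alpha> r) * ?B r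
      = (\<Sum>i\<in>UNIV. ennreal (\<alpha> $ i) * (\<Sum>j\<in>UNIV. ennreal (?Q r $ i $ j) * ?B r))" for r
  proof (cases "\<forall>n\<in>{1..m}. r n \<in> {a n<..b n}")
    case True
    \<comment> \<open>The time left after the last crossing, during which nothing is demanded of the
      path.\<close>
    define t where "t = b m - (if m = 0 then 0 else r m)"
    have t: "0 \<le> t" using True b0 by (auto simp: t_def)
    have "(\<Sum>j\<in>UNIV. ?Q r $ i $ j) = (\<Sum>j\<in>UNIV. matrix_prod (chain_matrix V G r) m $ i $ j)" for i
    proof -
      have "?Q r = matrix_prod (chain_matrix V G r) m ** E UNIV t"
        using chain_matrix_prod_eq_box_kernel[of m r] True Vm by (simp add: t_def)
      then have "(\<Sum>j\<in>UNIV. ?Q r $ i $ j)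
          = (\<Sum>k\<in>UNIV. matrix_prod (chain_matrix V G r) m $ i $ k * (\<Sum>j\<in>UNIV. E UNIV t $ k $ j))"
        by (simp add: matrix_matrix_mult_nth sum_distrib_left) (rule sum.swap)
      then show ?thesis by (simp add: matrix_exp_UNIV_row_sum[OF t])
    qed
    then have "chain_density V G m \<alpha> r = (\<Sum>i\<in>UNIV. \<alpha> $ i * (\<Sum>j\<in>UNIV. ?Q r $ i $ j))"
      by (simp add: chain_density_def)
    moreover have nonneg: "0 \<le> ?Q r $ i $ j" for i j
      using True by (intro matrix_prod_nonneg box_kernel_nonneg) auto
    ultimately have "ennreal (chain_density V G m \<alpha> r)
        = (\<Sum>i\<in>UNIV. ennreal (\<alpha> $ i) * (\<Sum>j\<in>UNIV. ennreal (?Q r $ i $ j)))"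
      by (simp add: \<alpha> sum_nonneg ennreal_mult flip: sum_ennreal)
    moreover have "?B r = 1" using True by simp
    ultimately show ?thesis by simp
  next
    case False
    then have "?B r = 0" unfolding B by simp
    then show ?thesis by (simp only: mult_zero_right sum.neutral_const)
  qed
  have prob: "emeasure (P i) {\<omega> \<in> space M. box_event V G a b m (path_of \<omega>)}
      = (\<Sum>j\<in>UNIV. ennreal (matrix_prod box_matrix m $ i $ j))" for i
  proof -
    interpret prob_space "P i" by (rule prob_space_P)
    show ?thesis
      unfolding emeasure_eq_measure measure_box_event
      by (intro sum_ennreal[symmetric] matrix_prod_nonneg box_matrix_nonneg)
  qed
  have "(\<integral>\<^sup>+r. ennreal (chain_density V G m \<alpha> r) * ?B r \<partial>lborel_tuples m)
      = (\<Sum>i\<in>UNIV. ennreal (\<alpha> $ i) * (\<Sum>j\<in>UNIV. ennreal (matrix_prod box_matrix m $ i $ j)))"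
    unfolding density using nn_integral_box_kernel_prod[OF order_refl]
    by (simp add: nn_integral_sum nn_integral_cmult del: One_nat_def)
  then show ?thesis unfolding prob B .
qed

end

end

end

section \<open>Hitting times\<close>

text \<open>For a start outside \<open>G\<close> the first time in \<open>G\<close> over [0,
  \<infinity>) is positive, so excluding time 0 in the infimum changes nothing, and
  \<open>first_exit\<close> from the complement shows that it is attained.\<close>

lemma hitting_time_eq_iff:
  assumes x: "right_continuous_path (\<lambda>u. X u \<omega>)" and start: "X 0 \<omega> \<notin> G"
  shows "hitting_time X G \<omega> = ereal t \<longleftrightarrow> 0 < t \<and> X t \<omega> \<in> G \<and> (\<forall>u\<in>{0..<t}. X u \<omega> \<notin> G)"
proof -
  have eq: "hitting_time X G \<omega> = ereal t" if t: "0 < t" "X t \<omega> \<in> G" "\<forall>u\<in>{0..<t}. X u \<omega> \<notin> G" for t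
  proof (rule antisym)
    show "hitting_time X G \<omega> \<le> ereal t"
      unfolding hitting_time_def using t by (intro Inf_lower) auto
    show "ereal t \<le> hitting_time X G \<omega>"
      unfolding hitting_time_def
    proof (intro Inf_greatest, clarify)
      fix u :: real assume "0 < u" "X u \<omega> \<in> G"
      then show "ereal t \<le> ereal u" using bspec[OF t(3), of u] by force
    qed
  qed
  show ?thesis
  proof
    assume t: "hitting_time X G \<omega> = ereal t"
    then obtain v where v: "0 < v" "X v \<omega> \<in> G"
      by (cases "{u. 0 < u \<and> X u \<omega> \<in> G} = {}") (auto simp: hitting_time_def top_ereal_def)
    obtain t' where t': "0 \<le> t'" "t' \<le> v" "X t' \<omega> \<notin> - G" "\<And>u. 0 \<le> u \<Longrightarrow> u < t' \<Longrightarrow> X u \<omega> \<in> - G"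
      using first_exit[OF x order_refl, of v "- G"] v by auto
    then have "0 < t'" using start by (cases "t' = 0") auto
    moreover from this have "t' = t" using eq[of t'] t t' by auto
    ultimately show "0 < t \<and> X t \<omega> \<in> G \<and> (\<forall>u\<in>{0..<t}. X u \<omega> \<notin> G)" using t' by auto
  qed (use eq in blast)
qed

text \<open>By right-continuity, a visit to \<open>G\<close> before c persists for a short time and
  is thus witnessed at a rational time before c.\<close>

lemma (in finite_markov_process) borel_measurable_hitting_time:
  "hitting_time X G \<in> borel_measurable M"
proof (rule borel_measurableI_less)
  fix c :: ereal
  have "{\<omega> \<in> space M. hitting_time X G \<omega> < c}
      = (\<Union>q\<in>{q\<in>\<rat>. 0 < q \<and> ereal q < c}. X q -` G \<inter> space M)"
  proof safe
    fix \<omega> assume \<omega>: "\<omega> \<in> space M" "hitting_time X G \<omega> < c"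
    then obtain u where u: "0 < u" "X u \<omega> \<in> G" "ereal u < c"
      by (auto simp: hitting_time_def Inf_less_iff)
    obtain e where e: "u < e" "\<And>v. u \<le> v \<Longrightarrow> v < e \<Longrightarrow> X v \<omega> = X u \<omega>"
      using right_continuous_pathD[OF right_continuous[OF \<omega>(1)] less_imp_le[OF u(1)]] by blast
    obtain d where d: "u < d" "ereal d < c" using ereal_dense3[OF u(3)] by auto
    obtain q where q: "q \<in> \<rat>" "u < q" "q < min d e"
      using Rats_dense_in_real[of u "min d e"] d e(1) by auto
    then have "ereal q < c" "X q \<omega> \<in> G"
      using d(2) e(2)[of q] u(2) less_trans[of "ereal q" "ereal d" c] by simp_all
    then show "\<omega> \<in> (\<Union>q\<in>{q\<in>\<rat>. 0 < q \<and> ereal q < c}. X q -` G \<inter> space M)"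
      using q u(1) \<omega>(1) by (intro UN_I[of q]) auto
  qed (auto simp: hitting_time_def Inf_less_iff)
  also have "\<dots> \<in> sets M"
  proof (rule sets.countable_UN'')
    show "countable {q \<in> \<rat>. 0 < q \<and> ereal q < c}"
      by (rule countable_subset[OF _ countable_rat]) auto
    show "X q -` G \<inter> space M \<in> sets M" if "q \<in> {q \<in> \<rat>. 0 < q \<and> ereal q < c}" for q
      using measurable_X[of q] that by (intro measurable_sets[of _ _ "count_space UNIV"]) auto
  qed
  finally show "{\<omega> \<in> space M. hitting_time X G \<omega> < c} \<in> sets M" .
qed

lemma box_event_iff:
  "box_event V G a b m x \<longleftrightarrow> (\<forall>n<m. stay (V (Suc n)) (a (Suc n) - b n) (\<lambda>v. x (b n + v)) \<and>
     cross (V (Suc n)) (G (Suc n)) (V (Suc (Suc n))) (b (Suc n) - a (Suc n)) (\<lambda>v. x (a (Suc n) + v)))"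
  by (induction m) (auto simp: less_Suc_eq)

lemma stay_shift: "stay V (a - b) (\<lambda>v. x (b + v)) \<longleftrightarrow> (\<forall>u\<in>{b..a}. x u \<in> V)" for a b :: real
proof
  assume *: "stay V (a - b) (\<lambda>v. x (b + v))"
  show "\<forall>u\<in>{b..a}. x u \<in> V"
  proof
    fix u assume "u \<in> {b..a}"
    with bspec[OF *[unfolded stay_def], of "u - b"] show "x u \<in> V" by simp
  qed
qed (auto simp: stay_def)

lemma cross_shift:
  "cross V G V' (b - a) (\<lambda>v. x (a + v)) \<longleftrightarrow>
    (\<exists>t\<in>{a<..b}. (\<forall>u\<in>{a..<t}. x u \<in> V) \<and> x t \<in> G \<and> (\<forall>u\<in>{t..b}. x u \<in> V'))" for a b :: real
proof
  assume "cross V G V' (b - a) (\<lambda>v. x (a + v))"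
  then obtain t where t: "0 < t" "t \<le> b - a" "\<forall>u\<in>{0..<t}. x (a + u) \<in> V" "x (a + t) \<in> G"
    "\<forall>u\<in>{t..b - a}. x (a + u) \<in> V'" by (auto simp: cross_def)
  have "x u \<in> V" if "u \<in> {a..<a + t}" for u using bspec[OF t(3), of "u - a"] that by simp
  moreover have "x u \<in> V'" if "u \<in> {a + t..b}" for u using bspec[OF t(5), of "u - a"] that by simp
  ultimately show "\<exists>t\<in>{a<..b}. (\<forall>u\<in>{a..<t}. x u \<in> V) \<and> x t \<in> G \<and> (\<forall>u\<in>{t..b}. x u \<in> V')"
    using t(1,2,4) by (intro bexI[of _ "a + t"]) auto
next
  assume "\<exists>t\<in>{a<..b}. (\<forall>u\<in>{a..<t}. x u \<in> V) \<and> x t \<in> G \<and> (\<forall>u\<in>{t..b}. x u \<in> V')"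
  then obtain t where "t \<in> {a<..b}" "\<forall>u\<in>{a..<t}. x u \<in> V" "x t \<in> G" "\<forall>u\<in>{t..b}. x u \<in> V'" by blast
  then show "cross V G V' (b - a) (\<lambda>v. x (a + v))"
    unfolding cross_def by (intro exI[of _ "t - a"]) auto
qed

text \<open>Dropping n - 1 components shifts the numbering by n - 1. The range of n includes
  \<open>length s + 1\<close>, where no component is left and the condition is empty.\<close>

lemma mem_W_iff:
  assumes "1 \<le> n"
  shows "i \<in> W \<Gamma> s n \<longleftrightarrow> (\<forall>l\<in>{n..length s}. \<forall>k\<in>component s l. i \<notin> \<Gamma> k)"
proof -
  have "component (drop (n - 1) s) l = component s (n - 1 + l)" if "l \<in> {1..length (drop (n - 1) s)}" for l
  proof -
    have "n - 1 + l - 1 = n - 1 + (l - 1)" "n - 1 \<le> length s" using that by auto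
    then show ?thesis unfolding component_def by (simp only: nth_drop)
  qed
  then have W: "i \<in> W \<Gamma> s n \<longleftrightarrow>
      (\<forall>l\<in>{1..length (drop (n - 1) s)}. \<forall>k\<in>component s (n - 1 + l). i \<notin> \<Gamma> k)"
    by (simp add: W_def covered_def)
  show ?thesis
    unfolding W
  proof (intro iffI ballI)
    fix l k
    assume *: "\<forall>l\<in>{1..length (drop (n - 1) s)}. \<forall>k\<in>component s (n - 1 + l). i \<notin> \<Gamma> k"
      and l: "l \<in> {n..length s}" and k: "k \<in> component s l"
    have "l - (n - 1) \<in> {1..length (drop (n - 1) s)}" "n - 1 + (l - (n - 1)) = l" using l assms by auto
    with * k show "i \<notin> \<Gamma> k" by metis
  next
    fix l k
    assume *: "\<forall>l\<in>{n..length s}. \<forall>k\<in>component s l. i \<notin> \<Gamma> k"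
      and l: "l \<in> {1..length (drop (n - 1) s)}" and k: "k \<in> component s (n - 1 + l)"
    have "n - 1 + l \<in> {n..length s}" using l assms by auto
    with * k show "i \<notin> \<Gamma> k" by blast
  qed
qed

section \<open>Boxes of crossing times and first hits along a fixed path\<close>

locale hitting_partition =
  fixes K :: "'k set" and s :: "'k set list" and \<Gamma> :: "'k \<Rightarrow> 'o set"
  assumes partition: "ordered_partition K s" and nonempty: "K \<noteq> {}"
begin

abbreviation m :: nat where "m \<equiv> length s"

abbreviation in_box :: "(nat \<Rightarrow> real) \<Rightarrow> (nat \<Rightarrow> real) \<Rightarrow> (real \<Rightarrow> 'o) \<Rightarrow> bool" where
  "in_box a b \<equiv> box_event (W \<Gamma> s) (T \<Gamma> s) a b m"

lemma component_nonempty: "n \<in> {1..m} \<Longrightarrow> component s n \<noteq> {}"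
  using partition unfolding ordered_partition_def subpartition_def by (elim conjE) (drule (1) bspec, simp)

lemma component_disjoint:
  assumes "n \<in> {1..m}" "n' \<in> {1..m}" "k \<in> component s n" "k \<in> component s n'"
  shows "n = n'"
proof (rule ccontr)
  assume "n \<noteq> n'"
  moreover have "\<forall>n\<in>{1..m}. \<forall>n'\<in>{1..m}. n \<noteq> n' \<longrightarrow> component s n \<inter> component s n' = {}"
    using partition unfolding ordered_partition_def subpartition_def by (elim conjE)
  ultimately have "component s n \<inter> component s n' = {}" using assms(1,2) by simp
  then show False using assms(3,4) by auto
qed

lemma Union_component: "(\<Union>n\<in>{1..m}. component s n) = K"
  using partition unfolding ordered_partition_def by (rule conjunct2)

lemma first_element_mem: "n \<in> {1..m} \<Longrightarrow> first_element s n \<in> component s n"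
  unfolding first_element_def some_in_eq by (rule component_nonempty)

lemma first_element_mem_K: "n \<in> {1..m} \<Longrightarrow> first_element s n \<in> K"
  using first_element_mem Union_component by blast

lemma m_pos: "1 \<le> m"
  using Union_component nonempty by (cases m) auto

text \<open>These are the hypotheses of the box computation. For disjointness, a point of
  \<open>T \<Gamma> s n\<close> lies in the set of the first element of component n, which
  \<open>W \<Gamma> s n\<close> avoids.\<close>

lemma W_T_chain:
  assumes "1 \<le> n" "n \<le> m"
  shows "W \<Gamma> s n \<subseteq> W \<Gamma> s (Suc n)" "T \<Gamma> s n \<subseteq> W \<Gamma> s (Suc n)" "W \<Gamma> s n \<inter> T \<Gamma> s n = {}"
proof -
  show "W \<Gamma> s n \<subseteq> W \<Gamma> s (Suc n)"   proof
    fix i assume "i \<in> W \<Gamma> s n"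
    then have "\<forall>l\<in>{n..m}. \<forall>k\<in>component s l. i \<notin> \<Gamma> k" using assms by (simp add: mem_W_iff)
    moreover have "{Suc n..m} \<subseteq> {n..m}" by auto
    ultimately have "\<forall>l\<in>{Suc n..m}. \<forall>k\<in>component s l. i \<notin> \<Gamma> k" by (meson subsetD)
    then show "i \<in> W \<Gamma> s (Suc n)" by (simp add: mem_W_iff)
  qed
  show "T \<Gamma> s n \<subseteq> W \<Gamma> s (Suc n)" by (auto simp: T_def)
  have n: "n \<in> {1..m}" "n \<in> {n..m}" using assms by auto
  have "i \<notin> T \<Gamma> s n" if "i \<in> W \<Gamma> s n" for i
    using bspec[OF bspec[OF mem_W_iff[OF assms(1), THEN iffD1, OF that] n(2)] first_element_mem[OF n(1)]]
      first_element_mem[OF n(1)] by (auto simp: T_def)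
  then show "W \<Gamma> s n \<inter> T \<Gamma> s n = {}" by auto
qed

lemma W_last: "W \<Gamma> s (Suc m) = UNIV"
  by (auto simp: mem_W_iff)

lemma W_first: "W \<Gamma> s 1 = UNIV - (\<Union>k\<in>K. \<Gamma> k)"
  using Union_component by (auto simp: mem_W_iff)

text \<open>For a start outside all \<Gamma> k and \<open>r n > 0\<close>, this says that the
  hitting times of component n all equal \<open>r n\<close>. The order of the \<open>r n\<close>
  comes from the boxes.\<close>

definition first_hits :: "(real \<Rightarrow> 'o) \<Rightarrow> (nat \<Rightarrow> real) \<Rightarrow> bool" where
  "first_hits x r \<longleftrightarrow> (\<forall>n\<in>{1..m}. \<forall>k\<in>component s n. x (r n) \<in> \<Gamma> k \<and> (\<forall>u\<in>{0..<r n}. x u \<notin> \<Gamma> k))"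

context
  fixes x :: "real \<Rightarrow> 'o" and a b :: "nat \<Rightarrow> real"
  assumes x0: "x 0 \<in> W \<Gamma> s 1"
    and b0: "b 0 = 0" and ab: "\<And>n. n < m \<Longrightarrow> b n \<le> a (Suc n)" "\<And>n. n < m \<Longrightarrow> a (Suc n) \<le> b (Suc n)"
begin

text \<open>Before r (n + 1) none of the sets of components n + 1, n + 2, ... has been visited, as
  their hitting times are no smaller. Those of components n + 2, ... are unvisited even up to b (n +
  1), because later windows lie beyond it.\<close>

lemma box_event_first_hits:
  assumes hits: "first_hits x r" and r: "\<And>n. n \<in> {1..m} \<Longrightarrow> r n \<in> {a n<..b n}"
  shows "in_box a b x"
  unfolding box_event_iff
proof (intro allI impI)
  fix n assume n: "n < m"
  have b_nonneg: "0 \<le> b l" if "l \<le> m" for l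
    using that by (induction l) (auto simp: b0 intro: order_trans[OF _ order_trans[OF ab]])
  have b_less: "b l < r l'" if "l < l'" "l' \<le> m" for l l'
    using that
  proof (induction l')
    case (Suc l')
    have step: "b l' < r (Suc l')" using ab(1)[of l'] r[of "Suc l'"] Suc.prems by simp
    show ?case
    proof (cases "l = l'")
      case False
      then have "b l < r l'" using Suc by simp
      also have "r l' \<le> b l'" using r[of l'] Suc.prems False by simp
      finally show ?thesis using step by simp
    qed (use step in simp)
  qed simp
  have r_mono: "r (Suc n) \<le> r l" if "Suc n \<le> l" "l \<le> m" for l
  proof (cases "l = Suc n")
    case False
    then show ?thesis using b_less[of "Suc n" l] r[of "Suc n"] that by simp
  qed simp
  have before: "x u \<in> W \<Gamma> s (Suc n)" if "0 \<le> u" "u < r (Suc n)" for u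
    using that r_mono hits by (force simp: mem_W_iff first_hits_def)
  have after: "x u \<in> W \<Gamma> s (Suc (Suc n))" if "0 \<le> u" "u \<le> b (Suc n)" for u
  proof -
    have "u < r l" if "l \<in> {Suc (Suc n)..m}" for l using b_less[of "Suc n" l] \<open>u \<le> b (Suc n)\<close> that by simp
    then show ?thesis using hits \<open>0 \<le> u\<close> by (force simp: mem_W_iff first_hits_def)
  qed
  have rn: "a (Suc n) < r (Suc n)" "r (Suc n) \<le> b (Suc n)" using r[of "Suc n"] n by auto
  have pos: "0 \<le> b n" "0 \<le> a (Suc n)" using b_nonneg[of n] ab(1)[OF n] n by simp_all
  show "stay (W \<Gamma> s (Suc n)) (a (Suc n) - b n) (\<lambda>v. x (b n + v)) \<and>
      cross (W \<Gamma> s (Suc n)) (T \<Gamma> s (Suc n)) (W \<Gamma> s (Suc (Suc n))) (b (Suc n) - a (Suc n)) (\<lambda>v. x (a (Suc n) + v))"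
    unfolding stay_shift cross_shift
  proof (intro conjI bexI[of _ "r (Suc n)"] ballI)
    show "x u \<in> W \<Gamma> s (Suc n)" if "u \<in> {b n..a (Suc n)}" for u using that pos rn by (intro before) auto
    show "x u \<in> W \<Gamma> s (Suc n)" if "u \<in> {a (Suc n)..<r (Suc n)}" for u using that pos rn by (intro before) auto
    show "x u \<in> W \<Gamma> s (Suc (Suc n))" if "u \<in> {r (Suc n)..b (Suc n)}" for u
      using that pos rn by (intro after) auto
    have "x (r (Suc n)) \<in> W \<Gamma> s (Suc (Suc n))" using pos rn by (intro after) auto
    then show "x (r (Suc n)) \<in> T \<Gamma> s (Suc n)" using hits n by (auto simp: T_def first_hits_def)
  qed (use rn in auto)
qed

text \<open>Take for \<open>r n\<close> the crossing time in window n. What has to be added is that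
  the sets of component n are unvisited on all of [0, r n), not only since b (n - 1).\<close>

lemma first_hits_box_event:
  assumes box: "in_box a b x"
  obtains r where "first_hits x r" "\<And>n. n \<in> {1..m} \<Longrightarrow> r n \<in> {a n<..b n}"
proof -
  have "\<forall>n\<in>{1..m}. \<exists>t. t \<in> {a n<..b n} \<and> (\<forall>u\<in>{b (n - 1)..<t}. x u \<in> W \<Gamma> s n) \<and>
      x t \<in> T \<Gamma> s n \<and> (\<forall>u\<in>{t..b n}. x u \<in> W \<Gamma> s (Suc n))"
  proof
    fix n assume n: "n \<in> {1..m}"
    then have "n - 1 < m" "Suc (n - 1) = n" by auto
    then have "\<forall>u\<in>{b (n - 1)..a n}. x u \<in> W \<Gamma> s n"
      and "\<exists>t\<in>{a n<..b n}. (\<forall>u\<in>{a n..<t}. x u \<in> W \<Gamma> s n) \<and> x t \<in> T \<Gamma> s n \<and> (\<forall>u\<in>{t..b n}. x u \<in> W \<Gamma> s (Suc n))"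
      using box unfolding box_event_iff stay_shift cross_shift by metis+
    then show "\<exists>t. t \<in> {a n<..b n} \<and> (\<forall>u\<in>{b (n - 1)..<t}. x u \<in> W \<Gamma> s n) \<and>
        x t \<in> T \<Gamma> s n \<and> (\<forall>u\<in>{t..b n}. x u \<in> W \<Gamma> s (Suc n))"
      by (metis atLeastAtMost_iff atLeastLessThan_iff linear)
  qed
  then obtain r where r: "\<forall>n\<in>{1..m}. r n \<in> {a n<..b n} \<and> (\<forall>u\<in>{b (n - 1)..<r n}. x u \<in> W \<Gamma> s n) \<and>
      x (r n) \<in> T \<Gamma> s n \<and> (\<forall>u\<in>{r n..b n}. x u \<in> W \<Gamma> s (Suc n))"
    by metis
  \<comment> \<open>The sets W grow with n, so a path that was in an earlier one is also in the
    current one; the start in the first one begins the induction.\<close>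
  have upto: "\<forall>u\<in>{0..b n}. x u \<in> W \<Gamma> s (Suc n)" if "n \<le> m" for n
    using that
  proof (induction n)
    case 0
    then show ?case using x0 b0 by (simp add: le_less)
  next
    case (Suc n)
    show ?case
    proof
      fix u assume u: "u \<in> {0..b (Suc n)}"
      have rn: "\<forall>u\<in>{b n..<r (Suc n)}. x u \<in> W \<Gamma> s (Suc n)" "\<forall>u\<in>{r (Suc n)..b (Suc n)}. x u \<in> W \<Gamma> s (Suc (Suc n))"
        using bspec[OF r, of "Suc n"] Suc.prems by auto
      have "x u \<in> W \<Gamma> s (Suc n) \<or> x u \<in> W \<Gamma> s (Suc (Suc n))"
        using Suc u rn by (cases "u \<le> b n"; cases "u < r (Suc n)") auto
      then show "x u \<in> W \<Gamma> s (Suc (Suc n))" using W_T_chain(1)[of "Suc n"] Suc.prems by auto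
    qed
  qed
  have "first_hits x r"
    unfolding first_hits_def
  proof (intro ballI conjI)
    fix n k assume n: "n \<in> {1..m}" and k: "k \<in> component s n"
    show "x (r n) \<in> \<Gamma> k" using r n k by (auto simp: T_def)
    fix u assume u: "u \<in> {0..<r n}"
    have "x u \<in> W \<Gamma> s n"
    proof (cases "u \<le> b (n - 1)")
      case True
      then show ?thesis using upto[of "n - 1"] n u by auto
    qed (use bspec[OF r n] u in auto)
    then show "x u \<notin> \<Gamma> k" using n k by (auto simp: mem_W_iff)
  qed
  then show thesis using that r by blast
qed

end

end

section \<open>The joint distribution\<close>

text \<open>Unlike \<open>increasing_tuples\<close>, this requires the first coordinate to be
  positive, as it is for hitting times and for all points of staggered boxes.\<close>

definition pos_increasing :: "nat \<Rightarrow> (nat \<Rightarrow> real) set" where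
  "pos_increasing m = {r \<in> {1..m} \<rightarrow>\<^sub>E UNIV. \<forall>n\<in>{1..m}. (if n = 1 then 0 else r (n - 1)) < r n}"

definition tuple_box :: "nat \<Rightarrow> (nat \<Rightarrow> real) \<Rightarrow> (nat \<Rightarrow> real) \<Rightarrow> (nat \<Rightarrow> real) set" where
  "tuple_box m a b = {r \<in> {1..m} \<rightarrow>\<^sub>E UNIV. \<forall>n\<in>{1..m}. r n \<in> {a n<..b n}}"

text \<open>Consecutive windows may touch, and a window may be empty, which provides the empty box
  needed for stability under intersection. \<open>b 0 = 0\<close> encodes the start of time.\<close>

definition staggered :: "nat \<Rightarrow> (nat \<Rightarrow> real) \<Rightarrow> (nat \<Rightarrow> real) \<Rightarrow> bool" where
  "staggered m a b \<longleftrightarrow> b 0 = 0 \<and> (\<forall>n<m. b n \<le> a (Suc n) \<and> a (Suc n) \<le> b (Suc n))"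

definition staggered_boxes :: "nat \<Rightarrow> (nat \<Rightarrow> real) set set" where
  "staggered_boxes m = {tuple_box m a b | a b. staggered m a b}"

text \<open>The windows abut, \<open>a n = b (n - 1)\<close>, so a single rational sequence
  determines the box; these countably many boxes suffice for covering.\<close>

definition rational_boxes :: "nat \<Rightarrow> (nat \<Rightarrow> real) set set" where
  "rational_boxes m = (\<lambda>b. tuple_box m (\<lambda>n. b (n - 1)) b) `
     {b \<in> {0..m} \<rightarrow>\<^sub>E \<rat>. staggered m (\<lambda>n. b (n - 1)) b}"

lemma rational_boxes_subset: "rational_boxes m \<subseteq> staggered_boxes m"
  unfolding rational_boxes_def staggered_boxes_def by blast

lemma countable_rational_boxes: "countable (rational_boxes m)"
proof -
  have "countable ({0..m} \<rightarrow>\<^sub>E (\<rat> :: real set))"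
    by (intro countable_PiE) (auto simp: countable_rat)
  then show ?thesis
    unfolding rational_boxes_def by (intro countable_image) (rule countable_subset, auto)
qed

lemma tuple_box_subset:
  assumes "staggered m a b"
  shows "tuple_box m a b \<subseteq> pos_increasing m"
proof
  fix r assume r: "r \<in> tuple_box m a b"
  have "(if n = 1 then 0 else r (n - 1)) < r n" if n: "n \<in> {1..m}" for n
  proof -
    have n': "n - 1 < m" "Suc (n - 1) = n" using n by auto
    with assms have "b (n - 1) \<le> a n" unfolding staggered_def by metis
    moreover have "a n < r n" using r n by (auto simp: tuple_box_def)
    moreover have "(if n = 1 then 0 else r (n - 1)) \<le> b (n - 1)"
    proof (cases "n = 1")
      case False
      then have "n - 1 \<in> {1..m}" using n by auto
      then show ?thesis using r False by (auto simp: tuple_box_def)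
    qed (use assms in \<open>simp add: staggered_def\<close>)
    ultimately show ?thesis by linarith
  qed
  then show "r \<in> pos_increasing m" using r by (simp add: pos_increasing_def tuple_box_def)
qed

lemma rational_box_around:
  assumes r: "r \<in> pos_increasing m" and c: "\<And>n. n \<in> {1..m} \<Longrightarrow> r n < c n"
  obtains B where "B \<in> rational_boxes m" "r \<in> B" "\<And>r' n. r' \<in> B \<Longrightarrow> n \<in> {1..m} \<Longrightarrow> r' n < c n"
proof -
  \<comment> \<open>The end point chosen above r n has to stay below c n and also below r (n + 1),
    so that the next coordinate falls into the next window.\<close>
  define d where "d n = (if n < m then min (c n) (r (Suc n)) else c n)" for n
  have less: "r n < d n" if "n \<in> {1..m}" for n
  proof -
    have "r n < r (Suc n)" if "n < m"
      using r \<open>n \<in> {1..m}\<close> that unfolding pos_increasing_def by (auto dest!: bspec[of _ _ "Suc n"])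
    then show ?thesis using c[OF that] by (auto simp: d_def)
  qed
  have "\<forall>n\<in>{1..m}. \<exists>q. q \<in> \<rat> \<and> r n < q \<and> q < d n"
    using less Rats_dense_in_real by blast
  then obtain q where q: "\<And>n. n \<in> {1..m} \<Longrightarrow> q n \<in> \<rat> \<and> r n < q n \<and> q n < d n"
    by metis
  define b where "b = (\<lambda>n\<in>{0..m}. if n = 0 then 0 else q n)"
  have b: "b 0 = 0" "\<And>n. n \<in> {1..m} \<Longrightarrow> b n = q n" by (auto simp: b_def)
  have lower: "b (n - 1) < r n" if n: "n \<in> {1..m}" for n
  proof (cases "n = 1")
    case True
    then show ?thesis using r n b unfolding pos_increasing_def by (auto dest!: bspec[of _ _ 1])
  next
    case False
    then have "n - 1 \<in> {1..m}" "n - 1 < m" "Suc (n - 1) = n" using n by auto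
    with q[of "n - 1"] show ?thesis by (simp add: b d_def)
  qed
  have stag: "staggered m (\<lambda>n. b (n - 1)) b"
    unfolding staggered_def
  proof (intro conjI allI impI)
    fix n assume "n < m"
    then show "b (Suc n - 1) \<le> b (Suc n)" using lower[of "Suc n"] q[of "Suc n"] b by simp
  qed (simp_all add: b)
  moreover have "b \<in> {0..m} \<rightarrow>\<^sub>E \<rat>" using q by (auto simp: b_def)
  ultimately have "tuple_box m (\<lambda>n. b (n - 1)) b \<in> rational_boxes m"
    unfolding rational_boxes_def by blast
  moreover have "r \<in> tuple_box m (\<lambda>n. b (n - 1)) b"
    using r lower q b by (auto simp: tuple_box_def pos_increasing_def less_imp_le)
  moreover have "r' n < c n" if r': "r' \<in> tuple_box m (\<lambda>n. b (n - 1)) b" and n: "n \<in> {1..m}" for r' n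
  proof -
    have "r' n \<le> b n" using r' n by (auto simp: tuple_box_def)
    also have "\<dots> < d n" using q[OF n] b(2)[OF n] by simp
    also have "\<dots> \<le> c n" by (simp add: d_def)
    finally show ?thesis .
  qed
  ultimately show thesis by (rule that)
qed

lemma Union_rational_boxes: "\<Union>(rational_boxes m) = pos_increasing m"
proof (intro equalityI subsetI)
  fix r assume "r \<in> pos_increasing m"
  then obtain B where "B \<in> rational_boxes m" "r \<in> B"
    using rational_box_around[of r m "\<lambda>n. r n + 1"] by (metis less_add_one)
  then show "r \<in> \<Union>(rational_boxes m)" by blast
qed (use tuple_box_subset in \<open>auto simp: rational_boxes_def\<close>)

lemma Int_stable_staggered_boxes:
  assumes "1 \<le> m"
  shows "Int_stable (staggered_boxes m)"
proof (rule Int_stableI)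
  fix A B assume "A \<in> staggered_boxes m" "B \<in> staggered_boxes m"
  then obtain a b a' b' where AB: "A = tuple_box m a b" "staggered m a b"
    "B = tuple_box m a' b'" "staggered m a' b'"
    by (auto simp: staggered_boxes_def)
  define a'' where "a'' n = max (a n) (a' n)" for n
  define b'' where "b'' n = min (b n) (b' n)" for n
  have eq: "A \<inter> B = tuple_box m a'' b''"
    by (auto simp: AB tuple_box_def a''_def b''_def)
  have le: "b'' n \<le> a'' (Suc n)" if "n < m" for n
    using AB(2,4) that by (auto simp: staggered_def a''_def b''_def min_le_iff_disj le_max_iff_disj)
  show "A \<inter> B \<in> staggered_boxes m"
  proof (cases "\<forall>n<m. a'' (Suc n) \<le> b'' (Suc n)")
    case True
    then have "staggered m a'' b''" using le AB(2,4) by (auto simp: staggered_def b''_def)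
    then show ?thesis unfolding eq staggered_boxes_def by blast
  next
    case False
    then obtain n where "n < m" "\<not> a'' (Suc n) \<le> b'' (Suc n)" by blast
    then have "r (Suc n) \<notin> {a'' (Suc n)<..b'' (Suc n)}" "Suc n \<in> {1..m}" for r :: "nat \<Rightarrow> real" by auto
    then have "A \<inter> B = {}" unfolding eq tuple_box_def by blast
    \<comment> \<open>For m at least 1 this degenerate staggered box is empty; for m = 0 it would
      contain the empty tuple.\<close>
    also have "{} = tuple_box m (\<lambda>_. 0) (\<lambda>_. 0)" using assms by (auto simp: tuple_box_def)
    finally show ?thesis unfolding staggered_boxes_def by (auto simp: staggered_def)
  qed
qed

lemma pos_increasing_sets: "pos_increasing m \<in> sets (tuple_space m)"
proof -
  let ?M = "tuple_space m"
  have "{r \<in> space ?M. \<forall>n\<in>{1..m}. (if n = 1 then 0 else r (n - 1)) < r n} \<in> sets ?M"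
  proof (intro sets.sets_Collect_finite_All)
    fix n assume n: "n \<in> {1..m}"
    have [measurable]: "(\<lambda>r. r n) \<in> borel_measurable ?M"
      using n by (rule measurable_component_singleton)
    have [measurable]: "(\<lambda>r. if n = 1 then 0 else r (n - 1)) \<in> borel_measurable ?M"
    proof (cases "n = 1")
      case False
      then have "n - 1 \<in> {1..m}" using n by auto
      from measurable_component_singleton[OF this, of "\<lambda>_. borel"] False show ?thesis by simp
    qed simp
    show "{r \<in> space ?M. (if n = 1 then 0 else r (n - 1)) < r n} \<in> sets ?M" by measurable
  qed simp
  then show ?thesis by (simp add: pos_increasing_def space_PiM)
qed

lemma tuple_box_sets: "tuple_box m a b \<in> sets (tuple_space m)"
proof -
  have "tuple_box m a b = (\<Pi>\<^sub>E n\<in>{1..m}. {a n<..b n})"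
  proof (rule set_eqI)
    fix r
    show "r \<in> tuple_box m a b \<longleftrightarrow> r \<in> (\<Pi>\<^sub>E n\<in>{1..m}. {a n<..b n})"
      unfolding tuple_box_def PiE_iff mem_Collect_eq by blast
  qed
  also have "\<dots> \<in> sets (tuple_space m)" by (rule sets_PiM_I_finite) auto
  finally show ?thesis .
qed

text \<open>The inclusion that needs work is that coordinates are measurable for the generated
  sigma-algebra: a set on which coordinate n is below c is the union of the countably many rational
  boxes inside it.\<close>

lemma sets_restrict_pos_increasing:
  "sets (restrict_space (tuple_space m) (pos_increasing m))
    = sigma_sets (pos_increasing m) (staggered_boxes m)"
proof -
  let ?M = "tuple_space m"
  let ?\<Omega> = "pos_increasing m"
  have sub: "staggered_boxes m \<subseteq> Pow ?\<Omega>"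
    using tuple_box_subset by (auto simp: staggered_boxes_def)
  define N where "N = sigma ?\<Omega> (staggered_boxes m)"
  have N: "sets N = sigma_sets ?\<Omega> (staggered_boxes m)" "space N = ?\<Omega>"
    unfolding N_def using sub by (simp_all add: space_measure_of_conv)
  show ?thesis
  proof (rule equalityI)
    \<comment> \<open>On the space of \<open>N\<close> this map is the identity; the conditional
      exhibits that its values are extensional.\<close>
    have "(\<lambda>r n. if n \<in> {1..m} then r n else undefined) \<in> measurable N ?M"
    proof (rule measurable_PiM_single')
      fix n assume n: "n \<in> {1..m}"
      show "(\<lambda>r. if n \<in> {1..m} then r n else undefined) \<in> borel_measurable N"
        unfolding borel_measurable_iff_less
      proof
        fix c :: real
        let ?R = "{B \<in> rational_boxes m. \<forall>r\<in>B. r n < c}"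
        have "{r \<in> space N. (if n \<in> {1..m} then r n else undefined) < c} = \<Union>?R"
        proof (intro equalityI subsetI)
          fix r assume "r \<in> {r \<in> space N. (if n \<in> {1..m} then r n else undefined) < c}"
          then have r: "r \<in> ?\<Omega>" "r n < c" using n N by auto
          \<comment> \<open>Only coordinate n is really bounded; the bounds r n' + 1 merely complete
            the hypotheses of \<open>rational_box_around\<close>.\<close>
          define c' where "c' n' = (if n' = n then c else r n' + 1)" for n'
          have "r n' < c' n'" for n' using r(2) by (simp add: c'_def)
          then obtain B where B: "B \<in> rational_boxes m" "r \<in> B" "\<And>r' n. r' \<in> B \<Longrightarrow> n \<in> {1..m} \<Longrightarrow> r' n < c' n"
            using rational_box_around[OF r(1), of c'] by blast
          have "r' n < c" if "r' \<in> B" for r' using B(3)[OF that n] by (simp add: c'_def)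
          with B(1,2) show "r \<in> \<Union>?R" by blast
        next
          fix r assume "r \<in> \<Union>?R"
          then show "r \<in> {r \<in> space N. (if n \<in> {1..m} then r n else undefined) < c}"
            using Union_rational_boxes[of m] n N by auto
        qed
        also have "\<dots> \<in> sets N"
          using rational_boxes_subset[of m]
          by (intro sets.countable_Union countable_subset[OF _ countable_rational_boxes[of m]])
            (auto simp: N)
        finally show "{r \<in> space N. (if n \<in> {1..m} then r n else undefined) < c} \<in> sets N" .
      qed
    qed (auto simp: N pos_increasing_def)
    moreover have "(\<lambda>n. if n \<in> {1..m} then r n else undefined) = r" if "r \<in> space N" for r
      using that by (auto simp: N pos_increasing_def PiE_iff extensional_def)
    ultimately have "(\<lambda>r. r) \<in> measurable N ?M"
      by (subst measurable_cong[where g = "\<lambda>r n. if n \<in> {1..m} then r n else undefined"]) auto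
    from measurable_sets[OF this] have "A \<inter> ?\<Omega> \<in> sets N" if "A \<in> sets ?M" for A
      using that by (simp add: N)
    then show "sets (restrict_space ?M ?\<Omega>) \<subseteq> sigma_sets ?\<Omega> (staggered_boxes m)"
      by (auto simp: sets_restrict_space N(1) Int_commute)
    have "staggered_boxes m \<subseteq> sets (restrict_space ?M ?\<Omega>)"
    proof
      fix C assume C: "C \<in> staggered_boxes m"
      then have "C \<in> sets ?M" using tuple_box_sets[of m] by (auto simp: staggered_boxes_def)
      moreover have "C \<subseteq> ?\<Omega>" using C sub by blast
      moreover have "?\<Omega> \<inter> space ?M \<in> sets ?M" using pos_increasing_sets[of m] by (intro sets.Int) auto
      ultimately show "C \<in> sets (restrict_space ?M ?\<Omega>)" by (simp add: sets_restrict_space_iff)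
    qed
    from sets.sigma_sets_subset[OF this]
    show "sigma_sets ?\<Omega> (staggered_boxes m) \<subseteq> sets (restrict_space ?M ?\<Omega>)"
      by (simp add: space_restrict_space space_PiM pos_increasing_def Int_absorb2 subset_iff)
  qed
qed

section \<open>The mixture and the law of the tuple of hitting times\<close>

lemma (in finite_markov_process)
  shows sets_mixture: "sets (mixture M P \<alpha>) = sets M"
    and space_mixture: "space (mixture M P \<alpha>) = space M"
    and emeasure_mixture:
      "A \<in> sets M \<Longrightarrow> emeasure (mixture M P \<alpha>) A = (\<Sum>i\<in>UNIV. ennreal (\<alpha> $ i) * emeasure (P i) A)"
proof -
  let ?\<mu> = "\<lambda>A. \<Sum>i\<in>UNIV. ennreal (\<alpha> $ i) * emeasure (P i) A"
  show sets: "sets (mixture M P \<alpha>) = sets M" and "space (mixture M P \<alpha>) = space M"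
    by (simp_all add: mixture_def)
  assume A: "A \<in> sets M"
  show "emeasure (mixture M P \<alpha>) A = ?\<mu> A"
  proof (rule emeasure_measure_of[OF mixture_def[of M P \<alpha>] sets.space_closed])
    show "positive (sets (mixture M P \<alpha>)) ?\<mu>" by (simp add: positive_def)
    show "countably_additive (sets (mixture M P \<alpha>)) ?\<mu>"
      unfolding sets
    proof (rule countably_additiveI)
      fix B :: "nat \<Rightarrow> 'w set"
      assume B: "range B \<subseteq> sets M" "disjoint_family B" "(\<Union>n. B n) \<in> sets M"
      have "(\<Sum>n. ?\<mu> (B n)) = (\<Sum>i\<in>UNIV. \<Sum>n. ennreal (\<alpha> $ i) * emeasure (P i) (B n))"
        by (intro suminf_sum summableI)
      also have "\<dots> = ?\<mu> (\<Union>n. B n)"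
        using B by (simp add: suminf_emeasure sets_P)
      finally show "(\<Sum>n. ?\<mu> (B n)) = ?\<mu> (\<Union>n. B n)" .
    qed
  qed (use A in \<open>simp add: sets\<close>)
qed

locale markov_hitting = finite_markov_process M P X \<Lambda> + hitting_partition K s \<Gamma>
  for M :: "'w measure" and P :: "'o::finite \<Rightarrow> 'w measure" and X and \<Lambda>
    and K :: "'k set" and s and \<Gamma> :: "'k \<Rightarrow> 'o set" +
  fixes \<alpha> :: "real ^ 'o"
  assumes finite_K: "finite K" and alpha: "prob_vector \<alpha>"
    and alpha_outside: "(\<Sum>i\<in>UNIV - (\<Union>k\<in>K. \<Gamma> k). \<alpha> $ i) = 1"
begin

abbreviation "mix \<equiv> mixture M P \<alpha>"
abbreviation "hit k \<equiv> hitting_time X (\<Gamma> k)"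
abbreviation "\<Omega> \<equiv> pos_increasing m"
abbreviation "hit_density \<equiv> hitting_density \<Lambda> \<Gamma> s \<alpha>"
abbreviation "K_tuples \<equiv> Pi\<^sub>M K (\<lambda>_. borel :: real measure)"
abbreviation "density_fun \<equiv> chain_density (W \<Gamma> s) (T \<Gamma> s) m \<alpha>"

abbreviation "fst_idx \<equiv> first_element s"

text \<open>Finiteness is included because \<open>real_of_ereal\<close>, used in
  \<open>times\<close>, sends \<infinity> to 0. The order of the components is not: it is imposed
  later by restricting \<open>times\<close> to increasing tuples.\<close>

definition pattern :: "'w set" where
  "pattern = {\<omega> \<in> space M. \<forall>n\<in>{1..m}. \<forall>k\<in>component s n.
     hit k \<omega> = hit (fst_idx n) \<omega> \<and> \<bar>hit (fst_idx n) \<omega>\<bar> \<noteq> \<infinity>}"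

definition times :: "'w \<Rightarrow> nat \<Rightarrow> real" where
  "times \<omega> = (\<lambda>n\<in>{1..m}. real_of_ereal (hit (fst_idx n) \<omega>))"

abbreviation "times_in B \<equiv> {\<omega> \<in> pattern. times \<omega> \<in> B}"

lemma alpha_nonneg: "0 \<le> \<alpha> $ i"
  using alpha by (simp add: prob_vector_def)

lemma alpha_eq_0:
  assumes "i \<notin> W \<Gamma> s 1"
  shows "\<alpha> $ i = 0"
proof -
  have "(\<Sum>i\<in>UNIV. \<alpha> $ i) = (\<Sum>i\<in>W \<Gamma> s 1. \<alpha> $ i) + (\<Sum>i\<in>- W \<Gamma> s 1. \<alpha> $ i)"
    by (subst sum.union_disjoint[symmetric]) auto
  then have "(\<Sum>i\<in>- W \<Gamma> s 1. \<alpha> $ i) = 0"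
    using alpha alpha_outside unfolding W_first prob_vector_def by linarith
  then show ?thesis using assms by (simp add: sum_nonneg_eq_0_iff alpha_nonneg)
qed

lemma finite_component: "n \<in> {1..m} \<Longrightarrow> finite (component s n)"
  using finite_K Union_component by (metis UN_upper finite_subset)

lemma pattern_sets: "pattern \<in> sets M"
proof -
  have [measurable]: "hit k \<in> borel_measurable M" for k by (rule borel_measurable_hitting_time)
  show ?thesis
    unfolding pattern_def using finite_component
    by (intro sets.sets_Collect_finite_All) (auto intro!: measurable_sets_Collect)
qed

lemma measurable_times: "times \<in> measurable M (tuple_space m)"
proof -
  have [measurable]: "hit k \<in> borel_measurable M" for k by (rule borel_measurable_hitting_time)
  show ?thesis unfolding times_def by measurable
qed

lemma times_sets:
  assumes "B \<in> sets (tuple_space m)"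
  shows "times_in B \<in> sets M"
proof -
  have "times_in B = pattern \<inter> (times -` B \<inter> space M)"
    by (auto simp: pattern_def)
  then show ?thesis using measurable_sets[OF measurable_times assms] pattern_sets by simp
qed

lemma pattern_hit:
  assumes "\<omega> \<in> pattern" "n \<in> {1..m}" "k \<in> component s n"
  shows "hit k \<omega> = ereal (times \<omega> n)"
  using assms by (auto simp: pattern_def times_def ereal_real)

lemma start_notin:
  assumes "X 0 \<omega> \<in> W \<Gamma> s 1" "n \<in> {1..m}" "k \<in> component s n"
  shows "X 0 \<omega> \<notin> \<Gamma> k"
  using assms by (auto simp: mem_W_iff)

lemma staggered_nonneg:
  assumes "staggered l a b" "n \<le> l"
  shows "0 \<le> b n"
  using assms(2)
proof (induction n)
  case (Suc n)
  then have "b n \<le> a (Suc n)" "a (Suc n) \<le> b (Suc n)" using assms(1) by (auto simp: staggered_def)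
  then show ?case using Suc by simp
qed (use assms(1) in \<open>simp add: staggered_def\<close>)

text \<open>Both directions pass through \<open>first_hits\<close>; the start in the first W is what
  allows \<open>hitting_time_eq_iff\<close> to translate the hitting times.\<close>

lemma times_mem_box_iff:
  assumes \<omega>: "\<omega> \<in> space M" "X 0 \<omega> \<in> W \<Gamma> s 1" and ab: "staggered m a b"
  shows "\<omega> \<in> pattern \<and> times \<omega> \<in> tuple_box m a b \<longleftrightarrow>
    in_box a b (path_of \<omega>)"
proof -
  have hit_iff: "hit k \<omega> = ereal t \<longleftrightarrow> 0 < t \<and> X t \<omega> \<in> \<Gamma> k \<and> (\<forall>u\<in>{0..<t}. X u \<omega> \<notin> \<Gamma> k)"
    if "n \<in> {1..m}" "k \<in> component s n" for n k t
    by (rule hitting_time_eq_iff[where X = X and \<omega> = \<omega> and G = "\<Gamma> k", OF right_continuous[OF \<omega>(1)] start_notin[OF \<omega>(2) that]])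
  have ab': "b 0 = 0" "\<And>n. n < m \<Longrightarrow> b n \<le> a (Suc n)" "\<And>n. n < m \<Longrightarrow> a (Suc n) \<le> b (Suc n)"
    using ab by (auto simp: staggered_def)
  show ?thesis
  proof
    assume "\<omega> \<in> pattern \<and> times \<omega> \<in> tuple_box m a b"
    then have *: "\<omega> \<in> pattern" "\<And>n. n \<in> {1..m} \<Longrightarrow> times \<omega> n \<in> {a n<..b n}"
      by (auto simp: tuple_box_def)
    have "first_hits (path_of \<omega>) (times \<omega>)"
      unfolding first_hits_def
    proof (intro ballI)
      fix n k assume nk: "n \<in> {1..m}" "k \<in> component s n"
      show "X (times \<omega> n) \<omega> \<in> \<Gamma> k \<and> (\<forall>u\<in>{0..<times \<omega> n}. X u \<omega> \<notin> \<Gamma> k)"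
        using iffD1[OF hit_iff[OF nk] pattern_hit[OF *(1) nk]] by (rule conjunct2)
    qed
    then show "in_box a b (path_of \<omega>)"
      using *(2) by (intro box_event_first_hits[where x = "path_of \<omega>" and a = a and b = b,
            OF \<omega>(2) ab']) auto
  next
    assume "in_box a b (path_of \<omega>)"
    then obtain r where r: "first_hits (path_of \<omega>) r" "\<And>n. n \<in> {1..m} \<Longrightarrow> r n \<in> {a n<..b n}"
      using first_hits_box_event[where x = "path_of \<omega>" and a = a and b = b, OF \<omega>(2) ab'] by blast
    have hit: "hit k \<omega> = ereal (r n)" if n: "n \<in> {1..m}" and k: "k \<in> component s n" for n k
    proof -
      have "n - 1 < m" "Suc (n - 1) = n" "n - 1 \<le> m" using n by auto
      then have "0 \<le> a n" using ab'(2)[of "n - 1"] staggered_nonneg[OF ab, of "n - 1"] by simp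
      then have "0 < r n" using r(2)[OF n] by simp
      then show ?thesis using hit_iff[OF n k] r(1) n k by (auto simp: first_hits_def)
    qed
    have "\<omega> \<in> pattern"
      using \<omega>(1) hit first_element_mem by (simp add: pattern_def)
    moreover have "times \<omega> n = r n" if "n \<in> {1..m}" for n
      using that hit[OF that first_element_mem[OF that]] by (simp add: times_def)
    ultimately show "\<omega> \<in> pattern \<and> times \<omega> \<in> tuple_box m a b"
      using r(2) by (simp add: tuple_box_def) (simp add: times_def)
  qed
qed

text \<open>States outside the first W have weight 0, and from the others the path almost surely
  starts there. Hence events need to be compared only on such paths.\<close>

lemma emeasure_mix_cong:
  assumes AB: "A \<in> sets M" "B \<in> sets M"
    and eq: "\<And>\<omega>. \<omega> \<in> space M \<Longrightarrow> X 0 \<omega> \<in> W \<Gamma> s 1 \<Longrightarrow> \<omega> \<in> A \<longleftrightarrow> \<omega> \<in> B"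
  shows "emeasure mix A = emeasure mix B"
proof -
  have "ennreal (\<alpha> $ i) * emeasure (P i) A = ennreal (\<alpha> $ i) * emeasure (P i) B" for i
  proof (cases "i \<in> W \<Gamma> s 1")
    case True
    have "emeasure (P i) A = emeasure (P i) B"
    proof (rule emeasure_eq_AE)
      show "AE \<omega> in P i. \<omega> \<in> A \<longleftrightarrow> \<omega> \<in> B"
        using AE_start[of i] AE_space by eventually_elim (use True eq in auto)
    qed (use AB in \<open>simp_all add: sets_P\<close>)
    then show ?thesis by simp
  qed (simp add: alpha_eq_0)
  then show ?thesis by (simp add: emeasure_mixture AB)
qed

lemma emeasure_times_box:
  assumes ab: "staggered m a b"
  shows "emeasure mix (times_in (tuple_box m a b))
    = (\<integral>\<^sup>+r. ennreal (density_fun r) * indicator (tuple_box m a b) r \<partial>lborel_tuples m)"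
proof -
  have ab': "b 0 = 0" "\<And>n. n < m \<Longrightarrow> b n \<le> a (Suc n)" "\<And>n. n < m \<Longrightarrow> a (Suc n) \<le> b (Suc n)"
    using ab by (auto simp: staggered_def)
  let ?A = "{\<omega> \<in> space M. in_box a b (path_of \<omega>)}"
  have A: "?A \<in> sets M"
    using observable_mem_sets[OF staggered_nonneg[OF ab order_refl] observable_box_event
        [where V = "W \<Gamma> s" and G = "T \<Gamma> s" and a = a and b = b and m = m, OF W_T_chain ab' order_refl]]
    by simp
  have "emeasure mix (times_in (tuple_box m a b)) = emeasure mix ?A"
    using times_mem_box_iff[OF _ _ ab]
    by (intro emeasure_mix_cong A times_sets tuple_box_sets) auto
  also have "\<dots> = (\<integral>\<^sup>+r. ennreal (density_fun r) * indicator {r. \<forall>n\<in>{1..m}. r n \<in> {a n<..b n}} r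
      \<partial>lborel_tuples m)"
    unfolding emeasure_mixture[OF A]
    by (rule nn_integral_box_chain_density[where V = "W \<Gamma> s" and G = "T \<Gamma> s"
          and a = a and b = b and m = m, OF W_T_chain ab' alpha_nonneg W_last, symmetric])
  also have "\<dots> = (\<integral>\<^sup>+r. ennreal (density_fun r) * indicator (tuple_box m a b) r \<partial>lborel_tuples m)"
    by (intro nn_integral_cong) (auto simp: tuple_box_def space_PiM split: split_indicator)
  finally show ?thesis .
qed

text \<open>The law of \<open>times\<close> on \<open>pattern\<close> and the measure with the
  claimed density, both restricted to \<open>\<Omega>\<close>, agree on staggered boxes. These are
  stable under intersection and generate the trace sigma-algebra.\<close>

lemma emeasure_times:
  assumes B: "B \<in> sets (tuple_space m)" "B \<subseteq> \<Omega>"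
  shows "emeasure mix (times_in B)
    = (\<integral>\<^sup>+r. ennreal (density_fun r) * indicator B r \<partial>lborel_tuples m)"
proof -
  let ?L = "lborel_tuples m" and ?B = "tuple_space m"
  have LB: "sets ?L = sets ?B" by (intro sets_PiM_cong) auto
  have f [measurable]: "(\<lambda>r. ennreal (density_fun r)) \<in> borel_measurable ?L"
    using borel_measurable_chain_density[where V = "W \<Gamma> s" and G = "T \<Gamma> s" and m = m, OF W_T_chain, of \<alpha>] measurable_cong_sets[OF LB refl] by auto
  have times [measurable]: "times \<in> measurable mix ?B"
    using measurable_times measurable_cong_sets[OF sets_mixture refl] by blast
  have pat [measurable]: "pattern \<in> sets mix" using pattern_sets by (simp add: sets_mixture)
  define \<mu>1 where "\<mu>1 = restrict_space (density ?L (\<lambda>r. ennreal (density_fun r))) \<Omega>"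
  define \<mu>2 where "\<mu>2 = restrict_space (distr (density mix (indicator pattern)) ?B times) \<Omega>"
  have 1: "emeasure \<mu>1 C = (\<integral>\<^sup>+r. ennreal (density_fun r) * indicator C r \<partial>?L)"
    if C: "C \<in> sets ?B" "C \<subseteq> \<Omega>" for C
  proof -
    have "\<Omega> \<inter> space (density ?L (\<lambda>r. ennreal (density_fun r))) \<in> sets (density ?L (\<lambda>r. ennreal (density_fun r)))"
      using pos_increasing_sets[of m] sets.top[of ?L] by (simp add: LB[symmetric] sets.Int)
    then have "emeasure \<mu>1 C = emeasure (density ?L (\<lambda>r. ennreal (density_fun r))) C"
      unfolding \<mu>1_def using C by (intro emeasure_restrict_space)
    also have "\<dots> = (\<integral>\<^sup>+r. ennreal (density_fun r) * indicator C r \<partial>?L)"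
      using C(1) by (intro emeasure_density f) (simp only: LB)
    finally show ?thesis .
  qed
  have 2: "emeasure \<mu>2 C = emeasure mix (times_in C)"
    if C: "C \<in> sets ?B" "C \<subseteq> \<Omega>" for C
  proof -
    have "emeasure \<mu>2 C = emeasure (distr (density mix (indicator pattern)) ?B times) C"
      unfolding \<mu>2_def using C pos_increasing_sets[of m] sets.top[of ?B]
      by (intro emeasure_restrict_space) (auto intro: sets.Int)
    also have "\<dots> = emeasure (density mix (indicator pattern)) (times -` C \<inter> space mix)"
      using times C by (subst emeasure_distr) auto
    also have "\<dots> = emeasure mix (pattern \<inter> (times -` C \<inter> space mix))"
      using measurable_sets[OF times C(1)] pat by (intro emeasure_restricted)
    also have "pattern \<inter> (times -` C \<inter> space mix) = times_in C"
      by (auto simp: pattern_def space_mixture)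
    finally show ?thesis .
  qed
  have box_eq: "emeasure \<mu>1 C = emeasure \<mu>2 C" if "C \<in> staggered_boxes m" for C
    using that emeasure_times_box 1 2 tuple_box_sets[of m] tuple_box_subset[of m]
    by (auto simp: staggered_boxes_def)
  have "\<mu>1 = \<mu>2"
  proof (rule measure_eqI_generator_eq_countable[OF Int_stable_staggered_boxes[OF m_pos] _ box_eq])
    show "staggered_boxes m \<subseteq> Pow \<Omega>" using tuple_box_subset[of m] by (auto simp: staggered_boxes_def)
    show "sets \<mu>1 = sigma_sets \<Omega> (staggered_boxes m)"
      unfolding \<mu>1_def sets_restrict_pos_increasing[symmetric]
      by (rule sets_restrict_space_cong) (simp only: sets_density LB)
    show "sets \<mu>2 = sigma_sets \<Omega> (staggered_boxes m)"
      unfolding \<mu>2_def sets_restrict_pos_increasing[symmetric]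
      by (rule sets_restrict_space_cong) (simp only: sets_distr)
    show "rational_boxes m \<subseteq> staggered_boxes m" by (rule rational_boxes_subset)
    show "\<Union>(rational_boxes m) = \<Omega>" by (rule Union_rational_boxes)
    show "countable (rational_boxes m)" by (rule countable_rational_boxes)
    fix C assume "C \<in> rational_boxes m"
    then have C: "C \<in> staggered_boxes m" using rational_boxes_subset by blast
    then obtain a b where ab: "C = tuple_box m a b" "staggered m a b"
      by (auto simp: staggered_boxes_def)
    have C': "C \<in> sets ?B" "C \<subseteq> \<Omega>"
      unfolding ab(1) by (rule tuple_box_sets, rule tuple_box_subset[OF ab(2)])
    \<comment> \<open>Finiteness on the covering boxes is read off the probability side, through the
      agreement on boxes.\<close>
    have "emeasure \<mu>1 C \<le> emeasure mix (space M)"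
      unfolding box_eq[OF C] 2[OF C'] by (intro emeasure_mono) (auto simp: pattern_def sets_mixture)
    also have "\<dots> = (\<Sum>i\<in>UNIV. ennreal (\<alpha> $ i))"
      using prob_space.emeasure_space_1[OF prob_space_P] by (simp add: emeasure_mixture)
    also have "\<dots> < \<infinity>" by (simp add: sum_ennreal alpha_nonneg)
    finally show "emeasure \<mu>1 C \<noteq> \<infinity>" by simp
  qed
  then show ?thesis using 1[OF B] 2[OF B] by simp
qed

section \<open>From tuples to points of the region\<close>

lemma spread_component:
  assumes "n \<in> {1..m}" "k \<in> component s n"
  shows "spread K s r k = r n"
proof -
  have "(THE n. n \<in> {1..m} \<and> k \<in> component s n) = n"
    using assms component_disjoint by (intro the_equality) auto
  moreover have "k \<in> K" using assms Union_component by blast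
  ultimately show ?thesis by (simp add: spread_def)
qed

lemma component_of:
  assumes "k \<in> K"
  obtains n where "n \<in> {1..m}" "k \<in> component s n"
  using assms Union_component by blast

lemma measurable_spread:
  "spread K s \<in> measurable (tuple_space m) K_tuples"
  unfolding spread_def
proof (rule measurable_restrict)
  fix k assume "k \<in> K"
  then obtain n where n: "n \<in> {1..m}" "k \<in> component s n" by (rule component_of)
  then have "(THE n. n \<in> {1..m} \<and> k \<in> component s n) = n"
    using component_disjoint by (intro the_equality) auto
  with n(1) show "(\<lambda>r. r (THE n. n \<in> {1..m} \<and> k \<in> component s n)) \<in> borel_measurable (tuple_space m)"
    by (simp only:) (rule measurable_component_singleton)
qed

lemma spread_first_element: "n \<in> {1..m} \<Longrightarrow> spread K s r (fst_idx n) = r n"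
  by (rule spread_component[OF _ first_element_mem])

text \<open>\<open>tbar\<close> of a spread tuple recovers its coordinates, and \<open>tbar\<close>
  at 0 matches the conditional in \<open>chain_matrix\<close>.\<close>

lemma hitting_density_spread:
  "hit_density (spread K s r) = density_fun r"
proof -
  have "tbar s (spread K s r) n - tbar s (spread K s r) (n - 1) = r n - (if n = 1 then 0 else r (n - 1))"
    if "1 \<le> n" "n \<le> m" for n
  proof -
    have "n \<in> {1..m}" "n \<noteq> 1 \<Longrightarrow> n - 1 \<in> {1..m}" using that by auto
    then show ?thesis using that by (auto simp: tbar_def spread_first_element)
  qed
  then have "matrix_prod (\<lambda>n. matrix_exp ((tbar s (spread K s r) n - tbar s (spread K s r) (n - 1)) *\<^sub>R
      block \<Lambda> (W \<Gamma> s n) (W \<Gamma> s n)) ** block \<Lambda> (W \<Gamma> s n) (T \<Gamma> s n)) m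
    = matrix_prod (chain_matrix (W \<Gamma> s) (T \<Gamma> s) r) m"
    by (intro matrix_prod_cong) (simp only: chain_matrix_def)
  then show ?thesis
    unfolding hitting_density_def chain_density_def
    by (simp add: vector_matrix_mult_def inner_vec_def sum_distrib_left mult.commute)
      (rule sum.swap)
qed

lemma spread_mem_region:
  assumes r: "r \<in> space (tuple_space m)" and U: "spread K s r \<in> region K s"
  shows "\<And>n. n \<in> {1..m} \<Longrightarrow> 0 \<le> r n"
    and "\<And>n n'. n \<in> {1..m} \<Longrightarrow> n' \<in> {1..m} \<Longrightarrow> n < n' \<Longrightarrow> r n < r n'"
    and "r \<in> increasing_tuples m"
proof -
  have 1: "spread K s r \<in> K \<rightarrow>\<^sub>E {0..}"
    and 2: "\<forall>n\<in>{1..m}. \<forall>n'\<in>{1..m}. n < n' \<longrightarrow>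
      spread K s r (fst_idx n) < spread K s r (fst_idx n')"
    using U unfolding region_def by simp_all
  show nonneg: "0 \<le> r n" if n: "n \<in> {1..m}" for n
    using PiE_mem[OF 1 first_element_mem_K[OF n]] by (simp add: spread_first_element[OF n])
  show less: "r n < r n'" if n: "n \<in> {1..m}" "n' \<in> {1..m}" "n < n'" for n n'
    using bspec[OF bspec[OF 2 n(1)] n(2)] n(3)
    by (simp add: spread_first_element[OF n(1)] spread_first_element[OF n(2)])
  show "r \<in> increasing_tuples m"
    unfolding increasing_tuples_def using r nonneg less
    by (auto simp: space_PiM PiE_iff strict_mono_on_def)
qed

lemma increasing_tuples_sets: "increasing_tuples m \<in> sets (tuple_space m)"
proof -
  let ?M = "tuple_space m"
  have "{r \<in> space ?M. (\<forall>n\<in>{1..m}. 0 \<le> r n) \<and> (\<forall>n\<in>{1..m}. \<forall>n'\<in>{1..m}. n < n' \<longrightarrow> r n < r n')} \<in> sets ?M"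
    by measurable
  also have "{r \<in> space ?M. (\<forall>n\<in>{1..m}. 0 \<le> r n) \<and> (\<forall>n\<in>{1..m}. \<forall>n'\<in>{1..m}. n < n' \<longrightarrow> r n < r n')}
      = increasing_tuples m"
    unfolding increasing_tuples_def strict_mono_on_def space_PiM PiE_iff by auto
  finally show ?thesis .
qed

text \<open>A point of the region is the spread of its own values at the first elements, so the
  event for the hitting times can be written as one for the tuple \<open>times\<close>.\<close>

lemma hitting_event_eq:
  assumes U: "U \<subseteq> region K s"
  shows "{\<omega> \<in> space M. \<exists>t\<in>U. \<forall>k\<in>K. hit k \<omega> = ereal (t k)}
    = {\<omega> \<in> pattern. times \<omega> \<in> {r \<in> space (tuple_space m). spread K s r \<in> U}}"
proof (intro set_eqI iffI)
  fix \<omega> assume "\<omega> \<in> {\<omega> \<in> space M. \<exists>t\<in>U. \<forall>k\<in>K. hit k \<omega> = ereal (t k)}"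
  then obtain t where \<omega>: "\<omega> \<in> space M" and t: "t \<in> U" "\<And>k. k \<in> K \<Longrightarrow> hit k \<omega> = ereal (t k)" by blast
  have reg: "t k = t (fst_idx n)" if "n \<in> {1..m}" "k \<in> component s n" for n k
    using U t(1) that first_element_mem[OF that(1)] unfolding region_def by blast
  have K: "k \<in> K" if "n \<in> {1..m}" "k \<in> component s n" for n k using that Union_component by blast
  have "\<omega> \<in> pattern"
    unfolding pattern_def using \<omega> reg t(2)[OF K] t(2)[OF first_element_mem_K] by simp
  moreover have times: "times \<omega> n = t (fst_idx n)" if "n \<in> {1..m}" for n
    using that t(2)[OF first_element_mem_K[OF that]] by (simp add: times_def)
  have "spread K s (times \<omega>) = t"
  proof
    fix k
    show "spread K s (times \<omega>) k = t k"
    proof (cases "k \<in> K")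
      case True
      then obtain n where "n \<in> {1..m}" "k \<in> component s n" by (rule component_of)
      then show ?thesis using reg times by (simp only: spread_component)
    next
      case False
      then show ?thesis
        using U t(1) by (auto simp: spread_def region_def PiE_iff extensional_def)
    qed
  qed
  moreover have "times \<omega> \<in> space (tuple_space m)"
    by (simp add: times_def space_PiM)
  ultimately show "\<omega> \<in> {\<omega> \<in> pattern. times \<omega> \<in> {r \<in> space (tuple_space m). spread K s r \<in> U}}"
    using t(1) by simp
next
  fix \<omega> assume "\<omega> \<in> {\<omega> \<in> pattern. times \<omega> \<in> {r \<in> space (tuple_space m). spread K s r \<in> U}}"
  then have \<omega>: "\<omega> \<in> pattern" "spread K s (times \<omega>) \<in> U" by auto
  have "hit k \<omega> = ereal (spread K s (times \<omega>) k)" if k: "k \<in> K" for k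
  proof -
    obtain n where "n \<in> {1..m}" "k \<in> component s n" by (rule component_of[OF k])
    then show ?thesis using pattern_hit[OF \<omega>(1)] by (simp only: spread_component)
  qed
  moreover have "\<omega> \<in> space M" using \<omega>(1) by (simp add: pattern_def)
  ultimately show "\<omega> \<in> {\<omega> \<in> space M. \<exists>t\<in>U. \<forall>k\<in>K. hit k \<omega> = ereal (t k)}" using \<omega>(2) by blast
qed

lemma AE_PiM_lborel_component_neq:
  assumes "n \<in> {1..m}"
  shows "AE r in lborel_tuples m. r n \<noteq> c"
proof -
  interpret product_sigma_finite "\<lambda>_. lborel :: real measure" ..
  define A where "A l = (if l = n then {c} else UNIV)" for l
  let ?L = "lborel_tuples m"
  have "emeasure ?L (Pi\<^sub>E {1..m} A) = (\<Prod>l\<in>{1..m}. emeasure lborel (A l))"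
    by (rule emeasure_PiM) (auto simp: A_def)
  also have "\<dots> = 0" using assms by (intro prod_zero) (auto simp: A_def)
  finally have "Pi\<^sub>E {1..m} A \<in> null_sets ?L"
    by (intro null_setsI sets_PiM_I_finite) (auto simp: A_def)
  then show ?thesis
    by (rule AE_I') (use assms in \<open>auto simp: A_def space_PiM PiE_iff extensional_def\<close>)
qed

text \<open>With \<open>C\<close> the tuples that spread into \<open>U\<close>, the event is
  \<open>times_in C\<close>. \<open>C\<close> and \<open>C \<inter> \<Omega>\<close> differ only
  where r 1 = 0: hitting times from a start outside the sets are positive, and the hyperplane is
  Lebesgue null. So \<open>emeasure_times\<close> applies to
  \<open>C \<inter> \<Omega>\<close>.\<close>

theorem hitting_times_density:
  assumes U: "U \<in> sets K_tuples" "U \<subseteq> region K s"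
  defines "A \<equiv> {\<omega> \<in> space M. \<exists>t\<in>U. \<forall>k\<in>K. hit k \<omega> = ereal (t k)}"
  shows "A \<in> sets M"
    and "emeasure mix A = (\<integral>\<^sup>+t. ennreal (indicator U t * hit_density t) \<partial>region_measure K s)"
    and "\<And>t. t \<in> U \<Longrightarrow> 0 \<le> hit_density t"
    and "hit_density \<in> borel_measurable K_tuples"
proof -
  let ?L = "lborel_tuples m" and ?B = "tuple_space m"
  have LB: "sets ?L = sets ?B" by (intro sets_PiM_cong) auto
  have space: "space ?L = space ?B" using LB by (rule sets_eq_imp_space_eq)
  define C where "C = {r \<in> space ?B. spread K s r \<in> U}"
  have C: "C \<in> sets ?B"
    using measurable_sets[OF measurable_spread U(1)] by (simp add: C_def vimage_def Int_def conj_commute)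
  have A: "A = times_in C"
    unfolding A_def C_def by (rule hitting_event_eq[OF U(2)])
  show "A \<in> sets M" unfolding A by (rule times_sets[OF C])
  have C_reg: "r \<in> space ?B" "spread K s r \<in> region K s" if "r \<in> C" for r
    using that U(2) by (auto simp: C_def)
  have C_first: "r \<in> \<Omega> \<longleftrightarrow> r 1 \<noteq> 0" if "r \<in> C" for r
  proof
    assume "r \<in> \<Omega>"
    then show "r 1 \<noteq> 0" using m_pos by (force simp: pos_increasing_def)
  next
    assume r1: "r 1 \<noteq> 0"
    have "(if n = 1 then 0 else r (n - 1)) < r n" if n: "n \<in> {1..m}" for n
    proof (cases "n = 1")
      case True
      then show ?thesis using spread_mem_region(1)[OF C_reg[OF \<open>r \<in> C\<close>] n] r1 by simp
    next
      case False
      then have "n - 1 \<in> {1..m}" "n - 1 < n" using n by auto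
      then show ?thesis using spread_mem_region(2)[OF C_reg[OF \<open>r \<in> C\<close>] _ n] False by simp
    qed
    then show "r \<in> \<Omega>" using C_reg(1)[OF that] by (simp add: pos_increasing_def space_PiM)
  qed
  have "emeasure mix A = emeasure mix (times_in (C \<inter> \<Omega>))"
    unfolding A
  proof (intro emeasure_mix_cong times_sets sets.Int C pos_increasing_sets)
    fix \<omega> assume \<omega>: "\<omega> \<in> space M" "X 0 \<omega> \<in> W \<Gamma> s 1"
    have one: "1 \<in> {1..m}" using m_pos by simp
    note k = first_element_mem[OF one]
    have "times \<omega> 1 \<noteq> 0" if "\<omega> \<in> pattern"
      using pattern_hit[OF that one k]
        hitting_time_eq_iff[where X = X and \<omega> = \<omega> and G = "\<Gamma> (fst_idx 1)",
          OF right_continuous[OF \<omega>(1)] start_notin[OF \<omega>(2) one k]] by auto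
    then show "\<omega> \<in> times_in C \<longleftrightarrow> \<omega> \<in> times_in (C \<inter> \<Omega>)"
      using C_first by auto
  qed
  also have "\<dots> = (\<integral>\<^sup>+r. ennreal (density_fun r) * indicator (C \<inter> \<Omega>) r \<partial>?L)"
    by (intro emeasure_times sets.Int C pos_increasing_sets) auto
  also have "\<dots> = (\<integral>\<^sup>+r. ennreal (indicator U (spread K s r) * hit_density (spread K s r)) *
      indicator (increasing_tuples m) r \<partial>?L)"
  proof (rule nn_integral_cong_AE)
    have "AE r in ?L. r 1 \<noteq> 0" using m_pos by (intro AE_PiM_lborel_component_neq) simp
    with AE_space show "AE r in ?L. ennreal (density_fun r) * indicator (C \<inter> \<Omega>) r
        = ennreal (indicator U (spread K s r) * hit_density (spread K s r)) *
          indicator (increasing_tuples m) r"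
    proof eventually_elim
      case (elim r)
      show ?case
      proof (cases "r \<in> C")
        case True
        then have "r \<in> C \<inter> \<Omega>" "r \<in> increasing_tuples m" "spread K s r \<in> U"
          using C_first elim spread_mem_region(3)[OF C_reg[OF True]] by (auto simp: C_def)
        then show ?thesis by (simp add: hitting_density_spread)
      next
        case False
        have "r \<in> space ?B" using elim(1) by (simp only: space)
        with False have "spread K s r \<notin> U" by (simp only: C_def mem_Collect_eq simp_thms)
        with False show ?thesis by simp
      qed
    qed
  qed
  \<comment> \<open>The change of variables along \<open>spread\<close> requires measurability of
    the density, assumed here and discharged below with the last claim.\<close>
  also have "\<dots> = (\<integral>\<^sup>+t. ennreal (indicator U t * hit_density t) \<partial>region_measure K s)"
    if "hit_density \<in> borel_measurable K_tuples"
  proof -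
    have [measurable]: "hit_density \<in> borel_measurable K_tuples" by fact
    have [measurable]: "U \<in> sets K_tuples" by fact
    have spread: "spread K s \<in> measurable (restrict_space ?L (increasing_tuples m)) K_tuples"
      using measurable_spread measurable_cong_sets[OF LB refl] by (intro measurable_restrict_space1) blast
    have inc: "increasing_tuples m \<inter> space ?L \<in> sets ?L"
      using increasing_tuples_sets by (simp only: LB space sets.Int sets.top)
    show ?thesis
      unfolding region_measure_def
      by (subst nn_integral_distr[OF spread]) (measurable, subst nn_integral_restrict_space[OF inc], rule refl)
  qed
  finally have *: "emeasure mix A = (\<integral>\<^sup>+t. ennreal (indicator U t * hit_density t) \<partial>region_measure K s)"
    if "hit_density \<in> borel_measurable K_tuples"
    using that by simp
  show meas: "hit_density \<in> borel_measurable K_tuples"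
  proof -
    define F where "F t n = matrix_exp ((tbar s t n - tbar s t (n - 1)) *\<^sub>R block \<Lambda> (W \<Gamma> s n) (W \<Gamma> s n))
        ** block \<Lambda> (W \<Gamma> s n) (T \<Gamma> s n)" for t n
    have tbar: "(\<lambda>t. tbar s t n) \<in> borel_measurable K_tuples" if "n \<le> m" for n
      using that first_element_mem_K[of n] unfolding tbar_def
      by (cases "n = 0") (auto intro: measurable_component_singleton)
    have "(\<lambda>t. matrix_prod (F t) m $ i $ j) \<in> borel_measurable K_tuples" for i j
      unfolding F_def
      by (intro borel_measurable_matrix_prod borel_measurable_matrix_mult borel_measurable_matrix_exp
          borel_measurable_diff tbar) auto
    then show ?thesis
      unfolding hitting_density_def[abs_def] F_def[symmetric]
      by (simp add: vector_matrix_mult_def inner_vec_def)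
  qed
  show "emeasure mix A = (\<integral>\<^sup>+t. ennreal (indicator U t * hit_density t) \<partial>region_measure K s)"
    by (rule *[OF meas])
  fix t assume t: "t \<in> U"
  \<comment> \<open>This tuple spreads back to t, which reduces the sign of the density to
    \<open>chain_density_nonneg\<close>.\<close>
  define r where "r = (\<lambda>n\<in>{1..m}. t (fst_idx n))"
  have spread: "spread K s r = t"
  proof
    fix k
    show "spread K s r k = t k"
    proof (cases "k \<in> K")
      case True
      then obtain n where n: "n \<in> {1..m}" "k \<in> component s n" by (rule component_of)
      have "t k = t (fst_idx n)"
        using t U(2) n first_element_mem[OF n(1)] unfolding region_def by blast
      then show ?thesis using n by (simp add: spread_component r_def)
    next
      case False
      then show ?thesis using t U(2) by (auto simp: spread_def region_def PiE_iff extensional_def)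
    qed
  qed
  have reg: "r \<in> space ?B" "spread K s r \<in> region K s"
    using t U(2) by (simp add: r_def space_PiM, unfold spread, blast)
  have "0 \<le> density_fun r"
  proof (rule chain_density_nonneg[where V = "W \<Gamma> s" and G = "T \<Gamma> s" and m = m, OF W_T_chain alpha_nonneg])
    fix n assume n: "1 \<le> n" "n \<le> m"
    then have n': "n \<in> {1..m}" by simp
    show "(if n = 1 then 0 else r (n - 1)) \<le> r n"
    proof (cases "n = 1")
      case False
      then have "n - 1 \<in> {1..m}" "n - 1 < n" using n by auto
      then show ?thesis using spread_mem_region(2)[OF reg _ n'] False by (simp add: less_imp_le)
    qed (use spread_mem_region(1)[OF reg n'] in simp)
  qed
  then show "0 \<le> hit_density t"
    using hitting_density_spread[of r] by (simp add: spread)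
qed

end

text \<open>Measurability of the event and integrability of the density are asserted together with
  the equation, since \<open>measure\<close> and the Bochner integral would otherwise take the
  default value 0. Hitting times are extended reals, so membership in U is expressed through a real
  point t with the same coordinates.\<close>

theorem theorem3p2:
  fixes M :: "'w measure"
    and P :: "'o::finite \<Rightarrow> 'w measure"
    and X :: "real \<Rightarrow> 'w \<Rightarrow> 'o"
    and \<Lambda> :: "real ^ 'o ^ 'o"
    and K :: "'k set"
    and \<Gamma> :: "'k \<Rightarrow> 'o set"
    and \<alpha> :: "real ^ 'o"
    and s :: "'k set list"
  assumes "finite_markov_process M P X \<Lambda>"
    and "finite K" and "K \<noteq> {}"
    and "UNIV - (\<Union>k\<in>K. \<Gamma> k) \<noteq> {}"
    and "prob_vector \<alpha>"
    and "(\<Sum>i\<in>UNIV - (\<Union>k\<in>K. \<Gamma> k). \<alpha> $ i) = 1"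
    and "ordered_partition K s"
  shows "\<forall>U \<in> sets (Pi\<^sub>M K (\<lambda>_. borel :: real measure)). U \<subseteq> region K s \<longrightarrow>
    (let E = {\<omega> \<in> space M. \<exists>t\<in>U. \<forall>k\<in>K. hitting_time X (\<Gamma> k) \<omega> = ereal (t k)} in
      E \<in> sets M \<and>
      set_integrable (region_measure K s) U (hitting_density \<Lambda> \<Gamma> s \<alpha>) \<and>
      measure (mixture M P \<alpha>) E = (LINT t:U|region_measure K s. hitting_density \<Lambda> \<Gamma> s \<alpha> t))"
proof (intro ballI impI)
  fix U assume U: "U \<in> sets (Pi\<^sub>M K (\<lambda>_. borel :: real measure))" "U \<subseteq> region K s"
  interpret markov_hitting M P X \<Lambda> K s \<Gamma> \<alpha>
    using assms by (auto simp: markov_hitting_def markov_hitting_axioms_def hitting_partition_def)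
  define A where "A = {\<omega> \<in> space M. \<exists>t\<in>U. \<forall>k\<in>K. hitting_time X (\<Gamma> k) \<omega> = ereal (t k)}"
  let ?f = "\<lambda>t. indicator U t * hitting_density \<Lambda> \<Gamma> s \<alpha> t"
  have A: "A \<in> sets M"
    and emeasure_A: "emeasure mix A = (\<integral>\<^sup>+t. ennreal (?f t) \<partial>region_measure K s)"
    unfolding A_def by (rule hitting_times_density[OF U])+
  \<comment> \<open>The finite total mass of the mixture bounds the nonnegative integral, and this
    yields integrability.\<close>
  have "emeasure mix A \<le> emeasure mix (space M)"
    using A sets.sets_into_space[OF A] by (intro emeasure_mono) (auto simp: sets_mixture)
  also have "\<dots> < \<infinity>"
    using prob_space.emeasure_space_1[OF prob_space_P]
    by (simp add: emeasure_mixture sum_ennreal alpha_nonneg)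
  finally have finite: "emeasure mix A < \<infinity>" .
  have nonneg: "0 \<le> ?f t" for t
    using hitting_times_density(3)[OF U] by (simp add: indicator_def)
  have meas: "?f \<in> borel_measurable (region_measure K s)"
  proof -
    have "sets (region_measure K s) = sets (Pi\<^sub>M K (\<lambda>_. borel))" by (simp add: region_measure_def)
    then show ?thesis
      using U(1) hitting_times_density(4)[OF U]
      by (subst measurable_cong_sets[OF _ refl]) (auto intro!: borel_measurable_times)
  qed
  have integrable: "integrable (region_measure K s) ?f"
    using finite nonneg meas by (intro integrableI_nonneg) (simp_all add: emeasure_A)
  then have "(\<integral>t. ?f t \<partial>region_measure K s) = measure mix A"
    unfolding measure_def emeasure_A using nonneg meas by (intro integral_eq_nn_integral) simp_all
  then show "let E = {\<omega> \<in> space M. \<exists>t\<in>U. \<forall>k\<in>K. hitting_time X (\<Gamma> k) \<omega> = ereal (t k)} in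
      E \<in> sets M \<and>
      set_integrable (region_measure K s) U (hitting_density \<Lambda> \<Gamma> s \<alpha>) \<and>
      measure (mixture M P \<alpha>) E = (LINT t:U|region_measure K s. hitting_density \<Lambda> \<Gamma> s \<alpha> t)"
    using A integrable
    by (simp add: A_def Let_def set_integrable_def set_lebesgue_integral_def)
qed

end
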